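(* Fix $p\in[\tfrac23,1)$ and let $\mu_p=\tfrac12(2-p)^d$. Conditionally on a realization of $Q_{d,p}$: - let $\mathsf{UniformSampler}$ be the uniform distribution on independent sets of $Q_{d,p}$; - let $\mathsf{DefectSize}$ be the law of $\min(|S\cap\mathsf{Even}|,|S\cap\mathsf{Odd}|)$ for $S\sim\mathsf{UniformSampler}$. Then, as $d\to\infty$, \[ \big\|\mathsf{DefectSize}-\mathrm{Poisson}(\mu_p)\big\|_{TV}\xrightarrow{\mathbb P}0 . \] That is, for every $\varepsilon>0$, the probability (over the percolation) that this total variation distance exceeds $\varepsilon$ tends to $0$.
   Context: Setup: - $Q_d=\{0,1\}^d$ is the hypercube graph, with edges between strings differing in exactly one coordinate. - $\mathsf{Even}$ and $\mathsf{Odd}$ are the sets of vertices of even and odd Hamming weight, respectively. - For fixed $p\in(0,1)$, $Q_{d,p}$ is obtained by retaining each edge of $Q_d$ independently with probability $p$. - Independent sets of $Q_{d,p}$ include the empty set. - $\|\cdot\|_{TV}$ is total variation distance. *)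

theory Defs
  imports "HOL-Probability.Probability"
begin

text \<open>Vertices of the hypercube Q_d: a 0/1 string of length d is identified with
  its support, a subset of {0..<d}. Hamming weight = card.\<close>
definition cube :: "nat \<Rightarrow> nat set set" where
  "cube d = Pow {..<d}"

definition cube_edges :: "nat \<Rightarrow> nat set set set" where
  "cube_edges d = {{x, y} | x y. x \<in> cube d \<and> y \<in> cube d \<and> card (x - y \<union> (y - x)) = 1}"

definition Even_v :: "nat \<Rightarrow> nat set set" where
  "Even_v d = {x \<in> cube d. even (card x)}"

definition Odd_v :: "nat \<Rightarrow> nat set set" where
  "Odd_v d = {x \<in> cube d. odd (card x)}"

definition indep_sets :: "nat \<Rightarrow> nat set set set \<Rightarrow> nat set set set" where
  "indep_sets d F = {S. S \<subseteq> cube d \<and> (\<forall>e\<in>F. \<not> e \<subseteq> S)}"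

text \<open>Law of the percolation Q_{d,p}: probability of an event (a set of edge subsets),
  each edge retained independently with probability p.\<close>
definition perc_prob :: "nat \<Rightarrow> real \<Rightarrow> nat set set set set \<Rightarrow> real" where
  "perc_prob d p A = (\<Sum>F\<in>{F. F \<subseteq> cube_edges d \<and> F \<in> A}.
       p ^ card F * (1 - p) ^ (card (cube_edges d) - card F))"

definition UniformSampler :: "nat \<Rightarrow> nat set set set \<Rightarrow> nat set set pmf" where
  "UniformSampler d F = pmf_of_set (indep_sets d F)"

definition DefectSize :: "nat \<Rightarrow> nat set set set \<Rightarrow> nat pmf" where
  "DefectSize d F = map_pmf (\<lambda>S. min (card (S \<inter> Even_v d)) (card (S \<inter> Odd_v d)))
                            (UniformSampler d F)"

definition tv_dist :: "'a pmf \<Rightarrow> 'a pmf \<Rightarrow> real" where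
  "tv_dist P Q = (SUP A. \<bar>measure_pmf.prob P A - measure_pmf.prob Q A\<bar>)"

end

theory Submission
  imports Defs "HOL-Real_Asymp.Real_Asymp"
begin

text \<open>
  Put \<open>q = 1 - p\<close> and \<open>N = 2 ^ (d - 1)\<close>, and call a set of vertices of one side spread if no two of its
  vertices have a common neighbour in the cube. An independent set whose part \<open>A\<close> on one side is spread can be
  completed on the other side in exactly \<open>2 ^ N\<close> times \<open>\<Prod>v\<in>A. 2 ^ - deg v\<close> ways. The weights \<open>2 ^ - deg v\<close>
  are independent with mean \<open>(1 - p / 2) ^ d\<close>; since \<open>p \<ge> 2/3\<close>, their sum has variance at most \<open>1/2\<close> around
  \<open>(2 - p) ^ d / 2\<close>, and the pairs that share a neighbour have total weight \<open>O(1)\<close>. Hence the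
  size of \<open>A\<close> is nearly Poisson.

  The other independent sets are controlled in expectation by \<open>\<Sum>q ^ e(A, B)\<close> over pairs \<open>A, B\<close> that are both
  not spread. Either one of \<open>A\<close> and \<open>B\<close> splits into polymers (sets that are linked through common
  neighbours) of not too large closure, at least one of which is not a singleton, or both have
  almost full neighbourhoods. The polymers of size at least two have exponentially small total weight: small ones by a direct
  count, large ones by Sapozhenko's graph containers together with Talagrand's isoperimetric inequality.
  The pairs with large neighbourhoods are excluded by a tilted Hoelder inequality.
\<close>

section \<open>A generalised Hoelder inequality, greedy covers and counting linked sets\<close>

text \<open>The mean defect number \<open>mu = (2 - p) ^ d / 2\<close> is exponentially large, so an
  error is affordable only relative to \<open>exp mu\<close>, the contribution of isolated defects.
  Hence the factor of the singletons is kept at the true \<open>q\<close>, while the other defects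
  are estimated at the worst value \<open>q = 1/3\<close>. The threshold 2/3 is where
  \<open>1 - 3 * p / 4 \<le> 1/2\<close>: exactly then \<open>N * (1 - 3 * p / 4) ^ d\<close>, the
  bound for the variance of the total weight, stays bounded. A Poisson law of mean \<open>mu\<close>
  has standard deviation \<open>sqrt mu\<close>, so an error of order \<open>sqrt d\<close> in its
  mean is invisible. The container argument lives on the gap between a neighbourhood and its
  closure. Isoperimetry gives a relative gap of order \<open>1 / sqrt d\<close>, but only while the
  closure leaves out a fixed share \<open>eps\<close> of the side; this is why pairs with almost
  full neighbourhoods need a separate argument, with \<open>eps = 1/1000\<close>. A set that is
  spread on both sides would be counted twice. It has at most \<open>N / d\<close> vertices on each
  side, and such sets are few compared with \<open>2 ^ N\<close>.\<close>

lemma prod_le_mean_power: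
  fixes x :: "'a \<Rightarrow> real"
  assumes "finite I" "k \<ge> 1" "k \<le> card I" "\<And>i. i \<in> I \<Longrightarrow> 0 \<le> x i" "\<And>i. i \<in> I \<Longrightarrow> x i \<le> 1"
  shows "(\<Prod>i\<in>I. x i) \<le> (\<Sum>i\<in>I. x i ^ k) / card I"
proof -
  have ne: "I \<noteq> {}" using assms by auto
  let ?P = "\<Prod>i\<in>I. x i"
  have P0: "0 \<le> ?P" using assms by (simp add: prod_nonneg)
  have P1: "?P \<le> 1" using assms by (simp add: prod_le_1)
  have eq: "(\<Prod>i\<in>I. x i ^ k) = ?P ^ k" by (simp add: prod_power_distrib)
  \<comment> \<open>As the product lies in [0, 1], raising it to the power
    \<open>k / card I \<le> 1\<close> does not decrease it. The arithmetic-geometric mean inequality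
    then applies to the \<open>k\<close>-th powers.\<close>
  have "?P \<le> (?P ^ k) powr (1 / card I)"
  proof (cases "?P = 0")
    case True
    then show ?thesis by simp
  next
    case False
    then have pos: "?P > 0" using P0 by simp
    have "(?P ^ k) powr (1 / card I) = ?P powr (k / card I)"
      using pos by (simp add: powr_realpow[symmetric] powr_powr)
    moreover have "?P powr 1 \<le> ?P powr (k / card I)"
      using pos P1 assms by (intro powr_mono') (auto simp: divide_simps)
    ultimately show ?thesis using pos by simp
  qed
  also have "\<dots> \<le> (\<Sum>i\<in>I. x i ^ k / card I)"
    using arith_geom_mean[of I "\<lambda>i. x i ^ k"] assms ne by (simp add: eq)
  finally show ?thesis by (simp add: sum_divide_distrib)
qed

text \<open>The one-variable case of the inequality below, with \<open>k\<close> or more factors.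
  After division by the roots all ratios lie in [0, 1], and \<open>prod_le_mean_power\<close> bounds
  the two products by means of \<open>k\<close>-th powers that add up to 1.\<close>

lemma prod_add_prod_le_prod_root:
  fixes a b :: "'a \<Rightarrow> real"
  assumes fin: "finite I" and k: "k \<ge> 1" "k \<le> card I"
    and a: "\<And>i. i \<in> I \<Longrightarrow> 0 \<le> a i" and b: "\<And>i. i \<in> I \<Longrightarrow> 0 \<le> b i"
  shows "(\<Prod>i\<in>I. a i) + (\<Prod>i\<in>I. b i) \<le> (\<Prod>i\<in>I. root k (a i ^ k + b i ^ k))"
proof -
  define c where "c i = root k (a i ^ k + b i ^ k)" for i
  have ck: "c i ^ k = a i ^ k + b i ^ k" if "i \<in> I" for i
    unfolding c_def using k a[OF that] b[OF that] by (intro real_root_pow_pos2) auto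
  have c0: "0 \<le> c i" if "i \<in> I" for i
    unfolding c_def using k a[OF that] b[OF that] by (intro real_root_ge_zero) auto
  have I0: "card I > 0" using k by simp
  show ?thesis
  proof (cases "\<exists>i\<in>I. c i = 0")
    case True
    then obtain i where i: "i \<in> I" "c i = 0" by auto
    have "a i ^ k + b i ^ k = 0" using ck[OF i(1)] i(2) k by (metis not_one_le_zero power_0_left)
    then have "a i ^ k = 0" "b i ^ k = 0" using a[OF i(1)] b[OF i(1)]
      by (metis add_nonneg_eq_0_iff zero_le_power)+
    then have "a i = 0" "b i = 0" by auto
    then have "prod a I = 0" "prod b I = 0" using i(1) fin by auto
    then show ?thesis using c0 by (simp add: prod_nonneg c_def[symmetric])
  next
    case False
    then have cpos: "c i > 0" if "i \<in> I" for i using c0[OF that] that by force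
    have le: "prod e I \<le> prod c I * ((\<Sum>i\<in>I. (e i / c i) ^ k) / card I)"
      if e: "\<And>i. i \<in> I \<Longrightarrow> 0 \<le> e i" "\<And>i. i \<in> I \<Longrightarrow> e i ^ k \<le> c i ^ k" for e
    proof -
      have "prod e I = prod c I * (\<Prod>i\<in>I. e i / c i)"
      proof -
        have "(\<Prod>i\<in>I. e i) = (\<Prod>i\<in>I. c i * (e i / c i))"
          using cpos by (intro prod.cong) (auto simp: less_imp_neq[symmetric])
        then show ?thesis by (simp only: prod.distrib)
      qed
      also have "(\<Prod>i\<in>I. e i / c i) \<le> (\<Sum>i\<in>I. (e i / c i) ^ k) / card I"
      proof (rule prod_le_mean_power[OF fin k])
        fix i assume i: "i \<in> I"
        show "0 \<le> e i / c i" using e(1)[OF i] cpos[OF i] by simp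
        have "e i \<le> c i" using e[OF i] c0[OF i] k by (meson power_le_imp_le_base[of _ "k - 1"] power_mono_iff less_le_trans zero_less_one)
        then show "e i / c i \<le> 1" using cpos[OF i] by simp
      qed
      finally show ?thesis using c0 by (simp add: mult_left_mono prod_nonneg)
    qed
    have "prod a I + prod b I \<le> prod c I * ((\<Sum>i\<in>I. (a i / c i) ^ k) / card I)
        + prod c I * ((\<Sum>i\<in>I. (b i / c i) ^ k) / card I)"
      using a b ck by (intro add_mono le) auto
    also have "\<dots> = prod c I * ((\<Sum>i\<in>I. (a i ^ k + b i ^ k) / c i ^ k) / card I)"
      by (simp add: power_divide add_divide_distrib sum.distrib distrib_left)
    also have "(\<Sum>i\<in>I. (a i ^ k + b i ^ k) / c i ^ k) = (\<Sum>i\<in>I. 1)"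
    proof (rule sum.cong[OF refl])
      fix i assume i: "i \<in> I"
      have "c i ^ k \<noteq> 0" using cpos[OF i] by simp
      then show "(a i ^ k + b i ^ k) / c i ^ k = 1" by (simp add: ck[OF i])
    qed
    finally show ?thesis using I0 by (simp add: c_def)
  qed
qed

text \<open>Finner's inequality with the uniform exponent \<open>k\<close>: it suffices that every variable lies in at least \<open>k\<close> of the scopes.\<close>

lemma holder_local:
  fixes f :: "'b \<Rightarrow> 'a set \<Rightarrow> real"
  assumes "finite S" and finF: "finite F" and k: "k \<ge> 1"
    and cov: "\<And>x. x \<in> S \<Longrightarrow> k \<le> card {y \<in> F. x \<in> N y}"
    and nonneg: "\<And>y T. 0 \<le> f y T"
  shows "(\<Sum>A\<in>Pow S. \<Prod>y\<in>F. f y (A \<inter> N y)) \<le> (\<Prod>y\<in>F. root k (\<Sum>T\<in>Pow (S \<inter> N y). f y T ^ k))"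
  using assms(1) cov nonneg
proof (induction S arbitrary: f rule: finite_induct)
  case empty
  have "root k (f y {} ^ k) = f y {}" for y using k empty by (simp add: real_root_power_cancel)
  then show ?case by simp
next
  case (insert x S)
  let ?F1 = "{y\<in>F. x \<in> N y}" and ?F2 = "{y\<in>F. x \<notin> N y}"
  \<comment> \<open>Summing out \<open>x\<close> replaces each factor whose scope contains
    \<open>x\<close> by the \<open>l^k\<close> norm of its two values; the remaining factors are
    common to both terms.\<close>
  define f' where "f' y T = (if x \<in> N y then root k (f y T ^ k + f y (insert x T) ^ k) else f y T)" for y T
  have f'0: "0 \<le> f' y T" for y T
    unfolding f'_def using insert.prems(2) k by (auto intro!: real_root_ge_zero)
  have f'k: "f' y T ^ k = f y T ^ k + f y (insert x T) ^ k" if "x \<in> N y" for y T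
    unfolding f'_def using that insert.prems(2) k by (simp add: real_root_pow_pos2)
  have split: "(\<Prod>y\<in>F. g y) = (\<Prod>y\<in>?F1. g y) * (\<Prod>y\<in>?F2. g y)" for g :: "'b \<Rightarrow> real"
  proof -
    have "F = ?F1 \<union> ?F2" by auto
    then show ?thesis by (metis (no_types, lifting) finF prod.union_disjoint disjoint_iff finite_Un mem_Collect_eq)
  qed
  have "(\<Sum>A\<in>Pow (insert x S). \<Prod>y\<in>F. f y (A \<inter> N y))
      = (\<Sum>A\<in>Pow S. \<Prod>y\<in>F. f y (A \<inter> N y)) + (\<Sum>A\<in>insert x ` Pow S. \<Prod>y\<in>F. f y (A \<inter> N y))"
    unfolding Pow_insert using insert.hyps by (intro sum.union_disjoint) auto
  also have "(\<Sum>A\<in>insert x ` Pow S. \<Prod>y\<in>F. f y (A \<inter> N y)) = (\<Sum>A\<in>Pow S. \<Prod>y\<in>F. f y (insert x A \<inter> N y))"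
    by (subst sum.reindex) (use insert.hyps in \<open>auto intro!: inj_onI simp: o_def\<close>)
  also have "(\<Sum>A\<in>Pow S. \<Prod>y\<in>F. f y (A \<inter> N y)) + \<dots>
      = (\<Sum>A\<in>Pow S. (\<Prod>y\<in>F. f y (A \<inter> N y)) + (\<Prod>y\<in>F. f y (insert x A \<inter> N y)))"
    by (simp add: sum.distrib)
  also have "\<dots> \<le> (\<Sum>A\<in>Pow S. \<Prod>y\<in>F. f' y (A \<inter> N y))"
  proof (rule sum_mono)
    fix A assume "A \<in> Pow S"
    have e1: "(\<Prod>y\<in>?F2. f y (insert x A \<inter> N y)) = (\<Prod>y\<in>?F2. f y (A \<inter> N y))"
      by (intro prod.cong) auto
    have e2: "(\<Prod>y\<in>?F1. f y (insert x A \<inter> N y)) = (\<Prod>y\<in>?F1. f y (insert x (A \<inter> N y)))"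
      by (intro prod.cong) auto
    have e3: "(\<Prod>y\<in>?F2. f' y (A \<inter> N y)) = (\<Prod>y\<in>?F2. f y (A \<inter> N y))"
      by (intro prod.cong) (auto simp: f'_def)
    have e4: "(\<Prod>y\<in>?F1. f' y (A \<inter> N y)) = (\<Prod>y\<in>?F1. root k (f y (A \<inter> N y) ^ k + f y (insert x (A \<inter> N y)) ^ k))"
      by (intro prod.cong) (auto simp: f'_def)
    have "(\<Prod>y\<in>?F1. f y (A \<inter> N y)) + (\<Prod>y\<in>?F1. f y (insert x (A \<inter> N y))) \<le> (\<Prod>y\<in>?F1. f' y (A \<inter> N y))"
      unfolding e4 using finF k insert.prems by (intro prod_add_prod_le_prod_root) auto
    then have "((\<Prod>y\<in>?F1. f y (A \<inter> N y)) + (\<Prod>y\<in>?F1. f y (insert x (A \<inter> N y)))) * (\<Prod>y\<in>?F2. f y (A \<inter> N y))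
       \<le> (\<Prod>y\<in>?F1. f' y (A \<inter> N y)) * (\<Prod>y\<in>?F2. f y (A \<inter> N y))"
      by (intro mult_right_mono prod_nonneg) (auto simp: insert.prems)
    then show "(\<Prod>y\<in>F. f y (A \<inter> N y)) + (\<Prod>y\<in>F. f y (insert x A \<inter> N y)) \<le> (\<Prod>y\<in>F. f' y (A \<inter> N y))"
      unfolding split[of "\<lambda>y. f y (A \<inter> N y)"] split[of "\<lambda>y. f y (insert x A \<inter> N y)"] split[of "\<lambda>y. f' y (A \<inter> N y)"] e1 e2 e3
      by (simp add: distrib_right)
  qed
  also have "\<dots> \<le> (\<Prod>y\<in>F. root k (\<Sum>T\<in>Pow (S \<inter> N y). f' y T ^ k))"
    using insert.prems f'0 by (intro insert.IH) auto
  also have "\<dots> = (\<Prod>y\<in>F. root k (\<Sum>T\<in>Pow (insert x S \<inter> N y). f y T ^ k))"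
  proof (intro prod.cong refl arg_cong[where f = "root k"])
    fix y assume "y \<in> F"
    show "(\<Sum>T\<in>Pow (S \<inter> N y). f' y T ^ k) = (\<Sum>T\<in>Pow (insert x S \<inter> N y). f y T ^ k)"
    proof (cases "x \<in> N y")
      case True
      have "(\<Sum>T\<in>Pow (insert x (S \<inter> N y)). f y T ^ k)
          = (\<Sum>T\<in>Pow (S \<inter> N y). f y T ^ k) + (\<Sum>T\<in>insert x ` Pow (S \<inter> N y). f y T ^ k)"
        unfolding Pow_insert using insert.hyps by (intro sum.union_disjoint) auto
      also have "(\<Sum>T\<in>insert x ` Pow (S \<inter> N y). f y T ^ k) = (\<Sum>T\<in>Pow (S \<inter> N y). f y (insert x T) ^ k)"
        by (subst sum.reindex) (use insert.hyps in \<open>auto intro!: inj_onI simp: o_def\<close>)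
      finally show ?thesis using True by (simp add: f'k sum.distrib)
    next
      case False
      then show ?thesis by (simp add: f'_def)
    qed
  qed
  finally show ?case .
qed

text \<open>Keep choosing a vertex that covers at least \<open>\<theta>\<close> points of
  \<open>U\<close> not covered so far. Each choice uses up \<open>\<theta>\<close> points, which
  bounds their number; when no choice is left, every vertex of \<open>V\<close> has fewer than
  \<open>\<theta>\<close> uncovered neighbours.\<close>

lemma greedy_cover:
  fixes N :: "'v \<Rightarrow> 'u set" and \<theta> :: real
  assumes "finite U" "\<theta> > 0"
  shows "\<exists>X\<subseteq>V. finite X \<and> \<theta> * card X \<le> card U \<and> (\<forall>v\<in>X. N v \<inter> U \<noteq> {}) \<and>
      (\<forall>v\<in>V. card (N v \<inter> U - \<Union> (N ` X)) < \<theta>)"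
  using assms(1)
proof (induction "card U" arbitrary: U rule: less_induct)
  case less
  show ?case
  proof (cases "\<forall>v\<in>V. card (N v \<inter> U) < \<theta>")
    case True
    then show ?thesis using assms by (intro exI[of _ "{}"]) auto
  next
    case False
    then obtain v where v: "v \<in> V" "card (N v \<inter> U) \<ge> \<theta>" by (auto simp: not_less)
    have pos: "card (N v \<inter> U) > 0" using v assms by (metis less_le_trans of_nat_0_less_iff)
    have eq: "card U = card (N v \<inter> U) + card (U - N v)"
      using less.prems by (metis Int_commute card_Int_Diff)
    then have "card (U - N v) < card U" using pos by simp
    from less.hyps[OF this] less.prems obtain X where X: "X \<subseteq> V" "finite X" "\<theta> * card X \<le> card (U - N v)"
      "\<forall>w\<in>X. N w \<inter> (U - N v) \<noteq> {}" "\<forall>w\<in>V. card (N w \<inter> (U - N v) - \<Union> (N ` X)) < \<theta>" by auto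
    have "\<theta> * card (insert v X) \<le> \<theta> * (card X + 1)"
      using assms X(2) by (intro mult_left_mono) (auto simp: card_insert_if)
    also have "\<dots> \<le> card U" using X(3) v(2) eq by (simp add: algebra_simps)
    finally have 1: "\<theta> * card (insert v X) \<le> card U" .
    have "N w \<inter> U - \<Union> (N ` insert v X) = N w \<inter> (U - N v) - \<Union> (N ` X)" for w by auto
    then show ?thesis using 1 X v pos
      by (intro exI[of _ "insert v X"]) (auto simp: card_gt_0_iff)
  qed
qed

section \<open>Counting small subsets and connected subsets\<close>

lemma sum_Pow_power_card:
  assumes "finite U" shows "(\<Sum>X\<in>Pow U. (r::real) ^ card X) = (1 + r) ^ card U"
proof -
  have "(\<Prod>x\<in>U. r + 1) = (\<Sum>X\<in>Pow U. (\<Prod>x\<in>X. r) * (\<Prod>x\<in>U-X. 1))" by (rule prod_add[OF assms])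
  then show ?thesis by (simp add: add.commute)
qed

text \<open>Exponential weighting: a set of at most \<open>t\<close> elements has weight
  \<open>lam ^ card X\<close> at least \<open>lam powr t\<close>, and all subsets together have
  weight \<open>(1 + lam) ^ card U\<close>. A small \<open>lam\<close> makes the ground set harmless
  at the price of \<open>ln (1/lam)\<close> per element.\<close>

lemma card_small_subsets_le:
  fixes t lam :: real
  assumes "finite U" "0 < lam" "lam \<le> 1" "0 \<le> t"
  shows "real (card {X. X \<subseteq> U \<and> card X \<le> t}) \<le> exp (t * ln (1/lam) + lam * card U)"
proof -
  let ?D = "{X. X \<subseteq> U \<and> card X \<le> t}"
  have "real (card ?D) = (\<Sum>X\<in>?D. 1)" by simp
  also have "\<dots> \<le> (\<Sum>X\<in>?D. exp (t * ln (1/lam)) * lam ^ card X)"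
  proof (rule sum_mono)
    fix X assume "X \<in> ?D"
    then have "card X * ln (1/lam) \<le> t * ln (1/lam)" using assms by (intro mult_right_mono) auto
    then have "exp (card X * ln (1/lam)) \<le> exp (t * ln (1/lam))" by simp
    moreover have "exp (card X * ln (1/lam)) * lam ^ card X = 1"
      using assms by (simp add: exp_of_nat_mult power_mult_distrib[symmetric])
    ultimately show "1 \<le> exp (t * ln (1/lam)) * lam ^ card X"
      using assms by (metis mult_right_mono zero_le_power less_imp_le)
  qed
  also have "\<dots> \<le> (\<Sum>X\<in>Pow U. exp (t * ln (1/lam)) * lam ^ card X)"
    using assms by (intro sum_mono2) auto
  also have "\<dots> = exp (t * ln (1/lam)) * (1 + lam) ^ card U"
    using assms by (simp add: sum_distrib_left[symmetric] sum_Pow_power_card)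
  also have "(1 + lam) ^ card U \<le> exp lam ^ card U"
    using assms by (intro power_mono) auto
  also have "\<dots> = exp (lam * card U)" by (simp add: exp_of_nat2_mult)
  finally show ?thesis by (simp add: exp_add)
qed

text \<open>Connectedness in the form of cuts: no nonempty proper part is closed under adjacency.
  This form hands over the next vertex of a walk and, where it fails, a splitting into two
  parts.\<close>

definition linked :: "('a \<Rightarrow> 'a set) \<Rightarrow> 'a set \<Rightarrow> bool" where
  "linked nbr S \<longleftrightarrow> S \<noteq> {} \<and> (\<forall>T. T \<subset> S \<and> T \<noteq> {} \<longrightarrow> (\<exists>x\<in>T. \<exists>y\<in>S - T. y \<in> nbr x))"

text \<open>A new vertex \<open>y\<close> adjacent to a visited \<open>x\<close> is inserted as a
  detour from \<open>x\<close> to \<open>y\<close> and back, so each new vertex costs two steps, as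
  in the traversal of a spanning tree.\<close>

lemma linked_walk:
  assumes S: "linked nbr S" "finite S" "v \<in> S" and sym: "\<And>x y. x \<in> S \<Longrightarrow> y \<in> S \<Longrightarrow> y \<in> nbr x \<Longrightarrow> x \<in> nbr y"
    and "Suc n \<le> card S"
  shows "\<exists>w. length w = Suc (2 * n) \<and> hd w = v \<and> successively (\<lambda>a b. b \<in> nbr a) w
     \<and> set w \<subseteq> S \<and> card (set w) = Suc n"
  using assms(5)
proof (induction n)
  case 0
  then show ?case using S by (intro exI[of _ "[v]"]) auto
next
  case (Suc n)
  then obtain w where w: "length w = Suc (2 * n)" "hd w = v" "successively (\<lambda>a b. b \<in> nbr a) w"
    "set w \<subseteq> S" "card (set w) = Suc n" by auto
  have "set w \<subset> S" using w Suc.prems by auto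
  moreover have "set w \<noteq> {}" using w by auto
  ultimately obtain x y where xy: "x \<in> set w" "y \<in> S - set w" "y \<in> nbr x"
    using S unfolding linked_def by meson
  obtain xs ys where dec: "w = xs @ x # ys" using xy by (meson split_list)
  have xny: "x \<in> nbr y" using sym xy w by blast
  let ?w = "xs @ x # y # x # ys"
  have "successively (\<lambda>a b. b \<in> nbr a) ?w"
    using w(3) xy(3) xny unfolding dec by (auto simp: successively_append_iff)
  moreover have "set ?w = insert y (set w)" unfolding dec by auto
  moreover have "hd ?w = v" using w(2) unfolding dec by (cases xs) auto
  moreover have "length ?w = Suc (2 * Suc n)" using w(1) unfolding dec by auto
  ultimately show ?case using xy w by (intro exI[of _ ?w]) auto
qed

lemma walks_count:
  assumes nbr: "\<And>x. x \<in> V \<Longrightarrow> finite (nbr x) \<and> nbr x \<subseteq> V \<and> card (nbr x) \<le> D" and "v \<in> V"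
  shows "finite {w. length w = Suc n \<and> hd w = v \<and> successively (\<lambda>a b. b \<in> nbr a) w} \<and>
    card {w. length w = Suc n \<and> hd w = v \<and> successively (\<lambda>a b. b \<in> nbr a) w} \<le> D ^ n"
  using assms(2)
proof (induction n arbitrary: v)
  case 0
  have "{w. length w = Suc 0 \<and> hd w = v \<and> successively (\<lambda>a b. b \<in> nbr a) w} = {[v]}"
    by (auto simp: length_Suc_conv)
  then show ?case by simp
next
  case (Suc n)
  let ?W = "\<lambda>m v. {w. length w = Suc m \<and> hd w = v \<and> successively (\<lambda>a b. b \<in> nbr a) w}"
  have sub: "?W (Suc n) v \<subseteq> (\<Union>x\<in>nbr v. (#) v ` ?W n x)"
  proof
    fix w assume "w \<in> ?W (Suc n) v"
    then obtain u r where "w = v # u # r" "length r = n" "successively (\<lambda>a b. b \<in> nbr a) (v # u # r)"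
      by (auto simp: length_Suc_conv)
    then show "w \<in> (\<Union>x\<in>nbr v. (#) v ` ?W n x)" by (auto intro!: bexI[of _ u])
  qed
  have fin: "finite (\<Union>x\<in>nbr v. (#) v ` ?W n x)" using Suc nbr by blast
  have "card (?W (Suc n) v) \<le> card (\<Union>x\<in>nbr v. (#) v ` ?W n x)" by (rule card_mono[OF fin sub])
  also have "\<dots> \<le> (\<Sum>x\<in>nbr v. card ((#) v ` ?W n x))" using nbr[OF Suc.prems] by (intro card_UN_le) auto
  also have "\<dots> \<le> (\<Sum>x\<in>nbr v. D ^ n)"
  proof (rule sum_mono)
    fix x assume "x \<in> nbr v"
    then have "x \<in> V" using nbr Suc.prems by blast
    then show "card ((#) v ` ?W n x) \<le> D ^ n" using Suc.IH card_image_le le_trans by blast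
  qed
  also have "\<dots> \<le> D ^ Suc n" using nbr[OF Suc.prems] by simp
  finally show ?case using finite_subset[OF sub fin] by blast
qed

text \<open>The set is the range of a walk of \<open>2 * (t - 1)\<close> steps from
  \<open>v\<close>, so it suffices to count walks.\<close>

lemma linked_count:
  assumes nbr: "\<And>x. x \<in> V \<Longrightarrow> finite (nbr x) \<and> nbr x \<subseteq> V \<and> card (nbr x) \<le> D" and v: "v \<in> V"
    and sym: "\<And>x y. x \<in> V \<Longrightarrow> y \<in> V \<Longrightarrow> y \<in> nbr x \<Longrightarrow> x \<in> nbr y"
    and t: "t \<ge> 1" and V: "finite V"
  shows "card {S. S \<subseteq> V \<and> linked nbr S \<and> v \<in> S \<and> card S = t} \<le> D ^ (2 * t - 2)"
proof -
  let ?W = "{w. length w = Suc (2 * (t - 1)) \<and> hd w = v \<and> successively (\<lambda>a b. b \<in> nbr a) w}"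
  have "{S. S \<subseteq> V \<and> linked nbr S \<and> v \<in> S \<and> card S = t} \<subseteq> set ` ?W"
  proof
    fix S assume "S \<in> {S. S \<subseteq> V \<and> linked nbr S \<and> v \<in> S \<and> card S = t}"
    then have S: "S \<subseteq> V" "linked nbr S" "v \<in> S" "card S = t" by auto
    have fS: "finite S" using S V finite_subset by blast
    obtain w where w: "length w = Suc (2 * (t-1))" "hd w = v" "successively (\<lambda>a b. b \<in> nbr a) w"
     "set w \<subseteq> S" "card (set w) = Suc (t-1)"
      using linked_walk[OF S(2) fS S(3), of "t - 1"] sym S t by (auto simp: subset_iff)
    have "set w = S" using w S t fS by (intro card_subset_eq) auto
    then show "S \<in> set ` ?W" using w by blast
  qed
  moreover have W: "finite ?W \<and> card ?W \<le> D ^ (2 * (t - 1))" by (rule walks_count[OF nbr v])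
  ultimately have "card {S. S \<subseteq> V \<and> linked nbr S \<and> v \<in> S \<and> card S = t} \<le> card (set ` ?W)"
    by (intro card_mono) auto
  also have "\<dots> \<le> D ^ (2 * t - 2)" using W card_image_le[of ?W set] by (simp add: diff_mult_distrib2)
  finally show ?thesis .
qed

section \<open>Biregular bipartite graphs\<close>

lemma sum_UN_le:
  fixes f :: "'a \<Rightarrow> real"
  assumes "finite I" "\<And>i. i \<in> I \<Longrightarrow> finite (A i)" "\<And>x. 0 \<le> f x"
  shows "sum f (\<Union>i\<in>I. A i) \<le> (\<Sum>i\<in>I. sum f (A i))"
  using assms(1,2)
proof (induction I rule: finite_induct)
  case (insert i I)
  have "sum f (\<Union>j\<in>insert i I. A j) \<le> sum f (A i) + sum f (\<Union>j\<in>I. A j)"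
    using insert assms(3) by (simp add: sum_Un sum_nonneg)
  then show ?case using insert by force
qed simp

text \<open>Such a set arises in \<open>n\<close> rounds, each adding one element of
  \<open>M\<close> or nothing; the idle round \<open>None\<close> accounts for the
  \<open>+ 1\<close>.\<close>

lemma card_le_subsets_power:
  assumes "finite M"
  shows "card {T. T \<subseteq> M \<and> card T \<le> n} \<le> (card M + 1) ^ n"
proof (induction n)
  case 0
  have "{T. T \<subseteq> M \<and> card T \<le> 0} = {{}}" using assms by (auto dest: finite_subset)
  then show ?case by simp
next
  case (Suc n)
  let ?A = "{T. T \<subseteq> M \<and> card T \<le> n}"
  have fin: "finite ?A" using assms by simp
  have "{T. T \<subseteq> M \<and> card T \<le> Suc n} \<subseteq> (\<lambda>(T, x). case x of None \<Rightarrow> T | Some x \<Rightarrow> insert x T) ` (?A \<times> insert None (Some ` M))"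
  proof
    fix T assume T: "T \<in> {T. T \<subseteq> M \<and> card T \<le> Suc n}"
    have fT: "finite T" using T assms finite_subset by blast
    show "T \<in> (\<lambda>(T, x). case x of None \<Rightarrow> T | Some x \<Rightarrow> insert x T) ` (?A \<times> insert None (Some ` M))"
    proof (cases "T = {}")
      case True
      then show ?thesis by (intro image_eqI[of _ _ "({}, None)"]) auto
    next
      case False
      then obtain x where x: "x \<in> T" by auto
      then have "card (T - {x}) \<le> n" using T fT by (auto simp: card_Diff_singleton)
      then show ?thesis using x T by (intro image_eqI[of _ _ "(T - {x}, Some x)"]) auto
    qed
  qed
  then have "card {T. T \<subseteq> M \<and> card T \<le> Suc n} \<le> card (?A \<times> insert None (Some ` M))"
    using fin assms by (meson card_image_le card_mono finite_SigmaI finite_imageI finite_insert le_trans)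
  also have "\<dots> = card ?A * (card M + 1)"
    using assms by (simp add: card_cartesian_product card_image)
  also have "\<dots> \<le> (card M + 1) ^ Suc n" by (metis Suc.IH mult_le_mono1 power_Suc2)
  finally show ?case .
qed

locale biregular =
  fixes L R :: "'a set" and nb :: "'a \<Rightarrow> 'a set" and d :: nat
  assumes finL: "finite L" and finR: "finite R"
    and nbL: "x \<in> L \<Longrightarrow> nb x \<subseteq> R" and nbR: "y \<in> R \<Longrightarrow> nb y \<subseteq> L"
    and card_nb: "x \<in> L \<union> R \<Longrightarrow> card (nb x) = d"
    and nb_sym: "x \<in> L \<Longrightarrow> y \<in> R \<Longrightarrow> y \<in> nb x \<longleftrightarrow> x \<in> nb y"
    and d1: "d \<ge> 1"
begin

definition nbs :: "'a set \<Rightarrow> 'a set" where "nbs A = \<Union> (nb ` A)"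
definition cl :: "'a set \<Rightarrow> 'a set" where "cl Q = {x \<in> L. nb x \<subseteq> Q}"
text \<open>Normalised weight of all completions: if \<open>B \<subseteq> R\<close> is chosen freely
  with a factor \<open>q\<close> per edge between \<open>A\<close> and \<open>B\<close>, a vertex
  with \<open>k\<close> neighbours in \<open>A\<close> contributes \<open>1 + q ^ k\<close>, against
  2 for a vertex outside \<open>nbs A\<close>. See \<open>sum_second_side\<close>.\<close>

definition wt :: "real \<Rightarrow> 'a set \<Rightarrow> real" where
  "wt q A = (\<Prod>y\<in>nbs A. (1 + q ^ card (nb y \<inter> A)) / 2)"
text \<open>For \<open>x\<close> in \<open>L\<close> these are the vertices of \<open>L\<close>
  within distance 2, \<open>x\<close> included. Sets that are not joined by \<open>n2\<close> have
  disjoint neighbourhoods, so their weights multiply.\<close>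

definition n2 :: "'a \<Rightarrow> 'a set" where "n2 x = nbs (nb x)"
definition n6 :: "'a \<Rightarrow> 'a set" where "n6 x = (\<Union>u\<in>n2 x. \<Union>v\<in>n2 u. n2 v)"

lemma nbs_L: "A \<subseteq> L \<Longrightarrow> nbs A \<subseteq> R" using nbL unfolding nbs_def by blast
lemma nbs_R: "B \<subseteq> R \<Longrightarrow> nbs B \<subseteq> L" using nbR unfolding nbs_def by blast
lemma nbs_mono: "A \<subseteq> B \<Longrightarrow> nbs A \<subseteq> nbs B" unfolding nbs_def by blast
lemma fin_nb: "x \<in> L \<union> R \<Longrightarrow> finite (nb x)" using nbL nbR finL finR finite_subset by (metis Un_iff)
lemma nb_ne: "x \<in> L \<union> R \<Longrightarrow> nb x \<noteq> {}" using card_nb d1 by fastforce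
lemma fin_sub: "A \<subseteq> L \<Longrightarrow> finite A" "B \<subseteq> R \<Longrightarrow> finite B" using finL finR finite_subset by auto
lemma cl_sub: "cl Q \<subseteq> L" unfolding cl_def by auto
lemma nbs_iff: "A \<subseteq> L \<Longrightarrow> y \<in> R \<Longrightarrow> y \<in> nbs A \<longleftrightarrow> nb y \<inter> A \<noteq> {}"
  unfolding nbs_def using nb_sym by blast
lemma sub_cl_nbs: "A \<subseteq> L \<Longrightarrow> A \<subseteq> cl (nbs A)" unfolding nbs_def cl_def by blast
lemma nbs_cl: "nbs (cl Q) \<subseteq> Q" unfolding nbs_def cl_def by blast

lemma edge_count:
  assumes "A \<subseteq> L" "B \<subseteq> R"
  shows "(\<Sum>x\<in>A. card (nb x \<inter> B)) = (\<Sum>y\<in>B. card (nb y \<inter> A))"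
proof -
  have fA: "finite A" and fB: "finite B" using assms fin_sub by auto
  have "(\<Sum>x\<in>A. card (nb x \<inter> B)) = (\<Sum>x\<in>A. \<Sum>y\<in>B. if y \<in> nb x then 1 else 0)"
    using fB by (intro sum.cong refl) (simp add: sum.If_cases Int_commute)
  also have "\<dots> = (\<Sum>y\<in>B. \<Sum>x\<in>A. if y \<in> nb x then 1 else 0)" by (rule sum.swap)
  also have "\<dots> = (\<Sum>y\<in>B. \<Sum>x\<in>A. if x \<in> nb y then 1 else 0)"
    using assms nb_sym by (intro sum.cong refl) (auto simp: subset_iff)
  also have "\<dots> = (\<Sum>y\<in>B. card (nb y \<inter> A))"
    using fA by (intro sum.cong refl) (simp add: sum.If_cases Int_commute)
  finally show ?thesis .
qed

lemma edges_le: "A \<subseteq> L \<Longrightarrow> B \<subseteq> R \<Longrightarrow> (\<Sum>x\<in>A. card (nb x \<inter> B)) \<le> d * card B"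
proof -
  assume a: "A \<subseteq> L" "B \<subseteq> R"
  have "(\<Sum>y\<in>B. card (nb y \<inter> A)) \<le> (\<Sum>y\<in>B. d)"
    using a card_nb fin_nb by (intro sum_mono) (metis UnCI card_mono inf_le1 subsetD)
  then show ?thesis using edge_count[OF a] by (simp add: mult.commute)
qed

lemma edges_cl:
  assumes "Q \<subseteq> R"
  shows "(\<Sum>y\<in>Q. card (nb y \<inter> cl Q)) = d * card (cl Q)"
proof -
  have "(\<Sum>x\<in>cl Q. card (nb x \<inter> Q)) = (\<Sum>x\<in>cl Q. d)"
    using card_nb by (intro sum.cong refl) (auto simp: cl_def Int_absorb2)
  then show ?thesis using edge_count[OF cl_sub assms] by (simp add: mult.commute)
qed

lemma card_cl_le:
  assumes "Q \<subseteq> R" shows "card (cl Q) \<le> card Q"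
proof -
  have "(\<Sum>x\<in>cl Q. card (nb x \<inter> Q)) = (\<Sum>x\<in>cl Q. d)"
    using card_nb by (intro sum.cong refl) (auto simp: cl_def Int_absorb2)
  then have "d * card (cl Q) \<le> d * card Q" using edges_le[OF cl_sub[of Q] assms] by (simp add: mult.commute)
  then show ?thesis using d1 by simp
qed

text \<open>All \<open>d * card (cl Q)\<close> edges at \<open>cl Q\<close> end in \<open>Q\<close>,
  so the gap between \<open>Q\<close> and its closure measures the edges from \<open>Q\<close> to
  vertices outside \<open>cl Q\<close>. Every approximation error in \<open>container\<close> is
  charged to these edges.\<close>

lemma edges_out_cl:
  assumes "Q \<subseteq> R"
  shows "(\<Sum>y\<in>Q. card (nb y - cl Q)) = d * (card Q - card (cl Q))"
proof -
  have "(\<Sum>y\<in>Q. card (nb y \<inter> cl Q)) + (\<Sum>y\<in>Q. card (nb y - cl Q)) = (\<Sum>y\<in>Q. d)"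
    unfolding sum.distrib[symmetric]
  proof (rule sum.cong[OF refl])
    fix y assume "y \<in> Q"
    then show "card (nb y \<inter> cl Q) + card (nb y - cl Q) = d"
      using assms card_nb fin_nb card_Int_Diff by (metis UnCI subsetD)
  qed
  then show ?thesis using edges_cl[OF assms] by (simp add: diff_mult_distrib2 mult.commute)
qed

lemma edges_out_le:
  assumes "Q \<subseteq> R" "U \<subseteq> L - cl Q"
  shows "(\<Sum>x\<in>U. card (nb x \<inter> Q)) \<le> d * (card Q - card (cl Q))"
proof -
  have "(\<Sum>x\<in>U. card (nb x \<inter> Q)) = (\<Sum>y\<in>Q. card (nb y \<inter> U))" using assms by (intro edge_count) auto
  also have "\<dots> \<le> (\<Sum>y\<in>Q. card (nb y - cl Q))"
    using assms fin_nb by (intro sum_mono card_mono) auto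
  finally show ?thesis using edges_out_cl[OF assms(1)] by simp
qed

lemma card_nbs_le:
  assumes "A \<subseteq> L" shows "card (nbs A) \<le> d * card A"
proof -
  have "card (nbs A) \<le> (\<Sum>x\<in>A. card (nb x))"
    unfolding nbs_def using fin_sub(1)[OF assms] by (rule card_UN_le)
  also have "\<dots> = (\<Sum>x\<in>A. d)" using assms card_nb by (intro sum.cong) auto
  finally show ?thesis by (simp add: mult.commute)
qed

lemma n2_sub: "x \<in> L \<Longrightarrow> n2 x \<subseteq> L" unfolding n2_def using nbs_R nbL by blast
lemma n2_iff:
  assumes "x \<in> L" "y \<in> L" shows "y \<in> n2 x \<longleftrightarrow> nb x \<inter> nb y \<noteq> {}"
proof -
  have "y \<in> nb z \<longleftrightarrow> z \<in> nb y" if "z \<in> nb x" for z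
    using nb_sym[of y z] nbL[OF assms(1)] assms(2) that by blast
  then show ?thesis unfolding n2_def nbs_def by blast
qed
lemma n2_sym: "x \<in> L \<Longrightarrow> y \<in> L \<Longrightarrow> y \<in> n2 x \<Longrightarrow> x \<in> n2 y"
  using n2_iff[of x y] n2_iff[of y x] by blast
lemma n2_refl: "x \<in> L \<Longrightarrow> x \<in> n2 x" using n2_iff nb_ne by auto
lemma card_n2: "x \<in> L \<Longrightarrow> card (n2 x) \<le> d ^ 2"
proof -
  assume x: "x \<in> L"
  have "card (n2 x) \<le> (\<Sum>y\<in>nb x. card (nb y))" unfolding n2_def nbs_def using x fin_nb by (intro card_UN_le) auto
  also have "\<dots> = (\<Sum>y\<in>nb x. d)" using x nbL card_nb by (intro sum.cong) auto
  finally show ?thesis using x card_nb by (simp add: power2_eq_square)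
qed
lemma n6_sub: "x \<in> L \<Longrightarrow> n6 x \<subseteq> L" unfolding n6_def using n2_sub by blast
lemma n6_sym:
  assumes "x \<in> L" "y \<in> L" "y \<in> n6 x" shows "x \<in> n6 y"
proof -
  obtain u v where uv: "u \<in> n2 x" "v \<in> n2 u" "y \<in> n2 v" using assms unfolding n6_def by blast
  have "u \<in> L" "v \<in> L" using uv assms n2_sub by blast+
  then have "x \<in> n2 u" "u \<in> n2 v" "v \<in> n2 y" using uv assms n2_sym by blast+
  then show ?thesis unfolding n6_def by blast
qed
lemma card_n6: "x \<in> L \<Longrightarrow> card (n6 x) \<le> d ^ 6"
proof -
  assume x: "x \<in> L"
  have f: "finite (n2 u)" if "u \<in> L" for u using that n2_sub fin_sub by auto
  have a: "card (\<Union>v\<in>n2 u. n2 v) \<le> d ^ 4" if u: "u \<in> L" for u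
  proof -
    have "card (\<Union>v\<in>n2 u. n2 v) \<le> (\<Sum>v\<in>n2 u. card (n2 v))" using f[OF u] by (rule card_UN_le)
    also have "\<dots> \<le> (\<Sum>v\<in>n2 u. d ^ 2)" using u n2_sub card_n2 by (intro sum_mono) auto
    also have "\<dots> \<le> d ^ 2 * d ^ 2" by (simp only: sum_constant of_nat_id mult_le_mono1[OF card_n2[OF u]])
    also have "\<dots> = d ^ 4" by (simp add: power_add[symmetric])
    finally show ?thesis .
  qed
  have "card (n6 x) \<le> (\<Sum>u\<in>n2 x. card (\<Union>v\<in>n2 u. n2 v))" unfolding n6_def using f[OF x] by (rule card_UN_le)
  also have "\<dots> \<le> (\<Sum>u\<in>n2 x. d ^ 4)" using x n2_sub a by (intro sum_mono) auto
  also have "\<dots> \<le> d ^ 2 * d ^ 4" by (simp only: sum_constant of_nat_id mult_le_mono1[OF card_n2[OF x]])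
  also have "\<dots> = d ^ 6" by (simp add: power_add[symmetric])
  finally show ?thesis .
qed

lemma wt_nonneg: "0 \<le> q \<Longrightarrow> 0 \<le> wt q A" unfolding wt_def by (intro prod_nonneg) simp

lemma wt_le_power:
  assumes "A \<subseteq> L" "0 \<le> q" "q \<le> 1"
  shows "wt q A \<le> ((1 + q) / 2) ^ card (nbs A)"
proof -
  have "wt q A \<le> (\<Prod>y\<in>nbs A. (1 + q) / 2)"
    unfolding wt_def
  proof (rule prod_mono)
    fix y assume "y \<in> nbs A"
    then have "nb y \<inter> A \<noteq> {}" "y \<in> R" using nbs_iff nbs_L assms by blast+
    then have "card (nb y \<inter> A) \<ge> 1" using fin_nb by (metis UnCI card_0_eq finite_Int less_one not_le)
    then have "q ^ card (nb y \<inter> A) \<le> q ^ 1" using assms by (intro power_decreasing) auto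
    then show "0 \<le> (1 + q ^ card (nb y \<inter> A)) / 2 \<and> (1 + q ^ card (nb y \<inter> A)) / 2 \<le> (1 + q) / 2"
      using assms by simp
  qed
  then show ?thesis by simp
qed

lemma wt_mono:
  assumes "0 \<le> q" "q \<le> q'"
  shows "wt q A \<le> wt q' A"
  unfolding wt_def using assms by (intro prod_mono) (auto intro!: power_mono)

end

section \<open>Containers\<close>

context biregular
begin

text \<open>At most \<open>(d + 1) ^ psi\<close> sets \<open>T\<close> are small, and each
  contributes at most \<open>(2/3) ^ k\<close>. For a larger \<open>T\<close> the factor is close to
  1/2, and \<open>d \<le> 3 ^ psi\<close> keeps its \<open>k\<close>-th power below
  \<open>3 * (1/2) ^ k\<close>, so all \<open>2 ^ card M\<close> of them together stay small as
  well. Thus each of the \<open>d - card M\<close> neighbours missing from the container gains 2/3,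
  and all losses fit into \<open>(d + 1) ^ (3 * psi)\<close>.\<close>

lemma local_factor_le:
  assumes M: "finite M" "card M \<le> d" and psi: "1 \<le> psi" "2 * psi \<le> d" "d \<le> 3 ^ psi" and k: "k = d - psi"
  shows "(\<Sum>T\<in>Pow M. (if T = {} then 0 else (1 + (1/3::real) ^ card T) / 2) ^ k)
     \<le> (real d + 1) ^ (3 * psi) * (2/3) ^ (d - card M)"
proof -
  let ?S = "{T. T \<subseteq> M \<and> card T \<le> psi}"
  let ?m = "card M"
  have k1: "k \<ge> 1" "k + psi = d" using k psi by auto
  have 3: "(1 + (1/3::real) ^ psi) ^ k \<le> 3"
  proof -
    have "real d \<le> 3 ^ psi" using psi(3) by (metis of_nat_le_iff of_nat_numeral of_nat_power)
    then have "real d * (1/3) ^ psi \<le> 1" by (simp add: power_one_over divide_simps)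
    moreover have "real k * (1/3) ^ psi \<le> real d * (1/3) ^ psi"
      using k by (intro mult_right_mono) auto
    ultimately have 1: "real k * (1/3) ^ psi \<le> 1" by linarith
    have "(1 + (1/3::real) ^ psi) ^ k \<le> exp ((1/3) ^ psi) ^ k" by (intro power_mono exp_ge_add_one_self) auto
    also have "\<dots> = exp (real k * (1/3) ^ psi)" by (simp add: exp_of_nat_mult)
    also have "\<dots> \<le> exp 1" using 1 by simp
    finally show ?thesis using exp_le by linarith
  qed
  have "(\<Sum>T\<in>Pow M. (if T = {} then 0 else (1 + (1/3::real) ^ card T) / 2) ^ k)
     \<le> (\<Sum>T\<in>Pow M. (if T \<in> ?S then (2/3) ^ k else 0) + 3 * (1/2) ^ k)"
  proof (rule sum_mono)
    fix T assume T: "T \<in> Pow M"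
    have fT: "finite T" using T M finite_subset by auto
    show "(if T = {} then 0 else (1 + (1/3::real) ^ card T) / 2) ^ k \<le> (if T \<in> ?S then (2/3) ^ k else 0) + 3 * (1/2) ^ k"
    proof (cases "T = {}")
      case True
      then show ?thesis using k1 by (simp add: power_0_left)
    next
      case False
      show ?thesis
      proof (cases "T \<in> ?S")
        case True
        have "card T \<ge> 1" using False fT by (simp add: Suc_leI card_gt_0_iff)
        then have "(1/3::real) ^ card T \<le> (1/3) ^ 1" by (intro power_decreasing) auto
        then have "((1 + (1/3::real) ^ card T) / 2) ^ k \<le> (2/3) ^ k" by (intro power_mono) auto
        then show ?thesis using True False by (simp add: add_increasing2)
      next
        case nS: False
        then have "(1/3::real) ^ card T \<le> (1/3) ^ psi" using T by (intro power_decreasing) auto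
        then have "((1 + (1/3::real) ^ card T) / 2) ^ k \<le> ((1 + (1/3) ^ psi) * (1/2)) ^ k" by (intro power_mono) auto
        also have "\<dots> \<le> 3 * (1/2) ^ k" unfolding power_mult_distrib using 3 by (intro mult_right_mono) auto
        finally show ?thesis using False nS by auto
      qed
    qed
  qed
  also have "\<dots> = card ?S * (2/3) ^ k + 3 * (2 ^ ?m * (1/2) ^ k)"
  proof -
    have "(\<Sum>T\<in>Pow M. (if T \<in> ?S then (2/3::real) ^ k else 0)) = (\<Sum>T\<in>Pow M \<inter> ?S. (2/3) ^ k)"
      by (subst sum.inter_restrict) (use M in auto)
    also have "Pow M \<inter> ?S = ?S" by auto
    finally show ?thesis using M by (simp add: sum.distrib card_Pow)
  qed
  also have "\<dots> \<le> (real d + 1) ^ psi * ((3/2) ^ psi * (2/3) ^ (d - ?m)) + 3 * (2 ^ psi * (2/3) ^ (d - ?m))"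
  proof (intro add_mono mult_mono[of "real (card ?S)"] mult_left_mono)
    have "card ?S \<le> (d + 1) ^ psi"
      using card_le_subsets_power[OF M(1), of psi] power_mono[of "card M + 1" "d + 1" psi] M(2) by linarith
    then have "real (card ?S) \<le> real ((d + 1) ^ psi)" by (rule of_nat_mono)
    then show "real (card ?S) \<le> (real d + 1) ^ psi" by (simp add: add.commute)
    have "(2/3::real) ^ k = (3/2) ^ psi * (2/3) ^ (k + psi)" by (simp add: power_add power_mult_distrib[symmetric])
    also have "\<dots> \<le> (3/2) ^ psi * (2/3) ^ (d - ?m)" using k1 by (intro mult_left_mono power_decreasing) auto
    finally show "(2/3::real) ^ k \<le> (3/2) ^ psi * (2/3) ^ (d - ?m)" .
    have "2 ^ ?m * (1/2) ^ k = (2::real) ^ ?m * 2 ^ psi * (1/2) ^ (k + psi)"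
      by (simp add: power_add power_mult_distrib[symmetric])
    also have "\<dots> = 2 ^ psi * (1/2) ^ (d - ?m)" using M(2) k1
      by (simp add: power_diff divide_simps power_one_over)
    also have "\<dots> \<le> 2 ^ psi * (2/3) ^ (d - ?m)" by (intro mult_left_mono power_mono) auto
    finally show "2 ^ ?m * (1/2) ^ k \<le> (2::real) ^ psi * (2/3) ^ (d - ?m)" .
  qed auto
  also have "\<dots> = ((3/2 * (real d + 1)) ^ psi + 3 * 2 ^ psi) * (2/3) ^ (d - ?m)"
    unfolding power_mult_distrib[of "3/2"] by (simp only: distrib_left mult_ac)
  also have "\<dots> \<le> (real d + 1) ^ (3 * psi) * (2/3) ^ (d - ?m)"
  proof (rule mult_right_mono)
    have "3 * (2::real) ^ psi \<le> 3 ^ psi * 2 ^ psi" using psi power_increasing[of 1 psi "3::real"] by simp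
    also have "\<dots> = 6 ^ psi" by (simp add: power_mult_distrib[symmetric])
    finally have a: "3 * (2::real) ^ psi \<le> 6 ^ psi" .
    have d2: "real d \<ge> 2" using psi by linarith
    have sup: "x ^ n + y ^ n \<le> (x + y) ^ n" if "0 \<le> x" "0 \<le> y" "1 \<le> n" for x y :: real and n
      using that(3)
    proof (induction n rule: nat_induct_at_least)
      case (Suc n)
      have "x ^ Suc n + y ^ Suc n \<le> (x + y) * (x ^ n + y ^ n)" using that by (simp add: algebra_simps)
      also have "\<dots> \<le> (x + y) * (x + y) ^ n" using Suc.IH that by (intro mult_left_mono) auto
      finally show ?case by simp
    qed simp
    have "(3/2 * (real d + 1)) ^ psi + 3 * 2 ^ psi \<le> (3/2 * (real d + 1)) ^ psi + 6 ^ psi" using a by simp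
    also have "\<dots> \<le> (3/2 * (real d + 1) + 6) ^ psi" using psi d2 by (intro sup) auto
    also have "\<dots> \<le> ((real d + 1) ^ 3) ^ psi"
    proof (rule power_mono)
      have cube: "3/2 * z + 6 \<le> z ^ 3" if "z \<ge> 3" for z :: real
      proof -
        have "3 * z \<le> z * z" using that by (intro mult_right_mono) auto
        moreover have "3 * (z * z) \<le> z * (z * z)" using that by (intro mult_right_mono) auto
        moreover have "z ^ 3 = z * (z * z)" by (simp add: power3_eq_cube)
        ultimately show ?thesis using that by linarith
      qed
      show "3/2 * (real d + 1) + 6 \<le> (real d + 1) ^ 3" using cube[of "real d + 1"] d2 by simp
    qed (use d2 in auto)
    finally show "(3/2 * (real d + 1)) ^ psi + 3 * 2 ^ psi \<le> (real d + 1) ^ (3 * psi)" by (simp add: power_mult)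
  qed simp
  finally show ?thesis .
qed

text \<open>Every \<open>x\<close> in \<open>S\<close> has more than \<open>d - psi\<close>
  neighbours in \<open>F\<close>, so Hoelder's inequality over the scopes of \<open>F\<close> holds
  with exponent \<open>d - psi\<close>. Vertices of the neighbourhood outside \<open>F\<close> gain
  2/3 each; by counting edges between \<open>F\<close> and \<open>S\<close>, the local sums gain
  another \<open>(2/3) powr (card F - card S)\<close>. The product is the saving for
  \<open>g\<close> exceeding the container \<open>S\<close>.\<close>

lemma container_weight:
  assumes S: "S \<subseteq> L" and F: "F \<subseteq> R" and psi: "1 \<le> psi" "2 * psi \<le> d" "d \<le> 3 ^ psi"
    and cov: "\<And>x. x \<in> S \<Longrightarrow> card (nb x - F) < psi"
  shows "(\<Sum>A | A \<subseteq> S \<and> F \<subseteq> nbs A \<and> card (nbs A) = g. wt (1/3) A)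
     \<le> (2/3) powr (real g - real (card S)) * (real d + 1) powr (6 * real psi * real g / real d)"
proof (cases "\<exists>A. A \<subseteq> S \<and> F \<subseteq> nbs A \<and> card (nbs A) = g")
  case False
  then have e: "{A. A \<subseteq> S \<and> F \<subseteq> nbs A \<and> card (nbs A) = g} = {}" by blast
  show ?thesis unfolding e by simp
next
  case True
  define k where "k = d - psi"
  have k1: "k \<ge> 1" "k + psi = d" using k_def psi by auto
  have fS: "finite S" and fF: "finite F" using S F fin_sub by auto
  have Fg: "card F \<le> g" using True S by (metis card_mono fin_sub(2) nbs_L subset_trans)
  have d0: "real d > 0" using d1 by simp
  \<comment> \<open>The value 0 at the empty set encodes \<open>F \<subseteq> nbs A\<close>.
    Otherwise \<open>T = {}\<close> alone would contribute 1 to every local sum and nothing would be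
    gained.\<close>
  let ?h = "\<lambda>y T. if T = {} then 0 else (1 + (1/3::real) ^ card T) / 2"
  have "(\<Sum>A | A \<subseteq> S \<and> F \<subseteq> nbs A \<and> card (nbs A) = g. wt (1/3) A)
    \<le> (\<Sum>A | A \<subseteq> S \<and> F \<subseteq> nbs A \<and> card (nbs A) = g. (2/3) ^ (g - card F) * (\<Prod>y\<in>F. ?h y (A \<inter> nb y)))"
  proof (rule sum_mono)
    fix A assume "A \<in> {A. A \<subseteq> S \<and> F \<subseteq> nbs A \<and> card (nbs A) = g}"
    then have A: "A \<subseteq> S" "F \<subseteq> nbs A" "card (nbs A) = g" by auto
    have AL: "A \<subseteq> L" using A S by auto
    have fn: "finite (nbs A)" using AL nbs_L fin_sub by auto
    have c1: "nb y \<inter> A \<noteq> {}" "card (nb y \<inter> A) \<ge> 1" if "y \<in> nbs A" for y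
    proof -
      show n: "nb y \<inter> A \<noteq> {}" using that nbs_iff nbs_L AL by blast
      have "y \<in> R" using that nbs_L AL by blast
      then show "card (nb y \<inter> A) \<ge> 1" using n fin_nb by (metis UnCI card_0_eq finite_Int less_one not_le)
    qed
    have "wt (1/3) A = (\<Prod>y\<in>nbs A - F. (1 + (1/3) ^ card (nb y \<inter> A)) / 2) * (\<Prod>y\<in>F. (1 + (1/3) ^ card (nb y \<inter> A)) / 2)"
      unfolding wt_def using A(2) fn by (rule prod.subset_diff)
    also have "(\<Prod>y\<in>F. (1 + (1/3) ^ card (nb y \<inter> A)) / 2) = (\<Prod>y\<in>F. ?h y (A \<inter> nb y))"
      using c1 A(2) by (intro prod.cong) (auto simp: Int_commute)
    also have "(\<Prod>y\<in>nbs A - F. (1 + (1/3::real) ^ card (nb y \<inter> A)) / 2) \<le> (\<Prod>y\<in>nbs A - F. 2/3)"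
    proof (rule prod_mono)
      fix y assume "y \<in> nbs A - F"
      then have "(1/3::real) ^ card (nb y \<inter> A) \<le> (1/3) ^ 1" using c1 by (intro power_decreasing) auto
      then show "0 \<le> (1 + (1/3::real) ^ card (nb y \<inter> A)) / 2 \<and> (1 + (1/3::real) ^ card (nb y \<inter> A)) / 2 \<le> 2/3" by simp
    qed
    also have "(\<Prod>y\<in>nbs A - F. 2/3::real) = (2/3) ^ (g - card F)"
      using A fn fF by (simp add: card_Diff_subset)
    finally show "wt (1/3) A \<le> (2/3) ^ (g - card F) * (\<Prod>y\<in>F. ?h y (A \<inter> nb y))"
      by (simp add: mult_right_mono prod_nonneg)
  qed
  also have "\<dots> = (2/3) ^ (g - card F) * (\<Sum>A | A \<subseteq> S \<and> F \<subseteq> nbs A \<and> card (nbs A) = g. \<Prod>y\<in>F. ?h y (A \<inter> nb y))"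
    by (simp add: sum_distrib_left)
  also have "\<dots> \<le> (2/3) ^ (g - card F) * (\<Sum>A\<in>Pow S. \<Prod>y\<in>F. ?h y (A \<inter> nb y))"
    using fS by (intro mult_left_mono sum_mono2 prod_nonneg) auto
  also have "(\<Sum>A\<in>Pow S. \<Prod>y\<in>F. ?h y (A \<inter> nb y)) \<le> (\<Prod>y\<in>F. root k (\<Sum>T\<in>Pow (S \<inter> nb y). ?h y T ^ k))"
  proof (rule holder_local[OF fS fF k1(1)])
    fix x assume x: "x \<in> S"
    then have xL: "x \<in> L" using S by auto
    have "{y \<in> F. x \<in> nb y} = nb x \<inter> F" using nb_sym[OF xL] F nbL[OF xL] by blast
    moreover have "card (nb x) = card (nb x \<inter> F) + card (nb x - F)"
      using fin_nb xL by (metis UnI1 card_Int_Diff)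
    ultimately show "k \<le> card {y \<in> F. x \<in> nb y}" using cov[OF x] card_nb[of x] xL k_def by auto
  qed auto
  also have "(\<Prod>y\<in>F. root k (\<Sum>T\<in>Pow (S \<inter> nb y). ?h y T ^ k))
      \<le> (\<Prod>y\<in>F. (real d + 1) powr (6 * real psi / real d) * (2/3) powr ((real d - card (nb y \<inter> S)) / real d))"
  proof (rule prod_mono)
    fix y assume y: "y \<in> F"
    let ?M = "S \<inter> nb y"
    have fM: "finite ?M" using fS by auto
    have Md: "card ?M \<le> d" using y F card_nb fin_nb by (metis UnCI card_mono inf_le2 subsetD)
    have kk: "real k > 0" "real d \<le> 2 * real k" "real k \<le> real d" using k1 psi by auto
    have "root k (\<Sum>T\<in>Pow ?M. ?h y T ^ k) \<le> root k ((real d + 1) ^ (3 * psi) * (2/3) ^ (d - card ?M))"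
      using k1 local_factor_le[OF fM Md psi k_def] by (simp only: real_root_le_iff)
    also have "\<dots> = ((real d + 1) powr (3 * psi) * (2/3) powr (d - card ?M)) powr (1 / k)"
      using k1 by (subst root_powr_inverse) (auto simp: powr_realpow[symmetric])
    also have "\<dots> = (real d + 1) powr (3 * psi / k) * (2/3) powr ((real d - card ?M) / k)"
      using Md by (simp add: powr_mult powr_powr of_nat_diff)
    \<comment> \<open>Here \<open>k \<ge> d / 2\<close> turns the exponent
      \<open>3 * psi / k\<close> into \<open>6 * psi / d\<close>.\<close>
    also have "\<dots> \<le> (real d + 1) powr (6 * real psi / real d) * (2/3) powr ((real d - card ?M) / real d)"
    proof (intro mult_mono)
      have "3 * real psi * real d \<le> 3 * real psi * (2 * real k)" using kk by (intro mult_left_mono) auto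
      then have "3 * real psi / k \<le> 6 * real psi / real d"
        using kk d0 by (simp add: divide_simps mult_ac)
      then show "(real d + 1) powr (3 * psi / k) \<le> (real d + 1) powr (6 * real psi / real d)"
        by (intro powr_mono) auto
      have "(real d - card ?M) / real d \<le> (real d - card ?M) / real k"
        using kk d0 Md by (intro divide_left_mono) auto
      then show "(2/3) powr ((real d - card ?M) / real k) \<le> (2/3) powr ((real d - card ?M) / real d)"
        by (intro powr_mono') auto
    qed auto
    finally show "0 \<le> root k (\<Sum>T\<in>Pow ?M. ?h y T ^ k) \<and> root k (\<Sum>T\<in>Pow ?M. ?h y T ^ k)
       \<le> (real d + 1) powr (6 * real psi / real d) * (2/3) powr ((real d - card (nb y \<inter> S)) / real d)"
      by (auto intro!: real_root_ge_zero sum_nonneg simp: Int_commute)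
  qed
  also have "\<dots> = (real d + 1) powr (card F * (6 * real psi / real d)) *
      (2/3) powr (\<Sum>y\<in>F. (real d - card (nb y \<inter> S)) / real d)"
    using fF by (simp add: prod.distrib powr_power powr_sum)
  also have "\<dots> \<le> (real d + 1) powr (6 * real psi * g / real d) * (2/3) powr (real (card F) - real (card S))"
  proof (intro mult_mono)
    have "card F * (6 * real psi) \<le> g * (6 * real psi)" using Fg by (intro mult_right_mono) auto
    then show "(real d + 1) powr (card F * (6 * real psi / real d)) \<le> (real d + 1) powr (6 * real psi * g / real d)"
      using d0 by (intro powr_mono) (auto simp: divide_simps mult_ac)
    have "(\<Sum>y\<in>F. card (nb y \<inter> S)) = (\<Sum>x\<in>S. card (nb x \<inter> F))" using edge_count[OF S F] by simp
    also have "\<dots> \<le> (\<Sum>x\<in>S. d)" using S card_nb fin_nb by (intro sum_mono) (metis UnCI card_mono inf_le1 subsetD)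
    finally have "real (\<Sum>y\<in>F. card (nb y \<inter> S)) \<le> real (card S * d)"
      by (metis of_nat_le_iff sum_constant of_nat_id)
    then have "real d * (real (card F) - real (card S)) \<le> (\<Sum>y\<in>F. real d - card (nb y \<inter> S))"
      by (simp add: sum_subtractf algebra_simps)
    then have "real (card F) - real (card S) \<le> (\<Sum>y\<in>F. (real d - card (nb y \<inter> S)) / real d)"
      using d0 by (simp add: sum_divide_distrib[symmetric] divide_simps mult_ac)
    then show "(2/3) powr (\<Sum>y\<in>F. (real d - card (nb y \<inter> S)) / real d) \<le> (2/3) powr (real (card F) - real (card S))"
      by (intro powr_mono') auto
  qed auto
  finally have "(\<Sum>A | A \<subseteq> S \<and> F \<subseteq> nbs A \<and> card (nbs A) = g. wt (1/3) A) \<le>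
     (2/3) ^ (g - card F) * ((real d + 1) powr (6 * real psi * g / real d) * (2/3) powr (real (card F) - real (card S)))"
    by (simp add: mult_left_mono)
  also have "(2/3::real) ^ (g - card F) = (2/3) powr (real g - card F)" using Fg by (simp add: powr_realpow[symmetric] of_nat_diff)
  also have "(2/3) powr (real g - card F) * ((real d + 1) powr (6 * real psi * g / real d) * (2/3) powr (real (card F) - real (card S)))
    = ((2/3) powr (real g - card F) * (2/3) powr (real (card F) - real (card S))) * (real d + 1) powr (6 * real psi * g / real d)"
    by (simp only: mult_ac)
  also have "(2/3::real) powr (real g - card F) * (2/3) powr (real (card F) - real (card S)) = (2/3) powr (real g - card S)"
    by (simp add: powr_add[symmetric])
  finally show ?thesis .
qed

end

section \<open>Construction of the approximations\<close>

context biregular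
begin

text \<open>
  Approximations of a polymer with neighbourhood \<open>Q\<close> and closure \<open>C = cl Q\<close> (the largest set with neighbourhood
  contained in \<open>Q\<close>), encoded by three small sets: \<open>Y1 \<subseteq> C\<close>
  covers half of every neighbourhood inside \<open>Q\<close>, \<open>X\<close> lies outside \<open>Q\<close> and removes the vertices outside \<open>C\<close> that are
  cheap to exclude, and \<open>Y2 \<subseteq> C\<close> adds the missing parts of \<open>Q\<close>. Then \<open>C \<subseteq> appS\<close> and \<open>appF \<subseteq> Q\<close>.
\<close>

definition app1 :: "'a set \<Rightarrow> 'a set" where
  "app1 Y1 = {x \<in> L. d \<le> 2 * card (nb x \<inter> nbs Y1)}"
definition app2 :: "'a set \<Rightarrow> 'a set \<Rightarrow> 'a set" where
  "app2 Y1 X = app1 Y1 - nbs X"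
definition appF :: "nat \<Rightarrow> 'a set \<Rightarrow> 'a set \<Rightarrow> 'a set \<Rightarrow> 'a set" where
  "appF psi Y1 X Y2 = {y \<in> R. psi \<le> card (nb y \<inter> app2 Y1 X)} \<union> nbs Y2"
definition appS :: "nat \<Rightarrow> 'a set \<Rightarrow> 'a set \<Rightarrow> 'a set \<Rightarrow> 'a set" where
  "appS psi Y1 X Y2 = {x \<in> app2 Y1 X. card (nb x - appF psi Y1 X Y2) < psi}"

lemma appS_sub: "appS psi Y1 X Y2 \<subseteq> app1 Y1" "app1 Y1 \<subseteq> L"
  unfolding appS_def app2_def app1_def by auto

text \<open>A vertex of the closure has a neighbour in \<open>nbs A\<close>, hence is within
  distance 2 of some vertex of \<open>A\<close>; attaching such vertices keeps a linked set
  linked.\<close>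

lemma linked_cl:
  assumes A: "A \<subseteq> L" "linked n2 A" shows "linked n2 (cl (nbs A))"
proof -
  have sub: "A \<subseteq> cl (nbs A)" using A sub_cl_nbs by auto
  have near: "\<exists>a\<in>A. x \<in> n2 a \<and> a \<in> n2 x" if "x \<in> cl (nbs A)" for x
  proof -
    have x: "x \<in> L" "nb x \<subseteq> nbs A" using that unfolding cl_def by auto
    obtain y where y: "y \<in> nb x" using nb_ne x by blast
    then obtain a where a: "a \<in> A" "y \<in> nb a" using x unfolding nbs_def by blast
    then have "x \<in> n2 a" "a \<in> n2 x" using n2_iff x y A by blast+
    then show ?thesis using a by auto
  qed
  show ?thesis unfolding linked_def
  proof (intro conjI allI impI)
    show "cl (nbs A) \<noteq> {}" using sub A unfolding linked_def by auto
    fix T assume T: "T \<subset> cl (nbs A) \<and> T \<noteq> {}"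
    show "\<exists>x\<in>T. \<exists>y\<in>cl (nbs A) - T. y \<in> n2 x"
    proof (cases "T \<inter> A = {}")
      case True
      obtain x where "x \<in> T" using T by auto
      then obtain a where "a \<in> A" "a \<in> n2 x" using near T by blast
      then show ?thesis using True sub \<open>x \<in> T\<close> by blast
    next
      case nT: False
      show ?thesis
      proof (cases "A \<subseteq> T")
        case True
        obtain x where "x \<in> cl (nbs A)" "x \<notin> T" using T by auto
        then show ?thesis using near True by blast
      next
        case False
        then have "T \<inter> A \<subset> A" by blast
        then obtain x y where "x \<in> T \<inter> A" "y \<in> A - T \<inter> A" "y \<in> n2 x"
          using A(2) nT unfolding linked_def by meson
        then show ?thesis using sub by blast
      qed
    qed
  qed
qed

text \<open>Let \<open>T\<close> be a proper part of \<open>Y\<close>. If the vertices of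
  \<open>C\<close> near \<open>T\<close> are all of \<open>C\<close>, one \<open>n2\<close> step
  leads from \<open>T\<close> to the rest of \<open>Y\<close>. Otherwise an \<open>n2\<close> step
  leaves that region, and with one step at either end this makes three, that is
  \<open>n6\<close>.\<close>

lemma linked_dominating:
  assumes C: "C \<subseteq> L" "linked n2 C" and Y: "Y \<subseteq> C" "\<And>x. x \<in> C \<Longrightarrow> nb x \<inter> nbs Y \<noteq> {}"
  shows "linked n6 Y"
proof -
  have near: "\<exists>y\<in>Y. x \<in> n2 y" if "x \<in> C" for x
  proof -
    have x: "x \<in> C" by (rule that)
    obtain y where "y \<in> Y" "nb x \<inter> nb y \<noteq> {}" using Y(2)[OF x] unfolding nbs_def by blast
    then show ?thesis using n2_iff[of y x] C Y x by blast
  qed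
  show ?thesis unfolding linked_def
  proof (intro conjI allI impI)
    show "Y \<noteq> {}" using near C unfolding linked_def by blast
    fix T assume T: "T \<subset> Y \<and> T \<noteq> {}"
    let ?D = "{x \<in> C. \<exists>y\<in>T. x \<in> n2 y}"
    show "\<exists>x\<in>T. \<exists>y\<in>Y - T. y \<in> n6 x"
    proof (cases "?D = C")
      case True
      obtain z where z: "z \<in> Y" "z \<notin> T" using T by auto
      then obtain y where y: "y \<in> T" "z \<in> n2 y" using True Y by blast
      have "z \<in> L" using z Y C by auto
      then have "z \<in> n2 z" by (rule n2_refl)
      then have "z \<in> n6 y" unfolding n6_def using y \<open>z \<in> n2 z\<close> by blast
      then show ?thesis using y z by blast
    next
      case False
      have "?D \<noteq> {}"
      proof -
        obtain y where "y \<in> T" using T by auto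
        moreover have "y \<in> C" "y \<in> L" using \<open>y \<in> T\<close> T Y C by auto
        ultimately show ?thesis using n2_refl by blast
      qed
      moreover have "?D \<subset> C" using False by blast
      ultimately obtain x z where xz: "x \<in> ?D" "z \<in> C - ?D" "z \<in> n2 x" using C(2) unfolding linked_def by meson
      obtain y where y: "y \<in> T" "x \<in> n2 y" using xz by blast
      obtain w where w: "w \<in> Y" "z \<in> n2 w" using near xz by blast
      have "w \<notin> T" using w xz by blast
      moreover have "w \<in> n2 z" using n2_sym[of w z] w xz Y C by blast
      then have "w \<in> n6 y" unfolding n6_def using y xz by blast
      ultimately show ?thesis using y w by blast
    qed
  qed
qed

text \<open>Three greedy covers. The first takes about \<open>g / d\<close> vertices, too many to be
  listed as an arbitrary set but cheap because they are linked in \<open>n6\<close>. The other two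
  have size proportional to the gap \<open>g - c\<close> divided by \<open>psi\<close> and can be
  listed as arbitrary subsets of what is known already.\<close>

lemma container:
  assumes A: "A \<subseteq> L" "linked n2 A" and psi: "1 \<le> psi" "2 * psi \<le> d"
    and Q: "Q = nbs A" and g: "g = card Q" and c: "c = card (cl Q)"
  obtains Y1 X Y2 where
    "Y1 \<subseteq> L" "linked n6 Y1" "card Y1 * d \<le> 2 * g" "card (app1 Y1) \<le> 2 * g"
    "X \<subseteq> nbs (app1 Y1)" "psi * card X \<le> 2 * (g - c)" "Y2 \<subseteq> app1 Y1" "psi * card Y2 \<le> 2 * (g - c)"
    "cl Q \<subseteq> appS psi Y1 X Y2" "appF psi Y1 X Y2 \<subseteq> Q"
proof -
  let ?C = "cl Q"
  have QR: "Q \<subseteq> R" using A nbs_L Q by auto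
  have fQ: "finite Q" using QR fin_sub by auto
  have CL: "?C \<subseteq> L" by (rule cl_sub)
  have fC: "finite ?C" using CL fin_sub by auto
  have d0: "real d / 2 > 0" using d1 by simp
  \<comment> \<open>Threshold \<open>d / 2\<close>: a vertex of the closure has all its
    \<open>d\<close> neighbours in \<open>Q\<close>, so more than half of them are covered.\<close>
  obtain Y1 where Y1: "Y1 \<subseteq> ?C" "real d / 2 * card Y1 \<le> card Q"
    "\<forall>v\<in>?C. card (nb v \<inter> Q - \<Union> (nb ` Y1)) < real d / 2"
    using greedy_cover[OF fQ d0, of ?C nb] by blast
  have nbC: "nb x \<subseteq> Q" if "x \<in> ?C" for x using that unfolding cl_def by auto
  have Y1Q: "nbs Y1 \<subseteq> Q" using nbs_mono[OF Y1(1)] nbs_cl[of Q] by blast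
  have half: "d < 2 * card (nb x \<inter> nbs Y1)" if x: "x \<in> ?C" for x
  proof -
    have "nb x \<inter> Q - \<Union> (nb ` Y1) = nb x - nbs Y1" using nbC[OF x] unfolding nbs_def by auto
    then have "real (card (nb x - nbs Y1)) < real d / 2" using Y1(3) x by auto
    moreover have "card (nb x) = card (nb x \<inter> nbs Y1) + card (nb x - nbs Y1)"
      using fin_nb x CL by (metis UnI1 card_Int_Diff subsetD)
    moreover have "card (nb x) = d" using card_nb x CL by blast
    ultimately show ?thesis by linarith
  qed
  have C1: "?C \<subseteq> app1 Y1" unfolding app1_def using half CL by fastforce
  have lY1: "linked n6 Y1"
  proof (rule linked_dominating[OF CL _ Y1(1)])
    show "linked n2 ?C" using linked_cl A Q by auto
    show "nb x \<inter> nbs Y1 \<noteq> {}" if "x \<in> ?C" for x using half[OF that] by (metis card.empty mult_0_right not_less_zero)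
  qed
  have Y1c: "card Y1 * d \<le> 2 * g"
  proof -
    have "real (card Y1 * d) \<le> real (2 * g)" using Y1(2) g by (simp add: mult.commute)
    then show ?thesis by linarith
  qed
  let ?S1 = "app1 Y1"
  have S1L: "?S1 \<subseteq> L" by (rule appS_sub)
  have fS1: "finite ?S1" using S1L fin_sub by auto
  have inQ: "d \<le> 2 * card (nb x \<inter> Q)" if "x \<in> ?S1" for x
  proof -
    have "card (nb x \<inter> nbs Y1) \<le> card (nb x \<inter> Q)" using Y1Q fQ by (intro card_mono) auto
    then show ?thesis using that unfolding app1_def by auto
  qed
  have S1c: "card ?S1 \<le> 2 * g"
  proof -
    have "d * card ?S1 = (\<Sum>x\<in>?S1. d)" by simp
    also have "\<dots> \<le> (\<Sum>x\<in>?S1. 2 * card (nb x \<inter> Q))" using inQ by (intro sum_mono) auto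
    also have "\<dots> = 2 * (\<Sum>x\<in>?S1. card (nb x \<inter> Q))" by (simp add: sum_distrib_left)
    also have "\<dots> \<le> 2 * (d * g)" using edges_le[OF S1L QR] g by simp
    finally show ?thesis using d1 by simp
  qed
  have S1C: "card (?S1 - ?C) \<le> 2 * (g - c)"
  proof -
    have "d * card (?S1 - ?C) = (\<Sum>x\<in>?S1 - ?C. d)" by simp
    also have "\<dots> \<le> (\<Sum>x\<in>?S1 - ?C. 2 * card (nb x \<inter> Q))" using inQ by (intro sum_mono) auto
    also have "\<dots> = 2 * (\<Sum>x\<in>?S1 - ?C. card (nb x \<inter> Q))" by (simp add: sum_distrib_left)
    also have "\<dots> \<le> 2 * (d * (g - c))" using edges_out_le[OF QR, of "?S1 - ?C"] S1L g c by auto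
    finally show ?thesis using d1 by simp
  qed
  have psi0: "real psi > 0" using psi by simp
  have fU: "finite (?S1 - ?C)" using fS1 by auto
  \<comment> \<open>No vertex of \<open>C\<close> has a neighbour outside \<open>Q\<close>, so
    neighbourhoods of vertices outside \<open>Q\<close> can be struck out without losing any of
    \<open>C\<close>. Afterwards a vertex outside \<open>Q\<close> sees fewer than
    \<open>psi\<close> of the survivors. The set to be covered is small because each of its vertices
    sends at least \<open>d / 2\<close> edges into \<open>Q\<close>.\<close>
  obtain X where X: "X \<subseteq> R - Q" "real psi * card X \<le> card (?S1 - ?C)" "\<forall>v\<in>X. nb v \<inter> (?S1 - ?C) \<noteq> {}"
    "\<forall>v\<in>R - Q. card (nb v \<inter> (?S1 - ?C) - \<Union> (nb ` X)) < real psi"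
    using greedy_cover[OF fU psi0, of "R - Q" nb] by blast
  have Xn: "X \<subseteq> nbs ?S1"
    using X nbs_iff[OF S1L] by blast
  have Xc: "psi * card X \<le> 2 * (g - c)"
  proof -
    have "real (psi * card X) \<le> real (card (?S1 - ?C))" using X(2) by simp
    then show ?thesis using S1C by linarith
  qed
  let ?S2 = "app2 Y1 X"
  have CX: "nbs X \<inter> ?C = {}"
  proof -
    have False if "x \<in> ?C" "v \<in> X" "x \<in> nb v" for x v
    proof -
      have "v \<in> nb x" using nb_sym that CL X by blast
      then show False using nbC that X by blast
    qed
    then show ?thesis unfolding nbs_def by blast
  qed
  have C2: "?C \<subseteq> ?S2" unfolding app2_def using C1 CX by auto
  have outQ: "card (nb y \<inter> ?S2) < psi" if y: "y \<in> R - Q" for y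
  proof -
    have "nb y \<inter> ?C = {}"
    proof -
      have False if "x \<in> ?C" "x \<in> nb y" for x
      proof -
        have "y \<in> nb x" using nb_sym that CL y by blast
        then show False using nbC that y by blast
      qed
      then show ?thesis by blast
    qed
    then have "nb y \<inter> ?S2 = nb y \<inter> (?S1 - ?C) - \<Union> (nb ` X)" unfolding app2_def nbs_def by auto
    then show ?thesis using X(4) y by auto
  qed
  let ?F2 = "{y \<in> R. psi \<le> card (nb y \<inter> ?S2)}"
  have F2Q: "?F2 \<subseteq> Q"
  proof
    fix y assume y: "y \<in> ?F2"
    show "y \<in> Q"
    proof (rule ccontr)
      assume "y \<notin> Q"
      then have "card (nb y \<inter> ?S2) < psi" using y outQ by blast
      then show False using y by simp
    qed
  qed
  \<comment> \<open>A vertex of \<open>Q\<close> not detected by \<open>?F2\<close> has fewer than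
    \<open>psi \<le> d / 2\<close> neighbours in \<open>C\<close>, so at least half of its edges
    leave \<open>C\<close>, and there are only \<open>d * (g - c)\<close> such edges.\<close>
  have QF2: "card (Q - ?F2) \<le> 2 * (g - c)"
  proof -
    have "d \<le> 2 * card (nb y - ?C)" if y: "y \<in> Q - ?F2" for y
    proof -
      have yR: "y \<in> R" using y QR by auto
      have "card (nb y \<inter> ?C) \<le> card (nb y \<inter> ?S2)" using C2 fin_nb yR by (intro card_mono) auto
      moreover have "card (nb y \<inter> ?S2) < psi" using y yR by auto
      moreover have "card (nb y) = card (nb y \<inter> ?C) + card (nb y - ?C)"
        using fin_nb yR by (metis UnI2 card_Int_Diff)
      moreover have "card (nb y) = d" using card_nb yR by auto
      ultimately show ?thesis using psi by linarith
    qed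
    then have "(\<Sum>y\<in>Q - ?F2. d) \<le> (\<Sum>y\<in>Q - ?F2. 2 * card (nb y - ?C))" by (intro sum_mono) auto
    also have "\<dots> \<le> (\<Sum>y\<in>Q. 2 * card (nb y - ?C))" using fQ by (intro sum_mono2) auto
    also have "\<dots> = 2 * (d * (g - c))" using edges_out_cl[OF QR] g c by (simp add: sum_distrib_left[symmetric])
    finally have "d * card (Q - ?F2) \<le> d * (2 * (g - c))" by (simp add: mult_ac)
    then show ?thesis using d1 by simp
  qed
  have fQ2: "finite (Q - ?F2)" using fQ by auto
  \<comment> \<open>The undetected part of \<open>Q\<close> is covered from inside \<open>C\<close>,
    until every vertex of \<open>C\<close> misses fewer than \<open>psi\<close> of its
    neighbours.\<close>
  obtain Y2 where Y2: "Y2 \<subseteq> ?C" "real psi * card Y2 \<le> card (Q - ?F2)"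
    "\<forall>v\<in>?C. card (nb v \<inter> (Q - ?F2) - \<Union> (nb ` Y2)) < real psi"
    using greedy_cover[OF fQ2 psi0, of ?C nb] by blast
  have Y2c: "psi * card Y2 \<le> 2 * (g - c)"
  proof -
    have "real (psi * card Y2) \<le> real (card (Q - ?F2))" using Y2(2) by simp
    then show ?thesis using QF2 by linarith
  qed
  have FQ: "appF psi Y1 X Y2 \<subseteq> Q" unfolding appF_def using F2Q nbs_mono[OF Y2(1)] nbs_cl[of Q] by blast
  have CS: "?C \<subseteq> appS psi Y1 X Y2"
  proof
    fix x assume x: "x \<in> ?C"
    have "nb x - appF psi Y1 X Y2 = nb x \<inter> (Q - ?F2) - \<Union> (nb ` Y2)"
      using nbC[OF x] unfolding appF_def nbs_def by auto
    then show "x \<in> appS psi Y1 X Y2" unfolding appS_def using Y2(3) C2 x by auto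
  qed
  show ?thesis
    by (rule that[of Y1 X Y2]) (use Y1 CL lY1 Y1c S1c Xn Xc Y2 C1 Y2c CS FQ in auto)
qed

end

lemma sum_le_card_bound:
  fixes f :: "'a \<Rightarrow> real"
  assumes "\<And>i. i \<in> I \<Longrightarrow> f i \<le> w" "real (card I) \<le> b" "0 \<le> w"
  shows "sum f I \<le> b * w"
proof -
  have "sum f I \<le> real (card I) * w" using assms(1) by (rule sum_bounded_above)
  also have "\<dots> \<le> b * w" using assms by (intro mult_right_mono) auto
  finally show ?thesis .
qed

section \<open>Summation over all approximations\<close>

context biregular
begin

definition polymers :: "nat \<Rightarrow> nat \<Rightarrow> 'a set set" where
  "polymers g c = {A. A \<subseteq> L \<and> linked n2 A \<and> card (nbs A) = g \<and> card (cl (nbs A)) = c}"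

text \<open>The \<open>n6\<close> graph has degrees at most \<open>d ^ 6\<close>, so through a given
  vertex there are at most \<open>d ^ (12 * t)\<close> linked sets of size \<open>t\<close>, and
  \<open>t \<le> 2 * g / d\<close>. Start vertex and size give the remaining factors.\<close>

lemma seeds_count:
  "real (card {Y. Y \<subseteq> L \<and> linked n6 Y \<and> card Y * d \<le> 2 * g})
     \<le> real (card L) * (2 * real g) * real d powr (24 * real g / real d)"
proof -
  have d0: "real d \<ge> 1" using d1 by simp
  have nbr6: "finite (n6 x) \<and> n6 x \<subseteq> L \<and> card (n6 x) \<le> d ^ 6" if "x \<in> L" for x
    using n6_sub[OF that] card_n6[OF that] fin_sub(1) by auto
  let ?S = "\<lambda>(v, t). {S. S \<subseteq> L \<and> linked n6 S \<and> v \<in> S \<and> card S = t \<and> t * d \<le> 2 * g}"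
  have fin: "finite (\<Union>p\<in>L \<times> {1..2*g}. ?S p)" using finL by (auto intro: finite_subset[of _ "Pow L"])
  have "{Y. Y \<subseteq> L \<and> linked n6 Y \<and> card Y * d \<le> 2 * g} \<subseteq> (\<Union>p\<in>L \<times> {1..2*g}. ?S p)"
  proof
    fix Y assume "Y \<in> {Y. Y \<subseteq> L \<and> linked n6 Y \<and> card Y * d \<le> 2 * g}"
    then have Y: "Y \<subseteq> L" "linked n6 Y" "card Y * d \<le> 2 * g" by auto
    then obtain v where v: "v \<in> Y" unfolding linked_def by auto
    have "card Y \<ge> 1" using v Y fin_sub by (metis One_nat_def Suc_leI card_gt_0_iff empty_iff)
    moreover have "card Y \<le> 2 * g" using Y(3) d1 by (metis le_trans mult.right_neutral mult_le_mono2)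
    ultimately have "(v, card Y) \<in> L \<times> {1..2*g}" using v Y by auto
    moreover have "Y \<in> ?S (v, card Y)" using v Y by auto
    ultimately show "Y \<in> (\<Union>p\<in>L \<times> {1..2*g}. ?S p)" by blast
  qed
  then have "card {Y. Y \<subseteq> L \<and> linked n6 Y \<and> card Y * d \<le> 2 * g} \<le> card (\<Union>p\<in>L \<times> {1..2*g}. ?S p)"
    by (rule card_mono[OF fin])
  also have "\<dots> \<le> (\<Sum>p\<in>L \<times> {1..2*g}. card (?S p))" using finL by (intro card_UN_le) auto
  finally have "real (card {Y. Y \<subseteq> L \<and> linked n6 Y \<and> card Y * d \<le> 2 * g}) \<le> real (\<Sum>p\<in>L \<times> {1..2*g}. card (?S p))"
    by (rule of_nat_mono)
  also have "\<dots> = (\<Sum>p\<in>L \<times> {1..2*g}. real (card (?S p)))" by (rule of_nat_sum)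
  also have "\<dots> \<le> real (card (L \<times> {1..2*g})) * real d powr (24 * real g / real d)"
  proof (rule sum_le_card_bound)
    fix p assume "p \<in> L \<times> {1..2*g}"
    then obtain v t where p: "p = (v, t)" "v \<in> L" "t \<ge> 1" by auto
    show "real (card (?S p)) \<le> real d powr (24 * real g / real d)"
    proof (cases "t * d \<le> 2 * g")
      case True
      have "card {S. S \<subseteq> L \<and> linked n6 S \<and> v \<in> S \<and> card S = t} \<le> (d ^ 6) ^ (2 * t - 2)"
        by (rule linked_count[OF nbr6 p(2) n6_sym p(3) finL])
      also have "\<dots> \<le> (d ^ 6) ^ (2 * t)" using d1 by (intro power_increasing) auto
      finally have "card (?S p) \<le> d ^ (12 * t)" using True p by (simp add: power_mult[symmetric])
      then have "real (card (?S p)) \<le> real (d ^ (12 * t))" by (rule of_nat_mono)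
      then have "real (card (?S p)) \<le> real d ^ (12 * t)" by simp
      also have "\<dots> = real d powr (12 * t)" using d0 by (simp add: powr_realpow[symmetric])
      also have "\<dots> \<le> real d powr (24 * real g / real d)"
      proof (intro powr_mono d0)
        have "real t * real d \<le> 2 * real g" using True by (metis of_nat_le_iff of_nat_mult of_nat_numeral)
        then show "real (12 * t) \<le> 24 * real g / real d" using d0 by (simp add: divide_simps mult_ac)
      qed
      finally show ?thesis .
    next
      case False
      then have "?S p = {}" using p by auto
      then show ?thesis by simp
    qed
  qed auto
  finally show ?thesis by (simp add: card_cartesian_product mult_ac)
qed

text \<open>
  If the container \<open>appS\<close> is smaller than \<open>g\<close> by a fraction \<open>tau\<close> of the gap \<open>g - c\<close>, the Hoelder bound
  already gains enough. Otherwise \<open>appF\<close> is almost all of \<open>Q\<close>, and it is cheap to specify \<open>Q\<close> exactly, after which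
  the whole gap is gained.
\<close>

lemma polymer_sum_bound:
  fixes tau :: real
  assumes psi: "1 \<le> psi" "2 * psi \<le> d" "d \<le> 3 ^ psi" and tau: "0 \<le> tau" and gc: "c \<le> g"
    and dl: "dl = real (g - c)" and tD: "tD = tau * dl + 2 * real psi * real g / real d"
    and BX: "BX = exp (2 * dl / real psi * ln (real d ^ 3) + 2 * real g / real d ^ 2)"
    and BD: "BD = exp (tD * ln (real d ^ 3) + 2 * real g / real d ^ 2)"
    and K: "K = (real d + 1) powr (6 * real psi * real g / real d)"
  shows "(\<Sum>A\<in>polymers g c. wt (1/3) A)
    \<le> real (card L) * (2 * real g) * real d powr (24 * real g / real d) *
       (BX * (BX * (K * ((2/3) powr (tau * dl) + BD * (2/3) powr dl))))"
proof -
  have d0: "real d \<ge> 1" using d1 by simp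
  have dl0: "dl \<ge> 0" using dl by simp
  have tD0: "tD \<ge> 0" using tau dl0 by (simp add: tD)
  let ?W = "K * ((2/3) powr (tau * dl) + BD * (2/3) powr dl)"
  have W0: "?W \<ge> 0" by (simp add: K BD)
  define Ys where "Ys = {Y. Y \<subseteq> L \<and> linked n6 Y \<and> card Y * d \<le> 2 * g \<and> card (app1 Y) \<le> 2 * g}"
  define Xs where "Xs Y1 = {X. X \<subseteq> nbs (app1 Y1) \<and> real (card X) \<le> 2 * dl / real psi}" for Y1
  define Zs where "Zs Y1 = {X. X \<subseteq> app1 Y1 \<and> real (card X) \<le> 2 * dl / real psi}" for Y1
  define Ds where "Ds Y1 = {X. X \<subseteq> nbs (app1 Y1) \<and> real (card X) \<le> tD}" for Y1
  \<comment> \<open>In this family the neighbourhood is known exactly, so its closure serves as the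
    container.\<close>
  define G2 where "G2 Q = {A. A \<subseteq> cl Q \<and> Q \<subseteq> nbs A \<and> card (nbs A) = g \<and> card (cl Q) = c}" for Q
  define G where "G Y1 X Y2 = (if real (card (appS psi Y1 X Y2)) \<le> real g - tau * dl
     then {A. A \<subseteq> appS psi Y1 X Y2 \<and> appF psi Y1 X Y2 \<subseteq> nbs A \<and> card (nbs A) = g}
     else (\<Union>D\<in>Ds Y1. G2 (appF psi Y1 X Y2 \<union> D)))" for Y1 X Y2
  have fin1: "finite (app1 Y1)" "app1 Y1 \<subseteq> L" "finite (nbs (app1 Y1))" "nbs (app1 Y1) \<subseteq> R" for Y1
    using appS_sub fin_sub nbs_L by metis+
  have finXs: "finite (Xs Y1)" "finite (Zs Y1)" "finite (Ds Y1)" for Y1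
    unfolding Xs_def Zs_def Ds_def using fin1 by (auto intro: finite_subset[of _ "Pow (nbs (app1 Y1))"] finite_subset[of _ "Pow (app1 Y1)"])
  have finYs: "finite Ys" unfolding Ys_def using finL by (auto intro: finite_subset[of _ "Pow L"])
  have finG2: "finite (G2 Q)" for Q unfolding G2_def using cl_sub[of Q] finL by (auto intro: finite_subset[of _ "Pow L"])
  have finG: "finite (G Y1 X Y2)" for Y1 X Y2
  proof -
    have "finite (appS psi Y1 X Y2)" by (rule finite_subset[OF appS_sub(1) fin1(1)])
    then show ?thesis unfolding G_def using finG2 finXs by auto
  qed
  have cov: "polymers g c \<subseteq> (\<Union>Y1\<in>Ys. \<Union>X\<in>Xs Y1. \<Union>Y2\<in>Zs Y1. G Y1 X Y2)"
  proof
    fix A assume "A \<in> polymers g c"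
    then have A: "A \<subseteq> L" "linked n2 A" "g = card (nbs A)" "c = card (cl (nbs A))" unfolding polymers_def by auto
    let ?Q = "nbs A"
    have fQ: "finite ?Q" using A nbs_L fin_sub by auto
    obtain Y1 X Y2 where t: "Y1 \<subseteq> L" "linked n6 Y1" "card Y1 * d \<le> 2 * g" "card (app1 Y1) \<le> 2 * g"
      "X \<subseteq> nbs (app1 Y1)" "psi * card X \<le> 2 * (g - c)" "Y2 \<subseteq> app1 Y1" "psi * card Y2 \<le> 2 * (g - c)"
      "cl ?Q \<subseteq> appS psi Y1 X Y2" "appF psi Y1 X Y2 \<subseteq> ?Q"
      using container[OF A(1,2) psi(1,2) refl A(3) A(4)] by metis
    have conv: "real n \<le> 2 * dl / real psi" if "psi * n \<le> 2 * (g - c)" for n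
    proof -
      have "real (psi * n) \<le> real (2 * (g - c))" using that by (rule of_nat_mono)
      then show ?thesis using psi by (simp add: dl divide_simps mult_ac)
    qed
    have mem: "Y1 \<in> Ys" "X \<in> Xs Y1" "Y2 \<in> Zs Y1" unfolding Ys_def Xs_def Zs_def using t conv by auto
    let ?S = "appS psi Y1 X Y2" and ?F = "appF psi Y1 X Y2"
    have ASub: "A \<subseteq> ?S" by (rule subset_trans[OF sub_cl_nbs[OF A(1)] t(9)])
    have "A \<in> G Y1 X Y2"
    proof (cases "real (card ?S) \<le> real g - tau * dl")
      case True
      then show ?thesis unfolding G_def using ASub t A by auto
    next
      case False
      \<comment> \<open>Each vertex of \<open>?S\<close> sends at least \<open>d - psi + 1\<close>
        edges into \<open>?F\<close>, and a vertex of \<open>?F\<close> takes at most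
        \<open>d\<close>. Hence a large \<open>?S\<close> forces a large \<open>?F\<close>, and at
        most \<open>tD\<close> vertices of \<open>?Q\<close> remain to be specified.\<close>
      let ?D = "?Q - ?F"
      have SL: "?S \<subseteq> L" using appS_sub by blast
      have FR: "?F \<subseteq> R" using t nbs_L A by blast
      have S2g: "card ?S \<le> 2 * g" using t(4) appS_sub(1) fin1 by (meson card_mono le_trans)
      have "(\<Sum>x\<in>?S. d - psi) \<le> (\<Sum>x\<in>?S. card (nb x \<inter> ?F))"
      proof (rule sum_mono)
        fix x assume x: "x \<in> ?S"
        then have "card (nb x - ?F) < psi" unfolding appS_def by auto
        moreover have xL: "x \<in> L" using x SL by auto
        then have "card (nb x) = card (nb x \<inter> ?F) + card (nb x - ?F)"
          using fin_nb by (metis UnI1 card_Int_Diff)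
        moreover have "card (nb x) = d" using card_nb xL by auto
        ultimately show "d - psi \<le> card (nb x \<inter> ?F)" by linarith
      qed
      also have "\<dots> \<le> d * card ?F" by (rule edges_le[OF SL FR])
      finally have "real (card ?S * (d - psi)) \<le> real (d * card ?F)" by (intro of_nat_mono) simp
      then have "real (card ?S) * (real d - real psi) \<le> real d * real (card ?F)"
        using psi by (simp add: of_nat_diff)
      moreover have "real (card ?S) * real psi \<le> real (2 * g) * real psi" using S2g by (intro mult_right_mono) auto
      ultimately have "real d * real (card ?S) - 2 * real g * real psi \<le> real d * real (card ?F)"
        by (simp add: algebra_simps)
      moreover have "real d * (real g - tau * dl) \<le> real d * real (card ?S)" using False by (intro mult_left_mono) auto
      ultimately have "real d * (real g - real (card ?F)) \<le> real d * tD"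
        using d0 by (simp add: tD algebra_simps)
      then have "real g - real (card ?F) \<le> tD" using d0 by simp
      moreover have "real (card ?D) = real g - real (card ?F)"
        using t(10) A(3) fQ by (simp add: card_Diff_subset finite_subset of_nat_diff card_mono)
      ultimately have "real (card ?D) \<le> tD" by simp
      moreover have "?D \<subseteq> nbs (app1 Y1)"
        using nbs_mono[of A "app1 Y1"] ASub appS_sub(1)[of psi Y1 X Y2] by blast
      ultimately have D: "?D \<in> Ds Y1" unfolding Ds_def by auto
      have "?F \<union> ?D = ?Q" using t(10) by auto
      then have "A \<in> G2 (?F \<union> ?D)" unfolding G2_def using sub_cl_nbs A by auto
      with D have "A \<in> (\<Union>D\<in>Ds Y1. G2 (?F \<union> D))" by (rule UN_I)
      then show ?thesis unfolding G_def by (simp only: if_not_P[OF False])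
    qed
    then show "A \<in> (\<Union>Y1\<in>Ys. \<Union>X\<in>Xs Y1. \<Union>Y2\<in>Zs Y1. G Y1 X Y2)" using mem by blast
  qed
  have w0: "0 \<le> wt (1/3) A" for A by (rule wt_nonneg) simp
  have K0: "K \<ge> 0" by (simp add: K)
  \<comment> \<open>The ground sets have at most \<open>2 * d * g\<close> elements; with weight
    \<open>1 / real d ^ 3\<close> in \<open>card_small_subsets_le\<close> they cost only
    \<open>2 * g / d ^ 2\<close> in the exponent.\<close>
  have lam: "0 < 1 / real d ^ 3" "1 / real d ^ 3 \<le> 1" using d0 by auto
  have nbsc: "card (nbs (app1 Y1)) \<le> d * (2 * g)" if "Y1 \<in> Ys" for Y1
    using that card_nbs_le[OF fin1(2)[of Y1]] unfolding Ys_def by (auto intro: le_trans)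
  have nbsr: "1 / real d ^ 3 * real (card (nbs (app1 Y1))) \<le> 2 * real g / real d ^ 2" if "Y1 \<in> Ys" for Y1
  proof -
    have "real (card (nbs (app1 Y1))) \<le> real (d * (2 * g))" using nbsc[OF that] by (rule of_nat_mono)
    then have "1 / real d ^ 3 * real (card (nbs (app1 Y1))) \<le> 1 / real d ^ 3 * real (d * (2 * g))"
      using d0 by (intro mult_left_mono) auto
    also have "\<dots> = 2 * real g / real d ^ 2" using d0 by (simp add: power3_eq_cube power2_eq_square)
    finally show ?thesis .
  qed
  have cX: "real (card (Xs Y1)) \<le> BX" if "Y1 \<in> Ys" for Y1
  proof -
    have "real (card (Xs Y1)) \<le> exp (2 * dl / real psi * ln (1 / (1 / real d ^ 3)) + 1 / real d ^ 3 * card (nbs (app1 Y1)))"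
      unfolding Xs_def using dl0 by (intro card_small_subsets_le fin1 lam) auto
    also have "\<dots> \<le> BX" using nbsr[OF that] by (simp add: BX)
    finally show ?thesis .
  qed
  have cD: "real (card (Ds Y1)) \<le> BD" if "Y1 \<in> Ys" for Y1
  proof -
    have "real (card (Ds Y1)) \<le> exp (tD * ln (1 / (1 / real d ^ 3)) + 1 / real d ^ 3 * card (nbs (app1 Y1)))"
      unfolding Ds_def using tD0 by (intro card_small_subsets_le fin1 lam) auto
    also have "\<dots> \<le> BD" using nbsr[OF that] by (simp add: BD)
    finally show ?thesis .
  qed
  have cZ: "real (card (Zs Y1)) \<le> BX" if "Y1 \<in> Ys" for Y1
  proof -
    have "real (card (app1 Y1)) \<le> 2 * real g" using that unfolding Ys_def by simp
    then have "1 / real d ^ 3 * real (card (app1 Y1)) \<le> 1 / real d ^ 3 * (2 * real g)"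
      using d0 by (intro mult_left_mono) auto
    also have "\<dots> \<le> 2 * real g / real d ^ 2"
      using d0 by (simp add: frac_le power_increasing)
    finally have a: "1 / real d ^ 3 * real (card (app1 Y1)) \<le> 2 * real g / real d ^ 2" .
    have "real (card (Zs Y1)) \<le> exp (2 * dl / real psi * ln (1 / (1 / real d ^ 3)) + 1 / real d ^ 3 * card (app1 Y1))"
      unfolding Zs_def using dl0 by (intro card_small_subsets_le fin1 lam) auto
    also have "\<dots> \<le> BX" using a by (simp add: BX)
    finally show ?thesis .
  qed
  \<comment> \<open>With container \<open>cl Q\<close> and \<open>F = Q\<close> the covering
    condition holds trivially, and the whole gap \<open>dl\<close> is gained.\<close>
  have wG2: "sum (wt (1/3)) (G2 Q) \<le> K * (2/3) powr dl" if "Q \<subseteq> R" for Q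
  proof (cases "card (cl Q) = c")
    case True
    have cv: "card (nb x - Q) < psi" if "x \<in> cl Q" for x
    proof -
      have "nb x - Q = {}" using that unfolding cl_def by auto
      then have "card (nb x - Q) = 0" by (simp only: card.empty)
      then show ?thesis using psi by linarith
    qed
    have "sum (wt (1/3)) (G2 Q) = (\<Sum>A | A \<subseteq> cl Q \<and> Q \<subseteq> nbs A \<and> card (nbs A) = g. wt (1/3) A)"
      unfolding G2_def using True by (intro sum.cong) auto
    also have "\<dots> \<le> (2/3) powr (real g - real (card (cl Q))) * K"
      unfolding K by (rule container_weight[OF cl_sub that psi cv])
    also have "real g - real (card (cl Q)) = dl" using True gc dl by (simp add: of_nat_diff)
    finally show ?thesis by (simp add: mult.commute)
  next
    case False
    then have "G2 Q = {}" unfolding G2_def by auto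
    then show ?thesis using K0 by simp
  qed
  have wG: "sum (wt (1/3)) (G Y1 X Y2) \<le> ?W" if "Y1 \<in> Ys" "Y2 \<in> Zs Y1" for Y1 X Y2
  proof -
    let ?S = "appS psi Y1 X Y2" and ?F = "appF psi Y1 X Y2"
    have SL: "?S \<subseteq> L" using appS_sub by blast
    have Y2L: "Y2 \<subseteq> L" using that(2) fin1(2) unfolding Zs_def by blast
    have FR: "?F \<subseteq> R" unfolding appF_def using nbs_L[OF Y2L] by auto
    show ?thesis
    proof (cases "real (card ?S) \<le> real g - tau * dl")
      case True
      have "sum (wt (1/3)) (G Y1 X Y2) = (\<Sum>A | A \<subseteq> ?S \<and> ?F \<subseteq> nbs A \<and> card (nbs A) = g. wt (1/3) A)"
        unfolding G_def using True by (intro sum.cong) auto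
      also have "\<dots> \<le> (2/3) powr (real g - real (card ?S)) * K"
        unfolding K by (rule container_weight[OF SL FR psi]) (auto simp: appS_def)
      also have "\<dots> \<le> (2/3) powr (tau * dl) * K"
        using True K0 by (intro mult_right_mono powr_mono') auto
      also have "\<dots> \<le> ?W" using K0 by (simp add: algebra_simps BD)
      finally show ?thesis .
    next
      case False
      have "sum (wt (1/3)) (G Y1 X Y2) = sum (wt (1/3)) (\<Union>D\<in>Ds Y1. G2 (?F \<union> D))"
        unfolding G_def using False by auto
      also have "\<dots> \<le> (\<Sum>D\<in>Ds Y1. sum (wt (1/3)) (G2 (?F \<union> D)))"
        by (intro sum_UN_le finXs finG2 w0)
      also have "\<dots> \<le> BD * (K * (2/3) powr dl)"
      proof (rule sum_le_card_bound[OF _ cD[OF that(1)]])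
        fix D assume "D \<in> Ds Y1"
        then have "D \<subseteq> R" unfolding Ds_def using fin1(4) by blast
        then show "sum (wt (1/3)) (G2 (?F \<union> D)) \<le> K * (2/3) powr dl" using FR by (intro wG2) auto
      qed (use K0 in simp)
      also have "\<dots> \<le> ?W" using K0 by (simp add: algebra_simps)
      finally show ?thesis .
    qed
  qed
  have BX0: "BX \<ge> 0" by (simp add: BX)
  have "(\<Sum>A\<in>polymers g c. wt (1/3) A) \<le> sum (wt (1/3)) (\<Union>Y1\<in>Ys. \<Union>X\<in>Xs Y1. \<Union>Y2\<in>Zs Y1. G Y1 X Y2)"
    using cov finYs finXs finG w0 by (intro sum_mono2) auto
  also have "\<dots> \<le> (\<Sum>Y1\<in>Ys. sum (wt (1/3)) (\<Union>X\<in>Xs Y1. \<Union>Y2\<in>Zs Y1. G Y1 X Y2))"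
    using finYs finXs finG w0 by (intro sum_UN_le) auto
  also have "\<dots> \<le> real (card L) * (2 * real g) * real d powr (24 * real g / real d) * (BX * (BX * ?W))"
  proof (rule sum_le_card_bound)
    fix Y1 assume Y1: "Y1 \<in> Ys"
    have "sum (wt (1/3)) (\<Union>X\<in>Xs Y1. \<Union>Y2\<in>Zs Y1. G Y1 X Y2) \<le> (\<Sum>X\<in>Xs Y1. sum (wt (1/3)) (\<Union>Y2\<in>Zs Y1. G Y1 X Y2))"
      using finXs finG w0 by (intro sum_UN_le) auto
    also have "\<dots> \<le> BX * (BX * ?W)"
    proof (rule sum_le_card_bound[OF _ cX[OF Y1]])
      fix X assume "X \<in> Xs Y1"
      have "sum (wt (1/3)) (\<Union>Y2\<in>Zs Y1. G Y1 X Y2) \<le> (\<Sum>Y2\<in>Zs Y1. sum (wt (1/3)) (G Y1 X Y2))"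
        using finXs finG w0 by (intro sum_UN_le) auto
      also have "\<dots> \<le> BX * ?W" using wG[OF Y1] W0 by (intro sum_le_card_bound[OF _ cZ[OF Y1]]) auto
      finally show "sum (wt (1/3)) (\<Union>Y2\<in>Zs Y1. G Y1 X Y2) \<le> BX * ?W" .
    qed (use BX0 W0 in simp)
    finally show "sum (wt (1/3)) (\<Union>X\<in>Xs Y1. \<Union>Y2\<in>Zs Y1. G Y1 X Y2) \<le> BX * (BX * ?W)" .
  next
    have "real (card Ys) \<le> real (card {Y. Y \<subseteq> L \<and> linked n6 Y \<and> card Y * d \<le> 2 * g})"
      unfolding Ys_def using finL by (intro of_nat_mono card_mono) (auto intro: finite_subset[of _ "Pow L"])
    also note seeds_count
    finally show "real (card Ys) \<le> real (card L) * (2 * real g) * real d powr (24 * real g / real d)" .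
  qed (use BX0 W0 in simp)
  finally show ?thesis .
qed

end

text \<open>Numerical balance, with \<open>x\<close> in the role of the gap. As \<open>g\<close> is
  at most \<open>x * sqrt D / kap\<close>, the seeds cost \<open>x * ln D / sqrt D\<close>, the two
  small sets \<open>x * ln D / psi\<close> and the Hoelder losses
  \<open>x * psi * ln D / sqrt D\<close>, up to constants. For \<open>psi\<close> about
  \<open>D powr (1/4)\<close> all of this is small against the gain \<open>tau * x\<close> with
  \<open>tau = D powr (-1/8)\<close>. Specifying the neighbourhood exactly costs about
  \<open>(tau + psi / sqrt D) * ln D * x\<close>, small against the full gain of order
  \<open>x\<close>. Finally \<open>tau * x\<close> is at least of order
  \<open>D powr (11/8)\<close>, which beats any multiple of \<open>D\<close>.\<close>

lemma container_estimate:
  fixes kap :: real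
  assumes kap: "kap > 0"
  shows "eventually (\<lambda>d::nat. let D = real d; psi = nat \<lceil>D powr (1/4)\<rceil>; tau = D powr (-1/8) in
     1 \<le> psi \<and> 2 * psi \<le> d \<and> d \<le> 3 ^ psi \<and>
     (\<forall>(N::real) (g::real) (x::real). N \<le> exp D \<longrightarrow> 0 \<le> N \<longrightarrow> g \<le> exp D / 2 \<longrightarrow> D^2 / 8 \<le> g \<longrightarrow> kap * g / sqrt D \<le> x \<longrightarrow>
        (\<forall>tD BX BD K. tD = tau * x + 2 * real psi * g / D \<longrightarrow> BX = exp (2 * x / real psi * ln (D ^ 3) + 2 * g / D ^ 2) \<longrightarrow>
           BD = exp (tD * ln (D ^ 3) + 2 * g / D ^ 2) \<longrightarrow> K = (D + 1) powr (6 * real psi * g / D) \<longrightarrow>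
          N * (2 * g) * D powr (24 * g / D) * (BX * (BX * (K * ((2/3) powr (tau * x) + BD * (2/3) powr x))))
          \<le> exp (- 3 * D)))) sequentially"
proof -
  have e1: "eventually (\<lambda>d::nat. 24 * (ln (real d) / (kap * sqrt d)) + 12 * ln (real d) / real d powr (1/4) + 4 / (kap * (sqrt d * real d))
      + 12 * real d powr (1/4) * ln (real d + 1) / (kap * sqrt d) \<le> (1/6) * real d powr (-1/8)) sequentially"
    using kap by real_asymp
  have e2: "eventually (\<lambda>d::nat. (real d powr (-1/8) + 4 * real d powr (1/4) / (kap * sqrt d)) * (3 * ln (real d)) + 2 / (kap * (sqrt d * real d)) \<le> 1/6) sequentially"
    using kap by real_asymp
  have e3: "eventually (\<lambda>d::nat. (1/6) * real d powr (-1/8) * (kap * (real d)^2 / 8 / sqrt d) \<ge> 5 * real d + 1) sequentially"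
    using kap by real_asymp
  have e4: "eventually (\<lambda>d::nat. real d \<le> 3 powr (real d powr (1/4))) sequentially" by real_asymp
  have e5: "eventually (\<lambda>d::nat. 4 * real d powr (1/4) \<le> real d) sequentially" by real_asymp
  have e6: "eventually (\<lambda>d::nat. real d powr (-1/8) \<le> 1/2) sequentially" by real_asymp
  have e7: "eventually (\<lambda>d::nat. d \<ge> 2) sequentially" by (rule eventually_ge_at_top)
  show ?thesis
    using e1 e2 e3 e4 e5 e6 e7
  proof eventually_elim
    case (elim d)
    define D where "D = real d"
    define psi where "psi = nat \<lceil>D powr (1/4)\<rceil>"
    define tau where "tau = D powr (-1/8)"
    define b where "b = D powr (1/4)"
    define s where "s = sqrt D"
    have D2: "D \<ge> 2" using elim unfolding D_def by linarith
    have s0: "s > 0" "s * s = D" using D2 unfolding s_def by auto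
    have b1: "b \<ge> 1" using D2 unfolding b_def by (simp add: ge_one_powr_ge_zero)
    have tau0: "tau > 0" using D2 unfolding tau_def by simp
    have lnD: "ln D \<ge> 0" "ln (D + 1) \<ge> 0" using D2 by auto
    note E = elim[folded D_def, folded b_def tau_def s_def]
    have psi_ge: "b \<le> real psi" unfolding psi_def b_def by linarith
    have psi_le: "real psi \<le> 2 * b" using b1 unfolding psi_def b_def by linarith
    have p1: "1 \<le> psi" using psi_ge b1 by linarith
    have p2: "2 * psi \<le> d"
    proof -
      have "2 * real psi \<le> D" using psi_le E(5) by linarith
      then show ?thesis unfolding D_def by linarith
    qed
    have p3: "d \<le> 3 ^ psi"
    proof -
      have "D \<le> 3 powr b" using E(4) .
      also have "\<dots> \<le> 3 powr (real psi)" using psi_ge by (intro powr_mono) auto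
      also have "\<dots> = real (3 ^ psi)" by (simp add: powr_realpow)
      finally show ?thesis unfolding D_def by (simp only: of_nat_le_iff)
    qed
    have main: "N * (2 * g) * D powr (24 * g / D) * (BX * (BX * (K * ((2/3) powr (tau * x) + BD * (2/3) powr x)))) \<le> exp (- 3 * D)"
      if N: "N \<le> exp D" "0 \<le> N" and g: "g \<le> exp D / 2" "D^2 / 8 \<le> g" and x: "kap * g / s \<le> x"
        and tD: "tD = tau * x + 2 * real psi * g / D" and BX: "BX = exp (2 * x / real psi * ln (D ^ 3) + 2 * g / D ^ 2)"
        and BD: "BD = exp (tD * ln (D ^ 3) + 2 * g / D ^ 2)" and K: "K = (D + 1) powr (6 * real psi * g / D)"
      for N g x tD BX BD K :: real
    proof -
      have g0: "g \<ge> 0" using g(2) by (smt (verit) zero_le_power2 divide_nonneg_pos)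
      have "kap * g \<le> x * s" using x s0 by (simp add: divide_simps)
      then have gs: "g \<le> x * s / kap" using kap by (simp add: field_simps)
      have x0: "x \<ge> 0" using x g0 kap s0 by (smt (verit) divide_nonneg_pos mult_nonneg_nonneg)
      have gD: "g / D \<le> x / (kap * s)"
      proof -
        have "g / D \<le> (x * s / kap) / (s * s)" using gs s0 D2 g0 x0 kap by (intro frac_le) auto
        also have "(x * s / kap) / (s * s) = x / (kap * s)" using s0(1) by simp
        finally show ?thesis .
      qed
      have gD2: "g / D\<^sup>2 \<le> x / (kap * (s * D))"
      proof -
        have "g / D / D \<le> x / (kap * s) / D" using gD D2 by (intro divide_right_mono) auto
        then show ?thesis by (simp add: power2_eq_square mult_ac)
      qed
      have l3: "ln (D ^ 3) = 3 * ln D" using D2 by (simp add: ln_realpow)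
      have ln23: "ln (2/3::real) \<le> - 1/3" using ln_le_minus_one[of "2/3::real"] by simp
      have t1: "24 * g / D * ln D \<le> x * (24 * (ln D / (kap * s)))"
        using mult_right_mono[OF gD, of "24 * ln D"] lnD by (simp add: mult_ac)
      have t2: "2 * x / real psi * ln (D ^ 3) + 2 * g / D ^ 2 \<le> x * (6 * ln D / b + 2 / (kap * (s * D)))"
      proof -
        have "2 * x / real psi * ln (D ^ 3) \<le> 2 * x / b * (3 * ln D)"
          unfolding l3 using psi_ge b1 x0 lnD by (intro mult_right_mono divide_left_mono) auto
        moreover have "x * (6 * ln D / b + 2 / (kap * (s * D))) = 2 * x / b * (3 * ln D) + 2 * (x / (kap * (s * D)))"
          by (simp add: algebra_simps)
        moreover have "2 * g / D ^ 2 = 2 * (g / D ^ 2)" by simp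
        ultimately show ?thesis using gD2 by linarith
      qed
      have t3: "6 * real psi * g / D * ln (D + 1) \<le> x * (12 * b * ln (D + 1) / (kap * s))"
      proof -
        have "real psi * (g / D) \<le> 2 * b * (x / (kap * s))" using psi_le gD b1 g0 D2 by (intro mult_mono) auto
        from mult_right_mono[OF this, of "6 * ln (D + 1)"] lnD show ?thesis by (simp add: mult_ac)
      qed
      have t4: "tD * ln (D ^ 3) + 2 * g / D ^ 2 \<le> x * (1/6)"
      proof -
        have "real psi * (g / D) \<le> 2 * b * (x / (kap * s))" using psi_le gD b1 g0 D2 by (intro mult_mono) auto
        moreover have "2 * real psi * g / D = 2 * (real psi * (g / D))" by simp
        moreover have "x * (tau + 4 * b / (kap * s)) = tau * x + 2 * (2 * b * (x / (kap * s)))"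
          by (simp add: algebra_simps)
        ultimately have "tD \<le> x * (tau + 4 * b / (kap * s))" unfolding tD by linarith
        from mult_right_mono[OF this, of "3 * ln D"] lnD
        have "tD * ln (D ^ 3) \<le> x * ((tau + 4 * b / (kap * s)) * (3 * ln D))" unfolding l3 by (simp add: mult_ac)
        moreover have "2 * g / D ^ 2 \<le> x * (2 / (kap * (s * D)))"
        proof -
          have "2 * g / D ^ 2 = 2 * (g / D ^ 2)" "x * (2 / (kap * (s * D))) = 2 * (x / (kap * (s * D)))" by simp_all
          then show ?thesis using gD2 by linarith
        qed
        ultimately have "tD * ln (D ^ 3) + 2 * g / D ^ 2 \<le> x * ((tau + 4 * b / (kap * s)) * (3 * ln D) + 2 / (kap * (s * D)))"
          by (simp only: distrib_left)
        also have "\<dots> \<le> x * (1/6)" using E(2) x0 by (intro mult_left_mono) auto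
        finally show ?thesis .
      qed
      define a where "a = 24 * g / D * ln D + 2 * (2 * x / real psi * ln (D ^ 3) + 2 * g / D ^ 2) + 6 * real psi * g / D * ln (D + 1)"
      have "a \<le> x * (24 * (ln D / (kap * s)) + 12 * ln D / b + 4 / (kap * (s * D)) + 12 * b * ln (D + 1) / (kap * s))"
      proof -
        have "x * (24 * (ln D / (kap * s)) + 12 * ln D / b + 4 / (kap * (s * D)) + 12 * b * ln (D + 1) / (kap * s))
          = x * (24 * (ln D / (kap * s))) + 2 * (x * (6 * ln D / b + 2 / (kap * (s * D)))) + x * (12 * b * ln (D + 1) / (kap * s))"
          by (simp add: algebra_simps)
        moreover have comb: "u1 + 2 * u2 + u3 \<le> v1 + 2 * v2 + v3" if "u1 \<le> v1" "u2 \<le> v2" "u3 \<le> v3" for u1 u2 u3 v1 v2 v3 :: real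
          using that by linarith
        ultimately show ?thesis unfolding a_def using comb[OF t1 t2 t3] by (simp only:)
      qed
      also have "\<dots> \<le> x * ((1/6) * tau)" using E(1) x0 by (intro mult_left_mono) auto
      finally have a: "a \<le> (1/6) * tau * x" by (simp add: mult_ac)
      have q1: "(2/3) powr (tau * x) \<le> exp (- (1/3) * tau * x)"
      proof -
        have "tau * x * ln (2/3) \<le> tau * x * (- 1/3)" using ln23 tau0 x0 by (intro mult_left_mono) auto
        then show ?thesis by (simp add: powr_def mult_ac)
      qed
      have q2: "BD * (2/3) powr x \<le> exp (- (1/3) * tau * x)"
      proof -
        have "x * ln (2/3) \<le> x * (- 1/3)" using ln23 x0 by (intro mult_left_mono) auto
        moreover have "tau * x \<le> 1/2 * x" using E(6) x0 by (intro mult_right_mono) auto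
        ultimately have "tD * ln (D ^ 3) + 2 * g / D ^ 2 + x * ln (2/3) \<le> - (1/3) * tau * x" using t4 by linarith
        then show ?thesis unfolding BD by (simp add: powr_def exp_add[symmetric])
      qed
      have "D powr (24 * g / D) * (BX * (BX * (K * ((2/3) powr (tau * x) + BD * (2/3) powr x))))
         = exp a * ((2/3) powr (tau * x) + BD * (2/3) powr x)"
      proof -
        have "exp u * (exp v * (exp v * (exp w * z))) = exp (u + 2 * v + w) * z" for u v w z :: real
          unfolding mult_2 by (simp only: exp_add mult_ac)
        moreover have "D powr (24 * g / D) = exp (24 * g / D * ln D)" "K = exp (6 * real psi * g / D * ln (D + 1))"
          unfolding K powr_def using D2 by auto
        ultimately show ?thesis unfolding BX a_def by (simp only:)
      qed
      also have "\<dots> \<le> exp ((1/6) * tau * x) * (2 * exp (- (1/3) * tau * x))"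
        using a q1 q2 by (intro mult_mono) (auto simp: BD)
      also have "\<dots> = 2 * exp (- (1/6) * tau * x)" by (simp add: exp_add[symmetric])
      also have "\<dots> \<le> 2 * exp (- (5 * D + 1))"
      proof -
        have "kap * (D\<^sup>2 / 8) / s \<le> kap * g / s" using g(2) kap s0 by (intro divide_right_mono mult_left_mono) auto
        then have "kap * D\<^sup>2 / 8 / s \<le> x" using x by simp
        then have "(1/6) * tau * (kap * D\<^sup>2 / 8 / s) \<le> (1/6) * tau * x" using tau0 by (intro mult_left_mono) auto
        with E(3) have "5 * D + 1 \<le> (1/6) * tau * x" by (rule order_trans)
        then have "- (1/6) * tau * x \<le> - (5 * D + 1)" by linarith
        then show ?thesis by (simp only: exp_le_cancel_iff mult_left_mono)
      qed
      also have "\<dots> \<le> exp (- 5 * D)"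
      proof -
        have "2 * exp (-1) \<le> (1::real)" using exp_ge_add_one_self[of "1::real"] by (simp add: exp_minus divide_simps)
        then have "exp (- 5 * D) * (2 * exp (-1)) \<le> exp (- 5 * D) * 1" by (intro mult_left_mono) auto
        moreover have "exp (- (5 * D + 1)) = exp (- 5 * D) * exp (-1)" by (simp flip: exp_add)
        ultimately show ?thesis by simp
      qed
      finally have F: "D powr (24 * g / D) * (BX * (BX * (K * ((2/3) powr (tau * x) + BD * (2/3) powr x)))) \<le> exp (- 5 * D)" .
      have "N * (2 * g) * (D powr (24 * g / D) * (BX * (BX * (K * ((2/3) powr (tau * x) + BD * (2/3) powr x)))))
        \<le> exp D * exp D * exp (- 5 * D)"
        using N g g0 F by (intro mult_mono) (auto simp: BX K BD)
      also have "\<dots> = exp (- 3 * D)" by (simp add: exp_add[symmetric])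
      finally show ?thesis by (simp only: mult.assoc)
    qed
    show ?case
      unfolding Let_def D_def[symmetric] psi_def[symmetric] tau_def[symmetric] s_def[symmetric]
      using p1 p2 p3 main by blast
  qed
qed

section \<open>The total weight of the polymers\<close>

text \<open>What is needed from the cube beyond regularity. \<open>iso\<close> says that, apart from
  the factor \<open>1 - card C / card L\<close>, a set expands by a relative amount of at least
  \<open>1 / sqrt d\<close>.\<close>

locale cubical = biregular +
  assumes cardL: "card L = 2 ^ (d - 1)"
    and codeg: "x \<in> L \<Longrightarrow> x' \<in> L \<Longrightarrow> x \<noteq> x' \<Longrightarrow> card (nb x \<inter> nb x') \<le> 2"
    and iso: "C \<subseteq> L \<Longrightarrow> real (card C) * (real (card L) - real (card C))
       \<le> sqrt (real d) * real (card L) * (real (card (nbs C)) - real (card C))"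
begin

section \<open>Lower bounds for gaps and neighbourhoods\<close>

lemma cardR: "card R = card L"
proof -
  have "(\<Sum>x\<in>L. card (nb x \<inter> R)) = (\<Sum>x\<in>L. d)"
    using nbL card_nb by (intro sum.cong refl) (auto simp: Int_absorb2)
  moreover have "(\<Sum>y\<in>R. card (nb y \<inter> L)) = (\<Sum>y\<in>R. d)"
    using nbR card_nb by (intro sum.cong refl) (auto simp: Int_absorb2)
  ultimately show ?thesis using edge_count[of L R] d1 by simp
qed

lemma nbs_cl_nbs: "A \<subseteq> L \<Longrightarrow> nbs (cl (nbs A)) = nbs A"
  using nbs_cl nbs_mono[OF sub_cl_nbs] by blast

text \<open>Isoperimetry bounds the gap from below by the closure. If the closure is at least half
  of the neighbourhood this suffices; otherwise the gap itself is at least half of it.\<close>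

lemma gap_lower:
  fixes eps :: real
  assumes A: "A \<subseteq> L" and eps: "0 < eps" "eps \<le> 1" and c: "real (card (cl (nbs A))) \<le> (1 - eps) * real (card L)"
  shows "eps / 2 * real (card (nbs A)) / sqrt (real d) \<le> real (card (nbs A) - card (cl (nbs A)))"
proof -
  let ?c = "real (card (cl (nbs A)))" and ?g = "real (card (nbs A))" and ?N = "real (card L)" and ?s = "sqrt (real d)"
  have le: "card (cl (nbs A)) \<le> card (nbs A)" using A nbs_L card_cl_le by auto
  have s1: "?s \<ge> 1" using d1 by simp
  have N0: "?N > 0" using cardL by simp
  have "?c * (eps * ?N) \<le> ?c * (?N - ?c)" using c by (intro mult_left_mono) (auto simp: algebra_simps)
  also have "\<dots> \<le> ?s * ?N * (?g - ?c)" using iso[OF cl_sub, of "nbs A"] nbs_cl_nbs[OF A] by simp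
  finally have "?N * (?c * eps) \<le> ?N * (?s * (?g - ?c))" by (simp add: mult_ac)
  then have 1: "?c * eps \<le> ?s * (?g - ?c)" using N0 by simp
  have "eps / 2 * ?g \<le> ?s * (?g - ?c)"
  proof (cases "?g - ?c \<ge> ?c")
    case True
    have "eps / 2 * ?g \<le> 1 / 2 * ?g" using eps by (intro mult_right_mono) auto
    also have "\<dots> \<le> 1 * (?g - ?c)" using True by simp
    also have "\<dots> \<le> ?s * (?g - ?c)" using s1 le by (intro mult_right_mono) auto
    finally show ?thesis .
  next
    case False
    then have "eps * (?g / 2) \<le> eps * ?c" using eps by (intro mult_left_mono) auto
    then show ?thesis using 1 by (simp add: mult.commute)
  qed
  then show ?thesis using s1 le by (simp add: of_nat_diff divide_simps mult_ac)
qed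

text \<open>Adding a vertex to \<open>k\<close> earlier ones loses at most 2 common neighbours with
  each; the losses \<open>2 * k\<close> add up to \<open>card A * (card A - 1)\<close>.\<close>

lemma nbs_lower:
  assumes "A \<subseteq> L" shows "d * card A \<le> card (nbs A) + card A * (card A - 1)"
proof -
  have "finite A" using assms fin_sub by auto
  then show ?thesis using assms
  proof (induction A rule: finite_induct)
    case (insert x A)
    have xL: "x \<in> L" and AL: "A \<subseteq> L" using insert by auto
    have "card (nb x \<inter> nbs A) \<le> (\<Sum>a\<in>A. card (nb x \<inter> nb a))"
    proof -
      have "nb x \<inter> nbs A = (\<Union>a\<in>A. nb x \<inter> nb a)" unfolding nbs_def by auto
      then show ?thesis using card_UN_le[OF insert.hyps(1), of "\<lambda>a. nb x \<inter> nb a"] by simp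
    qed
    also have "\<dots> \<le> (\<Sum>a\<in>A. 2)" using codeg xL AL insert.hyps by (intro sum_mono) auto
    finally have 1: "card (nb x \<inter> nbs A) \<le> 2 * card A" by simp
    have f: "finite (nb x)" "finite (nbs A)" using fin_nb xL AL nbs_L fin_sub by auto
    have "nbs (insert x A) = nb x \<union> nbs A" unfolding nbs_def by auto
    then have "card (nbs (insert x A)) + card (nb x \<inter> nbs A) = d + card (nbs A)"
      using card_Un_Int[OF f] card_nb xL by simp
    then have "d + card (nbs A) \<le> card (nbs (insert x A)) + 2 * card A" using 1 by simp
    moreover have "d * card A \<le> card (nbs A) + card A * (card A - 1)" using insert AL by auto
    ultimately have "d * (card A + 1) \<le> card (nbs (insert x A)) + (2 * card A + card A * (card A - 1))"
      unfolding distrib_left mult_1_right by linarith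
    also have "2 * card A + card A * (card A - 1) = (card A + 1) * card A"
      by (cases "card A") (auto simp: algebra_simps)
    finally have "d * (card A + 1) \<le> card (nbs (insert x A)) + (card A + 1) * card A" .
    moreover have "card (insert x A) = card A + 1" using insert.hyps by simp
    ultimately show ?case by (simp only: add_diff_cancel_right')
  qed simp
qed

lemma nbs_lower_small:
  assumes "A \<subseteq> L" "6 * card A \<le> d + 6"
  shows "5 * d * card A \<le> 6 * card (nbs A)"
proof (cases "card A")
  case (Suc m)
  have "6 * (d * card A) \<le> 6 * card (nbs A) + card A * (6 * m)" using nbs_lower[OF assms(1)] Suc by simp
  also have "card A * (6 * m) \<le> card A * d" using assms Suc by (intro mult_left_mono) auto
  finally show ?thesis by simp
qed simp

text \<open>Apply \<open>nbs_lower_small\<close> to a subset with \<open>d / 6\<close> elements,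
  rounded up.\<close>

lemma nbs_lower_large:
  assumes A: "A \<subseteq> L" and a: "d \<le> 6 * card A"
  shows "5 * d\<^sup>2 \<le> 36 * card (nbs A)"
proof -
  define m where "m = (d + 5) div 6"
  have m: "d \<le> 6 * m" "6 * m \<le> d + 6" unfolding m_def by linarith+
  have "m \<le> card A" using a unfolding m_def by linarith
  then obtain B where B: "B \<subseteq> A" "card B = m" by (meson obtain_subset_with_card_n)
  have "5 * d * m \<le> 6 * card (nbs B)" using nbs_lower_small[of B] B A m by auto
  also have "card (nbs B) \<le> card (nbs A)" using nbs_mono[OF B(1)] A nbs_L fin_sub by (intro card_mono) auto
  finally have "5 * d * m \<le> 6 * card (nbs A)" by simp
  then have h: "5 * d * (6 * m) \<le> 36 * card (nbs A)" by simp
  have "5 * d * d \<le> 5 * d * (6 * m)" using m by (intro mult_left_mono) auto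
  from le_trans[OF this h] show ?thesis by (simp add: power2_eq_square mult.assoc)
qed

text \<open>Direct count. Each vertex beyond the second brings at most \<open>d ^ 4\<close> more
  choices and at least \<open>0.35 * d\<close> more neighbours, so the sum over sizes is governed by
  the pairs, of which there are about \<open>2 ^ d\<close> up to powers of \<open>d\<close>.\<close>

lemma small_polymers:
  assumes d20: "d \<ge> 20" and small: "real d ^ 4 * (2/3) powr (0.35 * real d) \<le> 1"
  shows "(\<Sum>A | A \<subseteq> L \<and> linked n2 A \<and> 2 \<le> card A \<and> 6 * card A < d. wt (1/3) A)
     \<le> real d ^ 9 * 2 ^ d * (2/3) powr (1.9 * real d)"
proof -
  define P where "P a v = {A. A \<subseteq> L \<and> linked n2 A \<and> v \<in> A \<and> card A = a}" for a :: nat and v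
  have finP: "finite (P a v)" for a v unfolding P_def using finL by (auto intro: finite_subset[of _ "Pow L"])
  have w0: "0 \<le> wt (1/3) A" for A by (rule wt_nonneg) simp
  let ?I = "{a. 2 \<le> a \<and> 6 * a < d}"
  have finI: "finite ?I" by (rule finite_subset[of _ "{..d}"]) auto
  have cov: "{A. A \<subseteq> L \<and> linked n2 A \<and> 2 \<le> card A \<and> 6 * card A < d} \<subseteq> (\<Union>a\<in>?I. \<Union>v\<in>L. P a v)"
    unfolding P_def linked_def by blast
  have trm: "sum (wt (1/3)) (P a v) \<le> real d ^ 8 * (2/3) powr (1.9 * real d)" if a: "a \<in> ?I" and v: "v \<in> L" for a v
  proof -
    have n2s: "finite (n2 x) \<and> n2 x \<subseteq> L \<and> card (n2 x) \<le> d ^ 2" if "x \<in> L" for x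
      using n2_sub[OF that] card_n2[OF that] fin_sub(1) by auto
    have a1: "1 \<le> a" using a by simp
    have "card (P a v) \<le> (d ^ 2) ^ (2 * a - 2)" unfolding P_def
      by (rule linked_count[OF n2s v n2_sym a1 finL])
    also have "\<dots> \<le> (d ^ 2) ^ (2 * a)" using d1 by (intro power_increasing) auto
    finally have "real (card (P a v)) \<le> real ((d ^ 2) ^ (2 * a))" by (rule of_nat_mono)
    also have "\<dots> = real d ^ 8 * (real d ^ 4) ^ (a - 2)"
    proof -
      have e: "2 * (2 * a) = 8 + 4 * (a - 2)" using a by auto
      have "real ((d ^ 2) ^ (2 * a)) = real d ^ (2 * (2 * a))" by (simp add: power_mult)
      also have "\<dots> = real d ^ (8 + 4 * (a - 2))" by (simp only: e)
      finally show ?thesis by (simp only: power_add power_mult)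
    qed
    finally have cP: "real (card (P a v)) \<le> real d ^ 8 * (real d ^ 4) ^ (a - 2)" .
    have "sum (wt (1/3)) (P a v) \<le> (real d ^ 8 * (real d ^ 4) ^ (a - 2)) * (2/3) powr (1.9 * real d + 0.35 * real d * (real a - 2))"
    proof (rule sum_le_card_bound[OF _ cP])
      fix A assume "A \<in> P a v"
      then have A: "A \<subseteq> L" "card A = a" unfolding P_def by auto
      \<comment> \<open>The ratio 5/6 from \<open>nbs_lower_small\<close> would give
        \<open>5 * d / 3\<close> neighbours for a pair, and
        \<open>2 ^ d * (2/3) powr (5 * d / 3)\<close> does not tend to 0. So pairs use the sharper
        \<open>2 * d - 2\<close>, which exceeds \<open>1.9 * d\<close> from \<open>d = 20\<close>
        on.\<close>
      have "1.9 * real d + 0.35 * real d * (real a - 2) \<le> real (card (nbs A))"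
      proof (cases "a = 2")
        case True
        have "d * 2 \<le> card (nbs A) + 2" using nbs_lower[OF A(1)] A(2) True by simp
        then have "2 * real d \<le> real (card (nbs A)) + 2" by linarith
        moreover have "real d \<ge> 20" using d20 by simp
        ultimately show ?thesis using True by simp
      next
        case False
        have "5 * d * a \<le> 6 * card (nbs A)" using nbs_lower_small[OF A(1)] A(2) a by auto
        then have "5 * real d * real a \<le> 6 * real (card (nbs A))"
          by (metis of_nat_le_iff of_nat_mult of_nat_numeral)
        moreover have "real a \<ge> 3" using a False by auto
        then have "real d * 3 \<le> real d * real a" by (intro mult_left_mono) auto
        moreover have "real d \<ge> 0" by simp
        moreover have "1.9 * real d + 0.35 * real d * (real a - 2) = 1.2 * real d + 0.35 * (real d * real a)"
          by (simp add: field_simps)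
        moreover have "1.2 * x + 0.35 * y \<le> g" if "5 * y \<le> 6 * g" "x * 3 \<le> y" "0 \<le> x" for x y g :: real
          using that by simp
        ultimately show ?thesis unfolding mult.assoc by (simp only:)
      qed
      have "wt (1/3) A \<le> (2/3) powr (card (nbs A))"
        using wt_le_power[OF A(1), of "1/3"] by (simp add: powr_realpow)
      also have "\<dots> \<le> (2/3) powr (1.9 * real d + 0.35 * real d * (real a - 2))"
        using \<open>1.9 * real d + _ \<le> _\<close> by (intro powr_mono') auto
      finally show "wt (1/3) A \<le> (2/3) powr (1.9 * real d + 0.35 * real d * (real a - 2))" .
    qed simp
    also have "\<dots> = real d ^ 8 * (2/3) powr (1.9 * real d) * (real d ^ 4 * (2/3) powr (0.35 * real d)) ^ (a - 2)"
      using a by (simp add: powr_add power_mult_distrib powr_power of_nat_diff mult_ac)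
    also have "\<dots> \<le> real d ^ 8 * (2/3) powr (1.9 * real d) * 1"
      using small by (intro mult_left_mono power_le_one) auto
    finally show ?thesis by simp
  qed
  have "(\<Sum>A | A \<subseteq> L \<and> linked n2 A \<and> 2 \<le> card A \<and> 6 * card A < d. wt (1/3) A) \<le> sum (wt (1/3)) (\<Union>a\<in>?I. \<Union>v\<in>L. P a v)"
    using cov finI finL finP w0 by (intro sum_mono2) auto
  also have "\<dots> \<le> (\<Sum>a\<in>?I. sum (wt (1/3)) (\<Union>v\<in>L. P a v))" using finI finL finP w0 by (intro sum_UN_le) auto
  also have "\<dots> \<le> real d * (2 ^ d * (real d ^ 8 * (2/3) powr (1.9 * real d)))"
  proof (rule sum_le_card_bound)
    fix a assume a: "a \<in> ?I"
    have "sum (wt (1/3)) (\<Union>v\<in>L. P a v) \<le> (\<Sum>v\<in>L. sum (wt (1/3)) (P a v))" using finL finP w0 by (intro sum_UN_le) auto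
    also have "\<dots> \<le> 2 ^ d * (real d ^ 8 * (2/3) powr (1.9 * real d))"
    proof (rule sum_le_card_bound[OF trm[OF a]])
      show "real (card L) \<le> 2 ^ d" using cardL by (simp add: power_increasing)
    qed auto
    finally show "sum (wt (1/3)) (\<Union>v\<in>L. P a v) \<le> 2 ^ d * (real d ^ 8 * (2/3) powr (1.9 * real d))" .
  next
    have "card ?I \<le> card {1..d}" by (intro card_mono) auto
    then show "real (card ?I) \<le> real d" by simp
  qed auto
  finally show ?thesis by (simp add: eval_nat_numeral mult_ac)
qed

text \<open>There are at most \<open>exp (2 * d)\<close> pairs of sizes \<open>g\<close> and
  \<open>c\<close>, and each class contributes at most \<open>exp (- 3 * d)\<close>. The hypothesis
  \<open>est\<close> is \<open>container_estimate\<close> at this \<open>d\<close> with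
  \<open>kap = eps / 2\<close> from \<open>gap_lower\<close>; a polymer with at least
  \<open>d / 6\<close> vertices has the required \<open>g \<ge> d\<^sup>2 / 8\<close>.\<close>

lemma big_polymers:
  fixes eps :: real
  assumes eps: "0 < eps" "eps \<le> 1" and psi: "1 \<le> psi" "2 * psi \<le> d" "d \<le> 3 ^ psi" and tau: "0 \<le> tau"
    and est: "\<And>(N::real) (g::real) (x::real) tD BX BD K. N \<le> exp (real d) \<Longrightarrow> 0 \<le> N \<Longrightarrow> g \<le> exp (real d) / 2 \<Longrightarrow> (real d)^2 / 8 \<le> g \<Longrightarrow> eps / 2 * g / sqrt (real d) \<le> x \<Longrightarrow>
         tD = tau * x + 2 * real psi * g / (real d) \<Longrightarrow> BX = exp (2 * x / real psi * ln ((real d) ^ 3) + 2 * g / (real d) ^ 2) \<Longrightarrow>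
           BD = exp (tD * ln ((real d) ^ 3) + 2 * g / (real d) ^ 2) \<Longrightarrow> K = ((real d) + 1) powr (6 * real psi * g / (real d)) \<Longrightarrow>
          N * (2 * g) * (real d) powr (24 * g / (real d)) * (BX * (BX * (K * ((2/3) powr (tau * x) + BD * (2/3) powr x))))
          \<le> exp (- 3 * (real d))"
  shows "(\<Sum>A | A \<subseteq> L \<and> linked n2 A \<and> d \<le> 6 * card A \<and> real (card (cl (nbs A))) \<le> (1 - eps) * real (card L). wt (1/3) A)
     \<le> exp (- real d)"
proof -
  let ?N = "card L"
  have w0: "0 \<le> wt (1/3) A" for A by (rule wt_nonneg) simp
  have finP: "finite (polymers g c)" for g c unfolding polymers_def using finL by (auto intro: finite_subset[of _ "Pow L"])
  define I where "I = {(g, c). g \<le> ?N \<and> c \<le> g \<and> 5 * d\<^sup>2 \<le> 36 * g \<and> eps / 2 * real g / sqrt (real d) \<le> real (g - c)}"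
  have Isub: "I \<subseteq> {..?N} \<times> {..?N}" unfolding I_def by auto
  have finI: "finite I" by (rule finite_subset[OF Isub]) simp
  have N2: "real ?N + 1 \<le> exp (real d)"
  proof -
    have "?N + 1 \<le> 2 ^ d" using cardL d1 by (cases d) auto
    then have "real (?N + 1) \<le> real (2 ^ d)" by (rule of_nat_mono)
    also have "\<dots> = 2 ^ d" by simp
    also have "(2::real) ^ d \<le> exp 1 ^ d" using exp_ge_add_one_self[of "1::real"] by (intro power_mono) auto
    finally show ?thesis by (simp add: exp_of_nat_mult[symmetric])
  qed
  have N3: "real ?N \<le> exp (real d) / 2"
  proof -
    have "2 * ?N = 2 ^ d" using cardL d1 by (cases d) auto
    then have "real (2 * ?N) = real (2 ^ d)" by (rule arg_cong)
    then have "2 * real ?N = 2 ^ d" by simp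
    also have "(2::real) ^ d \<le> exp 1 ^ d" using exp_ge_add_one_self[of "1::real"] by (intro power_mono) auto
    finally show ?thesis by (simp add: exp_of_nat_mult[symmetric])
  qed
  have "{A. A \<subseteq> L \<and> linked n2 A \<and> d \<le> 6 * card A \<and> real (card (cl (nbs A))) \<le> (1 - eps) * real (card L)}
     \<subseteq> (\<Union>p\<in>I. polymers (fst p) (snd p))" (is "?P \<subseteq> _")
  proof
    fix A assume A: "A \<in> ?P"
    have "card (nbs A) \<le> ?N" using A nbs_L finR cardR by (metis (no_types, lifting) card_mono mem_Collect_eq)
    moreover have "card (cl (nbs A)) \<le> card (nbs A)" using A nbs_L card_cl_le by auto
    ultimately have "(card (nbs A), card (cl (nbs A))) \<in> I" unfolding I_def
      using A gap_lower[OF _ eps, of A] nbs_lower_large[of A] by auto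
    moreover have "A \<in> polymers (card (nbs A)) (card (cl (nbs A)))" unfolding polymers_def using A by auto
    ultimately show "A \<in> (\<Union>p\<in>I. polymers (fst p) (snd p))" by force
  qed
  then have "sum (wt (1/3)) ?P \<le> sum (wt (1/3)) (\<Union>p\<in>I. polymers (fst p) (snd p))"
    using finI finP w0 by (intro sum_mono2) auto
  also have "\<dots> \<le> (\<Sum>p\<in>I. sum (wt (1/3)) (polymers (fst p) (snd p)))" using finI finP w0 by (intro sum_UN_le) auto
  also have "\<dots> \<le> (exp (real d) * exp (real d)) * exp (- 3 * real d)"
  proof (rule sum_le_card_bound)
    fix p assume "p \<in> I"
    then obtain g c where p: "p = (g, c)" "g \<le> ?N" "c \<le> g" "5 * d\<^sup>2 \<le> 36 * g" "eps / 2 * real g / sqrt (real d) \<le> real (g - c)"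
      unfolding I_def by auto
    have "real (5 * d\<^sup>2) \<le> real (36 * g)" using p(4) by (rule of_nat_mono)
    then have g8: "(real d)\<^sup>2 / 8 \<le> real g" by simp
    have gN: "real g \<le> exp (real d) / 2" using p(2) N3 by linarith
    have "sum (wt (1/3)) (polymers g c) \<le> exp (- 3 * real d)"
      using polymer_sum_bound[OF psi tau p(3) refl refl refl refl refl]
        est[OF _ _ gN g8 p(5) refl refl refl refl, of "real ?N"] N2 by (meson le_add_same_cancel1 of_nat_0_le_iff order_trans zero_le_one)
    then show "sum (wt (1/3)) (polymers (fst p) (snd p)) \<le> exp (- 3 * real d)" using p by simp
  next
    have "card I \<le> card ({..?N} \<times> {..?N})" by (intro card_mono Isub) auto
    then have "real (card I) \<le> real ((?N + 1) * (?N + 1))" by (intro of_nat_mono) (simp add: card_cartesian_product)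
    also have "\<dots> = (real ?N + 1) * (real ?N + 1)" by (simp only: of_nat_mult of_nat_add of_nat_1)
    also have "\<dots> \<le> exp (real d) * exp (real d)" using N2 by (intro mult_mono) auto
    finally show "real (card I) \<le> exp (real d) * exp (real d)" .
  qed simp
  also have "\<dots> = exp (- real d)" by (simp add: exp_add[symmetric])
  finally show ?thesis .
qed

end

lemma polymers_total:
  fixes eps :: real
  assumes eps: "0 < eps" "eps \<le> 1"
  shows "eventually (\<lambda>d. \<forall>L R (nb :: 'a \<Rightarrow> 'a set). cubical L R nb d \<longrightarrow>
    (\<Sum>A | A \<subseteq> L \<and> linked (biregular.n2 nb) A \<and> 2 \<le> card A \<and>
        real (card (biregular.cl L nb (biregular.nbs nb A))) \<le> (1 - eps) * real (card L). biregular.wt nb (1/3) A)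
     \<le> 2 * exp (- real d / 20)) sequentially"
proof -
  have e1: "eventually (\<lambda>d::nat. real d ^ 4 * (2/3) powr (0.35 * real d) \<le> 1) sequentially" by real_asymp
  have e2: "eventually (\<lambda>d::nat. real d ^ 9 * 2 ^ d * (2/3) powr (1.9 * real d) \<le> exp (- real d / 20)) sequentially"
  proof -
    \<comment> \<open>Ten times \<open>ln 2 + 1.9 * ln (2/3)\<close> is the logarithm of
      \<open>2 ^ 29 / 3 ^ 19\<close>, about 0.462. The resulting rate 0.053 leaves room for the
      factor \<open>d ^ 9\<close> above the rate 1/20.\<close>
    have "ln (2 ^ 29 / 3 ^ 19 :: real) \<le> 2 ^ 29 / 3 ^ 19 - 1" by (rule ln_le_minus_one) simp
    also have "\<dots> \<le> - (53/100)" by simp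
    finally have "ln (2 ^ 29 / 3 ^ 19 :: real) \<le> - (53/100)" .
    moreover have "ln (2 ^ 29 / 3 ^ 19 :: real) = 29 * ln 2 - 19 * ln 3"
      using ln_div[of "2 ^ 29 :: real" "3 ^ 19"] ln_realpow[of "2::real" 29] ln_realpow[of "3::real" 19] by simp
    moreover have "ln (2/3::real) = ln 2 - ln 3" by (simp add: ln_div)
    ultimately have l: "ln 2 + 1.9 * ln (2/3) \<le> - (53/1000::real)" by linarith
    have "eventually (\<lambda>d::nat. real d ^ 9 * exp (- (53/1000) * real d) \<le> exp (- real d / 20)) sequentially"
      by real_asymp
    then show ?thesis
    proof eventually_elim
      case (elim d)
      have "2 ^ d * (2/3) powr (1.9 * real d) = exp (real d * (ln 2 + 1.9 * ln (2/3)))"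
        by (simp add: powr_def exp_add distrib_left exp_of_nat_mult mult_ac)
      also have "\<dots> \<le> exp (- (53/1000) * real d)"
        using mult_left_mono[OF l, of "real d"] by simp
      finally have "real d ^ 9 * (2 ^ d * (2/3) powr (1.9 * real d)) \<le> real d ^ 9 * exp (- (53/1000) * real d)"
        by (intro mult_left_mono) auto
      then show ?case using elim by (simp only: mult.assoc)
    qed
  qed
  have e3: "eventually (\<lambda>d::nat. d \<ge> 20) sequentially" by (rule eventually_ge_at_top)
  have kap: "eps / 2 > 0" using eps by simp
  show ?thesis using e1 e2 e3 container_estimate[OF kap]
  proof eventually_elim
    case (elim d)
    define psi where "psi = nat \<lceil>real d powr (1/4)\<rceil>"
    define tau where "tau = real d powr (-1/8)"
    show ?case
    proof (intro allI impI)
      fix L R and nb :: "'a \<Rightarrow> 'a set"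
      assume "cubical L R nb d"
      then interpret cubical L R nb d .
      have w0: "0 \<le> wt (1/3) A" for A by (rule wt_nonneg) simp
      have psi: "1 \<le> psi" "2 * psi \<le> d" "d \<le> 3 ^ psi" and tau: "0 \<le> tau"
        using elim(4) unfolding Let_def psi_def tau_def by auto
      have big: "(\<Sum>A | A \<subseteq> L \<and> linked n2 A \<and> d \<le> 6 * card A \<and> real (card (cl (nbs A))) \<le> (1 - eps) * real (card L). wt (1/3) A)
         \<le> exp (- real d)"
        by (rule big_polymers[OF eps psi tau])
          (use elim(4) in \<open>unfold Let_def psi_def[symmetric] tau_def[symmetric], blast\<close>)
      have fin: "finite {A. A \<subseteq> L \<and> P A}" for P using finL by (auto intro: finite_subset[of _ "Pow L"])
      have "(\<Sum>A | A \<subseteq> L \<and> linked n2 A \<and> 2 \<le> card A \<and> real (card (cl (nbs A))) \<le> (1 - eps) * real (card L). wt (1/3) A)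
        \<le> sum (wt (1/3)) ({A. A \<subseteq> L \<and> linked n2 A \<and> 2 \<le> card A \<and> 6 * card A < d}
          \<union> {A. A \<subseteq> L \<and> linked n2 A \<and> d \<le> 6 * card A \<and> real (card (cl (nbs A))) \<le> (1 - eps) * real (card L)})"
        using fin w0 by (intro sum_mono2) auto
      also have "\<dots> \<le> (\<Sum>A | A \<subseteq> L \<and> linked n2 A \<and> 2 \<le> card A \<and> 6 * card A < d. wt (1/3) A)
         + (\<Sum>A | A \<subseteq> L \<and> linked n2 A \<and> d \<le> 6 * card A \<and> real (card (cl (nbs A))) \<le> (1 - eps) * real (card L). wt (1/3) A)"
        using fin w0 by (simp add: sum_Un sum_nonneg)
      also have "\<dots> \<le> exp (- real d / 20) + exp (- real d)"
        using small_polymers[OF elim(3,1)] elim(2) big by linarith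
      also have "\<dots> \<le> 2 * exp (- real d / 20)" by simp
      finally show "(\<Sum>A | A \<subseteq> L \<and> linked n2 A \<and> 2 \<le> card A \<and> real (card (cl (nbs A))) \<le> (1 - eps) * real (card L). wt (1/3) A)
        \<le> 2 * exp (- real d / 20)" .
    qed
  qed
qed

section \<open>Decomposition of a set into polymers\<close>

definition spread :: "('a \<Rightarrow> 'a set) \<Rightarrow> 'a set \<Rightarrow> bool" where
  "spread nb A \<longleftrightarrow> (\<forall>x\<in>A. \<forall>y\<in>A. x \<noteq> y \<longrightarrow> nb x \<inter> nb y = {})"

lemma prod_one_plus_le_exp:
  fixes f :: "'a \<Rightarrow> real"
  assumes "\<And>x. x \<in> A \<Longrightarrow> 0 \<le> f x" shows "(\<Prod>x\<in>A. 1 + f x) \<le> exp (sum f A)"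
proof (cases "finite A")
  case True
  have "(\<Prod>x\<in>A. 1 + f x) \<le> (\<Prod>x\<in>A. exp (f x))"
    using assms exp_ge_add_one_self by (intro prod_mono) (auto simp: add_nonneg_nonneg)
  then show ?thesis using True by (simp add: exp_sum)
qed simp

context biregular
begin

text \<open>Split along a cut that no \<open>n2\<close> step crosses and recurse; vertices on
  different sides of the cut have no common neighbour.\<close>

lemma component_decomposition:
  assumes "A \<subseteq> L"
  shows "\<exists>P. finite P \<and> (\<forall>S\<in>P. S \<subseteq> A \<and> linked n2 S) \<and> \<Union>P = A \<and>
     (\<forall>S\<in>P. \<forall>T\<in>P. S \<noteq> T \<longrightarrow> nbs S \<inter> nbs T = {})"
  using assms
proof (induction "card A" arbitrary: A rule: less_induct)
  case less
  have fA: "finite A" using less.prems fin_sub by auto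
  show ?case
  proof (cases "A = {} \<or> linked n2 A")
    case True
    then show ?thesis
    proof
      assume "A = {}" then show ?thesis by (intro exI[of _ "{}"]) auto
    next
      assume "linked n2 A" then show ?thesis by (intro exI[of _ "{A}"]) auto
    qed
  next
    case False
    then obtain T where T: "T \<subset> A" "T \<noteq> {}" "\<not> (\<exists>x\<in>T. \<exists>y\<in>A - T. y \<in> n2 x)"
      unfolding linked_def by auto
    have far: "nbs T \<inter> nbs (A - T) = {}"
    proof -
      have False if "z \<in> nb x" "x \<in> T" "z \<in> nb y" "y \<in> A - T" for x y z
      proof -
        have "y \<in> n2 x" using n2_iff[of x y] that T less.prems by blast
        then show False using T(3) that by blast
      qed
      then show ?thesis unfolding nbs_def by blast
    qed
    have c: "card T < card A" "card (A - T) < card A" using T fA by (auto intro!: psubset_card_mono)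
    have TL: "T \<subseteq> L" "A - T \<subseteq> L" using T less.prems by auto
    obtain P where P0: "finite P \<and> (\<forall>S\<in>P. S \<subseteq> T \<and> linked n2 S) \<and> \<Union>P = T \<and>
     (\<forall>S\<in>P. \<forall>T\<in>P. S \<noteq> T \<longrightarrow> nbs S \<inter> nbs T = {})"
      using less.hyps[OF c(1) TL(1)] by (rule exE) (rule that)
    note P = P0[THEN conjunct1] P0[THEN conjunct2, THEN conjunct1] P0[THEN conjunct2, THEN conjunct2, THEN conjunct1]
      P0[THEN conjunct2, THEN conjunct2, THEN conjunct2]
    obtain P' where P0': "finite P' \<and> (\<forall>S\<in>P'. S \<subseteq> (A - T) \<and> linked n2 S) \<and> \<Union>P' = (A - T) \<and>
     (\<forall>S\<in>P'. \<forall>T\<in>P'. S \<noteq> T \<longrightarrow> nbs S \<inter> nbs T = {})"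
      using less.hyps[OF c(2) TL(2)] by (rule exE) (rule that)
    note P' = P0'[THEN conjunct1] P0'[THEN conjunct2, THEN conjunct1] P0'[THEN conjunct2, THEN conjunct2, THEN conjunct1]
      P0'[THEN conjunct2, THEN conjunct2, THEN conjunct2]
    have x: "nbs S \<inter> nbs S' = {}" if "S \<in> P" "S' \<in> P'" for S S'
      using far nbs_mono[of S T] nbs_mono[of S' "A - T"] that P P' by blast
    show ?thesis
    proof (intro exI[of _ "P \<union> P'"] conjI ballI impI)
      fix S S' assume "S \<in> P \<union> P'" "S' \<in> P \<union> P'" "S \<noteq> S'"
      then show "nbs S \<inter> nbs S' = {}" using x[of S S'] x[of S' S] P(4) P'(4) by (elim UnE) auto
    qed (use P P' T in auto)
  qed
qed

lemma wt_Un: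
  assumes "A \<subseteq> L" "B \<subseteq> L" "nbs A \<inter> nbs B = {}"
  shows "wt q (A \<union> B) = wt q A * wt q B"
proof -
  have fin: "finite (nbs A)" "finite (nbs B)" using assms nbs_L fin_sub by auto
  have U: "nbs (A \<union> B) = nbs A \<union> nbs B" unfolding nbs_def by auto
  have dis: "nb y \<inter> B = {}" if "y \<in> nbs A" for y
    using that assms nbs_iff[of B y] nbs_L[of A] by blast
  have dis': "nb y \<inter> A = {}" if "y \<in> nbs B" for y
    using that assms nbs_iff[of A y] nbs_L[of B] by blast
  have 1: "(\<Prod>y\<in>nbs A. (1 + q ^ card (nb y \<inter> (A \<union> B))) / 2) = wt q A"
    unfolding wt_def using dis by (intro prod.cong) (auto simp: Int_Un_distrib)
  have 2: "(\<Prod>y\<in>nbs B. (1 + q ^ card (nb y \<inter> (A \<union> B))) / 2) = wt q B"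
    unfolding wt_def using dis' by (intro prod.cong) (auto simp: Int_Un_distrib)
  have "wt q (A \<union> B) = (\<Prod>y\<in>nbs A \<union> nbs B. (1 + q ^ card (nb y \<inter> (A \<union> B))) / 2)"
    unfolding wt_def U by simp
  also have "\<dots> = (\<Prod>y\<in>nbs A. (1 + q ^ card (nb y \<inter> (A \<union> B))) / 2) * (\<Prod>y\<in>nbs B. (1 + q ^ card (nb y \<inter> (A \<union> B))) / 2)"
    using fin assms(3) by (rule prod.union_disjoint)
  finally show ?thesis by (simp add: 1 2)
qed

lemma wt_Union:
  assumes "finite P" "\<forall>S\<in>P. S \<subseteq> L" "\<forall>S\<in>P. \<forall>T\<in>P. S \<noteq> T \<longrightarrow> nbs S \<inter> nbs T = {}"
  shows "wt q (\<Union>P) = (\<Prod>S\<in>P. wt q S)"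
  using assms
proof (induction P rule: finite_induct)
  case empty
  then show ?case by (simp add: wt_def nbs_def)
next
  case (insert S P)
  have "nbs S \<inter> nbs (\<Union>P) = {}"
  proof -
    have "nbs (\<Union>P) = (\<Union>T\<in>P. nbs T)" unfolding nbs_def by auto
    then show ?thesis using insert by auto
  qed
  then have "wt q (S \<union> \<Union>P) = wt q S * wt q (\<Union>P)" using insert by (intro wt_Un) auto
  then show ?case using insert by auto
qed

lemma wt_singleton:
  assumes "v \<in> L" shows "wt q {v} = ((1 + q) / 2) ^ d"
proof -
  have "nb y \<inter> {v} = {v}" if "y \<in> nb v" for y using that assms nb_sym nbL by blast
  then have "wt q {v} = (\<Prod>y\<in>nb v. (1 + q ^ 1) / 2)" unfolding wt_def nbs_def by (intro prod.cong) auto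
  then show ?thesis using card_nb assms by simp
qed

text \<open>The weight of a set is the product over its components, which are singletons or members
  of \<open>P2\<close>; the bound on \<open>nbs A\<close> passes to the closures of the components.
  Dropping all compatibility conditions leaves two independent products. A set that is not spread
  has a component in \<open>P2\<close>, so the empty choice there is excluded, whence the
  \<open>- 1\<close>.\<close>

lemma polymer_expansion:
  fixes q eps :: real
  assumes q: "0 \<le> q"
  defines "P2 \<equiv> {A. A \<subseteq> L \<and> linked n2 A \<and> 2 \<le> card A \<and> real (card (cl (nbs A))) \<le> (1 - eps) * real (card L)}"
  shows "(\<Sum>A | A \<subseteq> L \<and> \<not> spread nb A \<and> real (card (nbs A)) \<le> (1 - eps) * real (card L). wt q A)
     \<le> exp (real (card L) * ((1 + q) / 2) ^ d) * (exp (sum (wt q) P2) - 1)"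
proof -
  let ?X = "{A. A \<subseteq> L \<and> \<not> spread nb A \<and> real (card (nbs A)) \<le> (1 - eps) * real (card L)}"
  define P1 where "P1 = (\<lambda>v. {v}) ` L"
  have fin: "finite P1" "finite P2" unfolding P1_def P2_def using finL by (auto intro: finite_subset[of _ "Pow L"])
  have dis: "P1 \<inter> P2 = {}" unfolding P1_def P2_def by auto
  have w0: "0 \<le> wt q A" for A using q by (rule wt_nonneg)
  define good where "good A P \<longleftrightarrow> finite P \<and> (\<forall>S\<in>P. S \<subseteq> A \<and> linked n2 S) \<and> \<Union>P = A \<and>
     (\<forall>S\<in>P. \<forall>T\<in>P. S \<noteq> T \<longrightarrow> nbs S \<inter> nbs T = {})" for A P
  define comps where "comps A = (SOME P. good A P)" for A
  have comps: "finite (comps A) \<and> (\<forall>S\<in>(comps A). S \<subseteq> A \<and> linked n2 S) \<and> \<Union>(comps A) = A \<and>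
     (\<forall>S\<in>(comps A). \<forall>T\<in>(comps A). S \<noteq> T \<longrightarrow> nbs S \<inter> nbs T = {})" if "A \<in> ?X" for A
  proof -
    have "A \<subseteq> L" using that by auto
    then have "\<exists>P. good A P" unfolding good_def by (rule component_decomposition)
    then have "good A (comps A)" unfolding comps_def by (rule someI_ex)
    then show ?thesis unfolding good_def .
  qed
  define h where "h A = (comps A \<inter> P1, comps A \<inter> P2)" for A
  have sub: "comps A \<subseteq> P1 \<union> P2" if A: "A \<in> ?X" for A
  proof
    fix S assume S: "S \<in> comps A"
    then have S': "S \<subseteq> A" "linked n2 S" "S \<subseteq> L" using comps[OF A] A by auto
    have fS: "finite S" "S \<noteq> {}" using S' fin_sub unfolding linked_def by auto
    show "S \<in> P1 \<union> P2"
    proof (cases "card S \<ge> 2")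
      case True
      have "card (cl (nbs S)) \<le> card (nbs S)" using card_cl_le S' nbs_L by auto
      also have "\<dots> \<le> card (nbs A)" using A nbs_mono[OF S'(1)] nbs_L fin_sub by (intro card_mono) auto
      finally have "real (card (cl (nbs S))) \<le> (1 - eps) * real (card L)" using A by auto
      then show ?thesis using True S' unfolding P2_def by auto
    next
      case False
      then have "card S = 1" using fS by (metis One_nat_def Suc_1 card_0_eq le_SucE less_one not_less_eq_eq linorder_not_le)
      then obtain v where "S = {v}" using card_1_singletonE by blast
      then show ?thesis using S' unfolding P1_def by auto
    qed
  qed
  have ne: "comps A \<inter> P2 \<noteq> {}" if A: "A \<in> ?X" for A
  proof
    assume "comps A \<inter> P2 = {}"
    then have s: "comps A \<subseteq> P1" using sub[OF A] by auto
    have "spread nb A" unfolding spread_def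
    proof (intro ballI impI)
      fix x y assume xy: "x \<in> A" "y \<in> A" "x \<noteq> y"
      have m: "{x} \<in> comps A" "{y} \<in> comps A" using comps[OF A] s xy(1,2) unfolding P1_def by blast+
      have far: "\<forall>S\<in>comps A. \<forall>T\<in>comps A. S \<noteq> T \<longrightarrow> nbs S \<inter> nbs T = {}"
        using comps[OF A] by (elim conjE)
      have "{x} \<noteq> {y}" using xy by simp
      with far m have "nbs {x} \<inter> nbs {y} = {}" by (metis (no_types))
      then show "nb x \<inter> nb y = {}" unfolding nbs_def by simp
    qed
    then show False using A by auto
  qed
  have un: "comps A = fst (h A) \<union> snd (h A)" if "A \<in> ?X" for A using sub[OF that] unfolding h_def by auto
  have inj: "inj_on h ?X"
  proof (rule inj_onI)
    fix A B assume AB: "A \<in> ?X" "B \<in> ?X" "h A = h B"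
    then have e: "comps A = comps B" using un[OF AB(1)] un[OF AB(2)] by (simp only:)
    have "A = \<Union>(comps A)" "B = \<Union>(comps B)"
      using comps[OF AB(1)] comps[OF AB(2)] by (elim conjE, simp only:)+
    then show "A = B" unfolding e by (simp only:)
  qed
  have img: "h ` ?X \<subseteq> Pow P1 \<times> (Pow P2 - {{}})" using ne unfolding h_def by auto
  have val: "wt q A = (case h A of (S, T) \<Rightarrow> (\<Prod>X\<in>S. wt q X) * (\<Prod>X\<in>T. wt q X))" if A: "A \<in> ?X" for A
  proof -
    have "wt q (\<Union>(comps A)) = (\<Prod>S\<in>comps A. wt q S)" using comps[OF A] A by (intro wt_Union) auto
    also have "\<dots> = (\<Prod>S\<in>(comps A \<inter> P1) \<union> (comps A \<inter> P2). wt q S)"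
      using un[OF A] unfolding h_def by simp
    also have "\<dots> = (\<Prod>X\<in>comps A \<inter> P1. wt q X) * (\<Prod>X\<in>comps A \<inter> P2. wt q X)"
      using comps[OF A] dis by (intro prod.union_disjoint) auto
    finally show ?thesis using comps[OF A] unfolding h_def by simp
  qed
  have "sum (wt q) ?X = (\<Sum>A\<in>?X. (case h A of (S, T) \<Rightarrow> (\<Prod>X\<in>S. wt q X) * (\<Prod>X\<in>T. wt q X)))"
    using val by (intro sum.cong) auto
  also have "\<dots> = (\<Sum>p\<in>h ` ?X. (case p of (S, T) \<Rightarrow> (\<Prod>X\<in>S. wt q X) * (\<Prod>X\<in>T. wt q X)))"
    by (simp only: sum.reindex[OF inj] o_def)
  also have "\<dots> \<le> (\<Sum>p\<in>Pow P1 \<times> (Pow P2 - {{}}). (case p of (S, T) \<Rightarrow> (\<Prod>X\<in>S. wt q X) * (\<Prod>X\<in>T. wt q X)))"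
    using img fin w0 by (intro sum_mono2) (auto intro!: mult_nonneg_nonneg prod_nonneg)
  also have "\<dots> = (\<Sum>S\<in>Pow P1. \<Sum>T\<in>Pow P2 - {{}}. (\<Prod>X\<in>S. wt q X) * (\<Prod>X\<in>T. wt q X))"
    by (simp add: sum.cartesian_product)
  also have "\<dots> = (\<Sum>S\<in>Pow P1. \<Prod>X\<in>S. wt q X) * (\<Sum>T\<in>Pow P2 - {{}}. \<Prod>X\<in>T. wt q X)"
    by (simp add: sum_product)
  also have "(\<Sum>T\<in>Pow P2 - {{}}. \<Prod>X\<in>T. wt q X) = (\<Prod>X\<in>P2. 1 + wt q X) - 1"
  proof -
    have "(\<Prod>X\<in>P2. wt q X + 1) = (\<Sum>T\<in>Pow P2. (\<Prod>X\<in>T. wt q X) * (\<Prod>X\<in>P2 - T. 1))" by (rule prod_add[OF fin(2)])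
    also have "\<dots> = 1 + (\<Sum>T\<in>Pow P2 - {{}}. \<Prod>X\<in>T. wt q X)" using fin by (subst sum.remove[of _ "{}"]) auto
    finally show ?thesis by (simp add: add.commute)
  qed
  also have "(\<Sum>S\<in>Pow P1. \<Prod>X\<in>S. wt q X) = (\<Prod>X\<in>P1. 1 + wt q X)"
    using prod_add[OF fin(1), of "wt q" "\<lambda>_. 1"] by (simp add: add.commute)
  also have "(\<Prod>X\<in>P1. 1 + wt q X) * ((\<Prod>X\<in>P2. 1 + wt q X) - 1) \<le> exp (sum (wt q) P1) * (exp (sum (wt q) P2) - 1)"
  proof (rule mult_mono)
    have "1 \<le> (\<Prod>X\<in>P2. 1 + wt q X)" using w0 by (intro prod_ge_1) auto
    then show "0 \<le> (\<Prod>X\<in>P2. 1 + wt q X) - 1" by simp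
    show "(\<Prod>X\<in>P1. 1 + wt q X) \<le> exp (sum (wt q) P1)" using w0 by (intro prod_one_plus_le_exp)
    have "(\<Prod>X\<in>P2. 1 + wt q X) \<le> exp (sum (wt q) P2)" using w0 by (intro prod_one_plus_le_exp)
    then show "(\<Prod>X\<in>P2. 1 + wt q X) - 1 \<le> exp (sum (wt q) P2) - 1" by simp
  qed simp
  also have "sum (wt q) P1 = (\<Sum>v\<in>L. wt q {v})" unfolding P1_def by (subst sum.reindex) auto
  also have "\<dots> = real (card L) * ((1 + q) / 2) ^ d" by (simp add: wt_singleton)
  finally show ?thesis .
qed

lemma sum_second_side:
  assumes A: "A \<subseteq> L"
  shows "(\<Sum>B\<in>Pow R. (q::real) ^ (\<Sum>y\<in>B. card (nb y \<inter> A))) = 2 ^ card R * wt q A"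
proof -
  have "(\<Sum>B\<in>Pow R. q ^ (\<Sum>y\<in>B. card (nb y \<inter> A))) = (\<Sum>B\<in>Pow R. (\<Prod>y\<in>B. q ^ card (nb y \<inter> A)) * (\<Prod>y\<in>R - B. 1))"
    by (simp add: power_sum)
  also have "\<dots> = (\<Prod>y\<in>R. q ^ card (nb y \<inter> A) + 1)" by (rule prod_add[OF finR, symmetric])
  also have "\<dots> = (\<Prod>y\<in>R. 2 * (if y \<in> nbs A then (1 + q ^ card (nb y \<inter> A)) / 2 else 1))"
    using nbs_iff[OF A] by (intro prod.cong) auto
  also have "\<dots> = 2 ^ card R * (\<Prod>y\<in>R. if y \<in> nbs A then (1 + q ^ card (nb y \<inter> A)) / 2 else 1)"
    by (simp only: prod.distrib prod_constant)
  also have "(\<Prod>y\<in>R. if y \<in> nbs A then (1 + q ^ card (nb y \<inter> A)) / 2 else 1) = (\<Prod>y\<in>R \<inter> nbs A. (1 + q ^ card (nb y \<inter> A)) / 2)"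
    by (subst prod.inter_restrict[OF finR]) (rule refl)
  also have "R \<inter> nbs A = nbs A" using nbs_L[OF A] by auto
  finally show ?thesis unfolding wt_def .
qed

end

section \<open>Pairs with large neighbourhoods on both sides\<close>

text \<open>The splitting of \<open>local_factor_le\<close> with a free factor \<open>r\<close> per
  element and coefficient \<open>t\<close>. It is used with \<open>r = 1/2\<close>,
  \<open>t = 1\<close> for small sets and with \<open>r = 1\<close>, \<open>t = 2\<close> for dense
  pairs.\<close>

lemma tilted_local_sum:
  fixes r t :: real
  assumes M: "finite M" "card M \<le> d" and r: "0 \<le> r" "r \<le> 1" and t: "0 \<le> t"
  shows "(\<Sum>T\<in>Pow M - {{}}. r ^ card T * (1 + t * (1/3) ^ card T) ^ d)
     \<le> (real d + 1) ^ psi * (1 + t / 3) ^ d + exp (t * (real d / 3 ^ psi)) * (1 + r) ^ d"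
proof -
  let ?S = "{T. T \<subseteq> M \<and> card T \<le> psi}"
  have finP: "finite (Pow M)" using M by simp
  have "(\<Sum>T\<in>Pow M - {{}}. r ^ card T * (1 + t * (1/3) ^ card T) ^ d)
     \<le> (\<Sum>T\<in>Pow M - {{}}. (if T \<in> ?S then (1 + t / 3) ^ d else 0) + exp (t * (real d / 3 ^ psi)) * r ^ card T)"
  proof (rule sum_mono)
    fix T assume T: "T \<in> Pow M - {{}}"
    then have fT: "finite T" "T \<noteq> {}" using M finite_subset by auto
    have c1: "card T \<ge> 1" using fT by (simp add: Suc_leI card_gt_0_iff)
    have rc: "0 \<le> r ^ card T" "r ^ card T \<le> 1" using r by (auto intro: power_le_one)
    show "r ^ card T * (1 + t * (1/3) ^ card T) ^ d \<le> (if T \<in> ?S then (1 + t / 3) ^ d else 0) + exp (t * (real d / 3 ^ psi)) * r ^ card T"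
    proof (cases "T \<in> ?S")
      case True
      have "(1/3::real) ^ card T \<le> (1/3) ^ 1" using c1 by (intro power_decreasing) auto
      then have "t * (1/3) ^ card T \<le> t / 3" using mult_left_mono[OF _ t, of "(1/3) ^ card T" "1/3"] by simp
      then have "(1 + t * (1/3) ^ card T) ^ d \<le> (1 + t / 3) ^ d" using t by (intro power_mono) auto
      then have "r ^ card T * (1 + t * (1/3) ^ card T) ^ d \<le> 1 * (1 + t / 3) ^ d" using rc t by (intro mult_mono) auto
      moreover have "0 \<le> exp (t * (real d / 3 ^ psi)) * r ^ card T" using rc by simp
      moreover have "(if T \<in> ?S then (1 + t / 3) ^ d else 0) = (1 + t / 3) ^ d" using True by (rule if_P)
      ultimately show ?thesis by linarith
    next
      case False
      then have "psi \<le> card T" using T by auto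
      then have "(1/3::real) ^ card T \<le> (1/3) ^ psi" by (intro power_decreasing) auto
      then have "t * (1/3) ^ card T \<le> t * (1/3) ^ psi" using t by (rule mult_left_mono)
      then have "(1 + t * (1/3) ^ card T) ^ d \<le> exp (t * (1/3) ^ psi) ^ d"
        using t by (intro power_mono order_trans[OF _ exp_ge_add_one_self]) auto
      also have "\<dots> = exp (t * (real d / 3 ^ psi))" by (simp add: exp_of_nat_mult[symmetric] power_one_over)
      finally have "r ^ card T * (1 + t * (1/3) ^ card T) ^ d \<le> r ^ card T * exp (t * (real d / 3 ^ psi))"
        using rc by (intro mult_left_mono) auto
      then show ?thesis unfolding if_not_P[OF False] by (simp add: mult.commute)
    qed
  qed
  also have "\<dots> = (\<Sum>T\<in>Pow M - {{}}. if T \<in> ?S then (1 + t / 3) ^ d else 0) + (\<Sum>T\<in>Pow M - {{}}. exp (t * (real d / 3 ^ psi)) * r ^ card T)"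
    by (rule sum.distrib)
  also have "\<dots> \<le> real (card ?S) * (1 + t / 3) ^ d + exp (t * (real d / 3 ^ psi)) * (1 + r) ^ card M"
  proof (rule add_mono)
    have "(\<Sum>T\<in>Pow M - {{}}. if T \<in> ?S then (1 + t / 3) ^ d else 0) = (\<Sum>T\<in>(Pow M - {{}}) \<inter> ?S. (1 + t / 3) ^ d)"
      by (subst sum.inter_restrict) (use finP in auto)
    also have "\<dots> \<le> (\<Sum>T\<in>?S. (1 + t / 3) ^ d)" using t M by (intro sum_mono2) auto
    finally show "(\<Sum>T\<in>Pow M - {{}}. if T \<in> ?S then (1 + t / 3) ^ d else 0) \<le> real (card ?S) * (1 + t / 3) ^ d" by simp
    have "(\<Sum>T\<in>Pow M - {{}}. exp (t * (real d / 3 ^ psi)) * r ^ card T) \<le> (\<Sum>T\<in>Pow M. exp (t * (real d / 3 ^ psi)) * r ^ card T)"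
      using finP r by (intro sum_mono2) auto
    also have "\<dots> = exp (t * (real d / 3 ^ psi)) * (1 + r) ^ card M"
      using M by (simp add: sum_distrib_left[symmetric] sum_Pow_power_card)
    finally show "(\<Sum>T\<in>Pow M - {{}}. exp (t * (real d / 3 ^ psi)) * r ^ card T) \<le> exp (t * (real d / 3 ^ psi)) * (1 + r) ^ card M" .
  qed
  also have "\<dots> \<le> (real d + 1) ^ psi * (1 + t / 3) ^ d + exp (t * (real d / 3 ^ psi)) * (1 + r) ^ d"
  proof (intro add_mono mult_right_mono mult_left_mono)
    have "card ?S \<le> (d + 1) ^ psi"
      using card_le_subsets_power[OF M(1), of psi] power_mono[of "card M + 1" "d + 1" psi] M(2) by linarith
    then have "real (card ?S) \<le> real ((d + 1) ^ psi)" by (rule of_nat_mono)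
    then show "real (card ?S) \<le> (real d + 1) ^ psi" by (simp add: add.commute)
    show "(1 + r) ^ card M \<le> (1 + r) ^ d" using r M by (intro power_increasing) auto
  qed (use t in auto)
  finally show ?thesis .
qed

context cubical
begin

lemma holder_all:
  assumes f0: "\<And>T. 0 \<le> f T" and b: "\<And>M. finite M \<Longrightarrow> card M \<le> d \<Longrightarrow> (\<Sum>T\<in>Pow M. f T ^ d) \<le> b"
  shows "(\<Sum>A\<in>Pow L. \<Prod>y\<in>R. f (A \<inter> nb y)) \<le> (root d b) ^ card R"
proof -
  have "(\<Sum>A\<in>Pow L. \<Prod>y\<in>R. f (A \<inter> nb y)) \<le> (\<Prod>y\<in>R. root d (\<Sum>T\<in>Pow (L \<inter> nb y). f T ^ d))"
  proof (rule holder_local[OF finL finR d1])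
    fix x assume x: "x \<in> L"
    have "{y \<in> R. x \<in> nb y} = nb x" using nb_sym[OF x] nbL[OF x] by blast
    then show "d \<le> card {y \<in> R. x \<in> nb y}" using card_nb x by simp
  qed (rule f0)
  also have "\<dots> \<le> (\<Prod>y\<in>R. root d b)"
  proof (rule prod_mono)
    fix y assume y: "y \<in> R"
    have f: "finite (L \<inter> nb y)" using finL by simp
    have c: "card (L \<inter> nb y) \<le> d" using card_nb[of y] fin_nb[of y] y by (metis UnCI card_mono inf_le2)
    have "0 \<le> (\<Sum>T\<in>Pow (L \<inter> nb y). f T ^ d)" using f0 by (intro sum_nonneg) simp
    then show "0 \<le> root d (\<Sum>T\<in>Pow (L \<inter> nb y). f T ^ d) \<and> root d (\<Sum>T\<in>Pow (L \<inter> nb y). f T ^ d) \<le> root d b"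
      using b[OF f c] d1 by (simp add: real_root_ge_zero real_root_le_iff)
  qed
  finally show ?thesis by simp
qed

lemma split_Pow_empty:
  fixes F :: "'b set \<Rightarrow> real"
  assumes "finite M" shows "(\<Sum>T\<in>Pow M. F T) = F {} + (\<Sum>T\<in>Pow M - {{}}. F T)"
  using assms by (subst sum.remove[of _ "{}"]) auto

lemma card_outside:
  assumes A: "A \<subseteq> L" "(1 - eps) * real (card L) < real (card (nbs A))"
  shows "real (card (R - nbs A)) \<le> eps * real (card L)"
proof -
  have s: "nbs A \<subseteq> R" using A nbs_L by auto
  have "card (R - nbs A) = card R - card (nbs A)" using s finR by (simp add: card_Diff_subset finite_subset)
  moreover have "card (nbs A) \<le> card R" using s finR by (rule card_mono[rotated])
  ultimately have "real (card (R - nbs A)) = real (card L) - real (card (nbs A))" using cardR by simp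
  then show ?thesis using A(2) by (simp add: algebra_simps)
qed

text \<open>Untilted, the large local sets alone would contribute about 1 to the local sum and
  Hoelder would gain nothing. Multiplying by \<open>(1/2) ^ card A\<close> costs at most
  \<open>2 ^ (N / 8)\<close> but reduces their contribution to about \<open>(3/4) ^ d\<close>. The
  local sums are then dominated by the value 4/5 assigned to uncovered vertices, and
  \<open>ln (4/5) + ln 2 / 8\<close> is negative.\<close>

lemma sparse_dominating_sets:
  fixes eps :: real
  assumes eps: "0 \<le> eps"
    and small: "(real d + 1) ^ psi * (4/3) ^ d + exp (real d / 3 ^ psi) * (3/2) ^ d \<le> (8/5) ^ d"
  shows "(\<Sum>A | A \<subseteq> L \<and> 8 * card A < card L \<and> (1 - eps) * real (card L) < real (card (nbs A)). wt (1/3) A)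
    \<le> exp (real (card L) * (ln 2 / 8 + eps * ln (5/4) + ln (4/5) + ln 2 / real d))"
proof -
  let ?N = "real (card L)"
  let ?X = "{A. A \<subseteq> L \<and> 8 * card A < card L \<and> (1 - eps) * real (card L) < real (card (nbs A))}"
  \<comment> \<open>A vertex of \<open>A\<close> lies in \<open>d\<close> neighbourhoods, so a
    factor \<open>rr\<close> per incidence amounts to 1/2 per vertex.\<close>
  define rr where "rr = root d (1/2::real)"
  have rr: "0 \<le> rr" "rr ^ d = 1/2" unfolding rr_def using d1 by (auto simp: real_root_pow_pos2)
  \<comment> \<open>The value 4/5 at the empty set exceeds 3/4, so it dominates the local sum. Since
    at most \<open>eps * N\<close> vertices are uncovered, lowering it from 1 costs only
    \<open>(5/4) powr (eps * N)\<close>.\<close>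
  define f where "f T = (if T = {} then 4/5 else rr ^ card T * ((1 + (1/3::real) ^ card T) / 2))" for T :: "'a set"
  have f0: "0 \<le> f T" for T unfolding f_def using rr by simp
  have b: "(\<Sum>T\<in>Pow M. f T ^ d) \<le> 2 * (4/5) ^ d" if M: "finite M" "card M \<le> d" for M :: "'a set"
  proof -
    have "(\<Sum>T\<in>Pow M. f T ^ d) = (4/5) ^ d + (\<Sum>T\<in>Pow M - {{}}. f T ^ d)"
      using split_Pow_empty[OF M(1), of "\<lambda>T. f T ^ d"] by (simp add: f_def)
    also have "(\<Sum>T\<in>Pow M - {{}}. f T ^ d) = (\<Sum>T\<in>Pow M - {{}}. (1/2) ^ d * ((1/2) ^ card T * (1 + 1 * (1/3) ^ card T) ^ d))"
    proof (rule sum.cong[OF refl])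
      fix T assume T: "T \<in> Pow M - {{}}"
      have "(rr ^ card T) ^ d = (1/2) ^ card T" by (metis rr(2) power_commutes power_mult mult.commute)
      then show "f T ^ d = (1/2) ^ d * ((1/2) ^ card T * (1 + 1 * (1/3) ^ card T) ^ d)"
        using T by (simp add: f_def power_mult_distrib power_divide)
    qed
    also have "\<dots> = (1/2) ^ d * (\<Sum>T\<in>Pow M - {{}}. (1/2) ^ card T * (1 + 1 * (1/3) ^ card T) ^ d)"
      by (rule sum_distrib_left[symmetric])
    also have "\<dots> \<le> (1/2) ^ d * ((real d + 1) ^ psi * (1 + 1 / 3) ^ d + exp (1 * (real d / 3 ^ psi)) * (1 + 1/2) ^ d)"
      by (intro mult_left_mono tilted_local_sum M) auto
    also have "\<dots> \<le> (1/2) ^ d * (8/5) ^ d" using small by (intro mult_left_mono) simp_all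
    also have "\<dots> = (4/5) ^ d" by (simp add: power_mult_distrib[symmetric])
    finally show ?thesis by simp
  qed
  have pt: "wt (1/3) A \<le> exp (?N * (ln 2 / 8) + ?N * (eps * ln (5/4))) * (\<Prod>y\<in>R. f (A \<inter> nb y))" if A: "A \<in> ?X" for A
  proof -
    have AL: "A \<subseteq> L" using A by auto
    have sR: "nbs A \<subseteq> R" using AL nbs_L by auto
    have e: "(\<Sum>y\<in>nbs A. card (nb y \<inter> A)) = d * card A"
    proof -
      have "(\<Sum>y\<in>nbs A. card (nb y \<inter> A)) = (\<Sum>x\<in>A. card (nb x \<inter> nbs A))" using edge_count[OF AL sR] by simp
      also have "\<dots> = (\<Sum>x\<in>A. d)"
        using AL card_nb by (intro sum.cong refl) (auto simp: nbs_def Int_absorb2 SUP_upper)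
      finally show ?thesis by simp
    qed
    have "(\<Prod>y\<in>R. f (A \<inter> nb y)) = (\<Prod>y\<in>R - nbs A. f (A \<inter> nb y)) * (\<Prod>y\<in>nbs A. f (A \<inter> nb y))"
      by (rule prod.subset_diff[OF sR finR])
    also have "(\<Prod>y\<in>R - nbs A. f (A \<inter> nb y)) = (\<Prod>y\<in>R - nbs A. 4/5)"
      using nbs_iff[OF AL] by (intro prod.cong) (auto simp: f_def)
    also have "(\<Prod>y\<in>nbs A. f (A \<inter> nb y)) = (\<Prod>y\<in>nbs A. rr ^ card (nb y \<inter> A) * ((1 + (1/3) ^ card (nb y \<inter> A)) / 2))"
      using nbs_iff[OF AL] sR by (intro prod.cong) (auto simp: f_def Int_commute)
    also have "\<dots> = rr ^ (d * card A) * wt (1/3) A"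
      by (simp only: prod.distrib power_sum[symmetric] e wt_def)
    also have "rr ^ (d * card A) = (1/2) ^ card A" by (simp add: power_mult rr)
    finally have eq: "(\<Prod>y\<in>R. f (A \<inter> nb y)) = (4/5) ^ card (R - nbs A) * ((1/2) ^ card A * wt (1/3) A)" by simp
    have 1: "(1/2::real) ^ card A \<ge> exp (- (?N * (ln 2 / 8)))"
    proof -
      have "8 * real (card A) \<le> ?N" using A by simp
      then have "real (card A) * ln 2 \<le> ?N / 8 * ln 2" by (intro mult_right_mono) auto
      then have "exp (- (?N * (ln 2 / 8))) \<le> exp (- (real (card A) * ln 2))" by simp
      also have "\<dots> = (1/2) ^ card A" by (simp add: exp_minus exp_of_nat_mult power_one_over inverse_eq_divide)
      finally show ?thesis .
    qed
    have 2: "(4/5::real) ^ card (R - nbs A) \<ge> exp (- (?N * (eps * ln (5/4))))"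
    proof -
      have "real (card (R - nbs A)) \<le> eps * ?N" using A by (intro card_outside) auto
      then have "real (card (R - nbs A)) * ln (5/4) \<le> eps * ?N * ln (5/4)" by (intro mult_right_mono) auto
      then have "exp (- (?N * (eps * ln (5/4)))) \<le> exp (- (real (card (R - nbs A)) * ln (5/4)))" by (simp add: mult_ac)
      also have "\<dots> = (4/5) ^ card (R - nbs A)" by (simp add: exp_minus exp_of_nat_mult power_divide)
      finally show ?thesis .
    qed
    have w0: "0 \<le> wt (1/3) A" by (rule wt_nonneg) simp
    have "exp (- (?N * (eps * ln (5/4)))) * (exp (- (?N * (ln 2 / 8))) * wt (1/3) A) \<le> (\<Prod>y\<in>R. f (A \<inter> nb y))"
      unfolding eq using 1 2 w0 by (intro mult_mono) auto
    then have "exp (?N * (ln 2 / 8) + ?N * (eps * ln (5/4))) * (exp (- (?N * (eps * ln (5/4)))) * (exp (- (?N * (ln 2 / 8))) * wt (1/3) A))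
      \<le> exp (?N * (ln 2 / 8) + ?N * (eps * ln (5/4))) * (\<Prod>y\<in>R. f (A \<inter> nb y))" by (intro mult_left_mono) auto
    moreover have "exp (u + v) * (exp (- v) * (exp (- u) * w)) = w" for u v w :: real
      by (simp add: exp_add exp_minus field_simps)
    ultimately show ?thesis by (simp only:)
  qed
  have "sum (wt (1/3)) ?X \<le> (\<Sum>A\<in>?X. exp (?N * (ln 2 / 8) + ?N * (eps * ln (5/4))) * (\<Prod>y\<in>R. f (A \<inter> nb y)))"
    by (rule sum_mono) (rule pt)
  also have "\<dots> = exp (?N * (ln 2 / 8) + ?N * (eps * ln (5/4))) * (\<Sum>A\<in>?X. \<Prod>y\<in>R. f (A \<inter> nb y))"
    by (rule sum_distrib_left[symmetric])
  also have "\<dots> \<le> exp (?N * (ln 2 / 8) + ?N * (eps * ln (5/4))) * (\<Sum>A\<in>Pow L. \<Prod>y\<in>R. f (A \<inter> nb y))"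
    using finL f0 by (intro mult_left_mono sum_mono2 prod_nonneg) auto
  also have "\<dots> \<le> exp (?N * (ln 2 / 8) + ?N * (eps * ln (5/4))) * (root d (2 * (4/5) ^ d)) ^ card R"
    using holder_all[OF f0 b] by (intro mult_left_mono) auto
  also have "root d (2 * (4/5) ^ d) = exp (ln 2 / real d + ln (4/5))"
  proof -
    have "root d (2 * (4/5) ^ d) = root d 2 * (4/5)" using d1 by (simp add: real_root_mult real_root_power_cancel)
    also have "root d 2 = exp (ln 2 / real d)" using d1 by (subst root_powr_inverse) (auto simp: powr_def)
    finally show ?thesis by (simp add: exp_add)
  qed
  also have "exp (ln 2 / real d + ln (4/5)) ^ card R = exp (?N * (ln 2 / real d + ln (4/5)))"
    by (simp add: exp_of_nat_mult cardR)
  finally show ?thesis by (simp add: exp_add[symmetric] distrib_left add_ac)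
qed

text \<open>
  Since the vertices of \<open>B\<close> outside \<open>nbs A\<close> see only the complement of \<open>A\<close>, many vertices of \<open>B\<close> lie in \<open>nbs A\<close>.
  Doubling the weight of each of these gains a factor \<open>2 ^ (N / (10 d))\<close>, while the local sums in Hoelder's
  inequality barely change; the factor \<open>s\<close> makes up for the few vertices outside \<open>nbs A\<close>.
\<close>

lemma dense_pairs:
  fixes eps :: real
  assumes eps: "0 \<le> eps" "eps \<le> 1/1000"
    and small: "(real d + 1) ^ psi * (5/3) ^ d + exp (2 * (real d / 3 ^ psi)) * 2 ^ d \<le> (1 + 3/200) * 2 ^ d"
  shows "(\<Sum>A | A \<subseteq> L \<and> card L \<le> 8 * card A \<and> (1 - eps) * real (card L) < real (card (nbs A)).
      \<Sum>B | B \<subseteq> R \<and> (1 - eps) * real (card L) < real (card (nbs B)). (1/3) ^ (\<Sum>y\<in>B. card (nb y \<inter> A)))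
    \<le> 2 ^ card R * exp (- (3/100) * (real (card L) / real d))"
proof -
  let ?N = "real (card L)"
  let ?X = "{A. A \<subseteq> L \<and> card L \<le> 8 * card A \<and> (1 - eps) * real (card L) < real (card (nbs A))}"
  let ?Y = "{B. B \<subseteq> R \<and> (1 - eps) * real (card L) < real (card (nbs B))}"
  have D0: "real d > 0" using d1 by simp
  \<comment> \<open>Uncovered vertices then add only \<open>2 ^ d / 100\<close> to a local sum.
    Undoing the factor \<open>s\<close> on at most \<open>eps * N\<close> vertices costs
    \<open>100 powr (eps * N / d)\<close>, on the same scale \<open>N / d\<close> as the
    gain.\<close>
  define s where "s = root d (1/100::real)"
  have s: "0 < s" "s ^ d = 1/100" unfolding s_def using d1 by (auto simp: real_root_pow_pos2)
  \<comment> \<open>A vertex of \<open>nbs A\<close> is either left out of \<open>B\<close>, or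
    taken with doubled weight; this gives \<open>1 + 2 * (1/3) ^ card T\<close>. A vertex outside is
    free and gives 2, times \<open>s\<close>.\<close>
  define f where "f T = (if T = {} then 2 * s else 1 + 2 * (1/3::real) ^ card T)" for T :: "'a set"
  have f0: "0 \<le> f T" for T unfolding f_def using s by simp
  have b: "(\<Sum>T\<in>Pow M. f T ^ d) \<le> exp (1/40) * 2 ^ d" if M: "finite M" "card M \<le> d" for M :: "'a set"
  proof -
    have "(\<Sum>T\<in>Pow M. f T ^ d) = 2 ^ d / 100 + (\<Sum>T\<in>Pow M - {{}}. f T ^ d)"
      using split_Pow_empty[OF M(1), of "\<lambda>T. f T ^ d"] by (simp add: f_def power_mult_distrib s)
    also have "(\<Sum>T\<in>Pow M - {{}}. f T ^ d) = (\<Sum>T\<in>Pow M - {{}}. 1 ^ card T * (1 + 2 * (1/3) ^ card T) ^ d)"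
      by (intro sum.cong) (auto simp: f_def)
    also have "\<dots> \<le> (real d + 1) ^ psi * (1 + 2 / 3) ^ d + exp (2 * (real d / 3 ^ psi)) * (1 + 1) ^ d"
      by (intro tilted_local_sum M) auto
    also have "\<dots> \<le> (1 + 3/200) * 2 ^ d" using small by simp
    finally have "(\<Sum>T\<in>Pow M. f T ^ d) \<le> (1 + 1/40) * 2 ^ d" by simp
    also have "\<dots> \<le> exp (1/40) * 2 ^ d" using exp_ge_add_one_self[of "1/40::real"] by (intro mult_right_mono) auto
    finally show ?thesis .
  qed
  have pt: "(\<Sum>B\<in>?Y. (1/3) ^ (\<Sum>y\<in>B. card (nb y \<inter> A))) \<le> exp (?N / real d * (- (ln 2 / 10) + eps * ln 100)) * (\<Prod>y\<in>R. f (A \<inter> nb y))"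
    if A: "A \<in> ?X" for A
  proof -
    have AL: "A \<subseteq> L" using A by auto
    have fA: "finite A" using AL fin_sub by auto
    have sR: "nbs A \<subseteq> R" using AL nbs_L by auto
    \<comment> \<open>The neighbourhood of \<open>B - nbs A\<close> avoids \<open>A\<close>, so at
      least \<open>N / 8 - eps * N\<close>, hence \<open>N / 10\<close>, vertices of
      \<open>nbs B\<close> are reached from \<open>B \<inter> nbs A\<close>, at most
      \<open>d\<close> from each.\<close>
    have many: "?N / (10 * real d) \<le> real (card (B \<inter> nbs A))" if B: "B \<in> ?Y" for B
    proof -
      have BR: "B \<subseteq> R" using B by auto
      have fB: "finite B" using BR fin_sub by auto
      have fn: "finite (nbs C)" if "C \<subseteq> R" for C using that nbs_R fin_sub by auto
      have "nbs (B - nbs A) \<inter> A = {}"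
      proof -
        have False if "y \<in> B" "y \<notin> nbs A" "x \<in> nb y" "x \<in> A" for x y
        proof -
          have "y \<in> nb x" using nb_sym[of x y] that AL BR by blast
          then show False using that unfolding nbs_def by blast
        qed
        then show ?thesis unfolding nbs_def by blast
      qed
      then have "card (nbs (B - nbs A)) + card A = card (nbs (B - nbs A) \<union> A)"
        using fA fn[of "B - nbs A"] BR by (subst card_Un_disjoint) auto
      also have "\<dots> \<le> card L" using nbs_R[of "B - nbs A"] BR AL finL by (intro card_mono) auto
      finally have 1: "card (nbs (B - nbs A)) + card A \<le> card L" .
      have "nbs B = nbs (B - nbs A) \<union> nbs (B \<inter> nbs A)" unfolding nbs_def by auto
      then have 2: "card (nbs B) \<le> card (nbs (B - nbs A)) + card (nbs (B \<inter> nbs A))" by (simp add: card_Un_le)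
      have 3: "card (nbs (B \<inter> nbs A)) \<le> d * card (B \<inter> nbs A)"
      proof -
        have "card (nbs (B \<inter> nbs A)) \<le> (\<Sum>y\<in>B \<inter> nbs A. card (nb y))" unfolding nbs_def using fB by (intro card_UN_le) auto
        also have "\<dots> = (\<Sum>y\<in>B \<inter> nbs A. d)" using BR card_nb by (intro sum.cong) auto
        finally show ?thesis by (simp add: mult.commute)
      qed
      have "card (nbs B) + card A \<le> card L + d * card (B \<inter> nbs A)" using 1 2 3 by linarith
      then have "real (card (nbs B) + card A) \<le> real (card L + d * card (B \<inter> nbs A))" by (rule of_nat_mono)
      then have 4: "real (card (nbs B)) + real (card A) \<le> ?N + real d * real (card (B \<inter> nbs A))" by simp
      have 5: "?N \<le> 8 * real (card A)" using A by simp
      have 6: "(1 - eps) * ?N < real (card (nbs B))" using B by auto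
      have "eps * ?N \<le> 1/1000 * ?N" using eps by (intro mult_right_mono) auto
      then have "?N / 10 \<le> real d * real (card (B \<inter> nbs A))" using 4 5 6 by (simp add: left_diff_distrib)
      then show ?thesis using D0 by (simp add: divide_simps mult_ac)
    qed
    have "(\<Sum>B\<in>?Y. (1/3) ^ (\<Sum>y\<in>B. card (nb y \<inter> A)))
      \<le> (\<Sum>B\<in>?Y. exp (- (ln 2 * (?N / (10 * real d)))) * (2 ^ card (B \<inter> nbs A) * (1/3::real) ^ (\<Sum>y\<in>B. card (nb y \<inter> A))))"
    proof (rule sum_mono)
      fix B assume B: "B \<in> ?Y"
      have "ln 2 * (?N / (10 * real d)) \<le> ln 2 * real (card (B \<inter> nbs A))" using many[OF B] by (intro mult_left_mono) auto
      then have "1 \<le> exp (- (ln 2 * (?N / (10 * real d)))) * exp (ln 2 * real (card (B \<inter> nbs A)))"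
        unfolding exp_add[symmetric] by (subst one_le_exp_iff) linarith
      also have "exp (ln 2 * real (card (B \<inter> nbs A))) = 2 ^ card (B \<inter> nbs A)" by (simp add: exp_of_nat2_mult)
      finally have "1 * (1/3::real) ^ (\<Sum>y\<in>B. card (nb y \<inter> A)) \<le> exp (- (ln 2 * (?N / (10 * real d)))) * 2 ^ card (B \<inter> nbs A) * (1/3) ^ (\<Sum>y\<in>B. card (nb y \<inter> A))"
        by (intro mult_right_mono) auto
      then show "(1/3::real) ^ (\<Sum>y\<in>B. card (nb y \<inter> A)) \<le> exp (- (ln 2 * (?N / (10 * real d)))) * (2 ^ card (B \<inter> nbs A) * (1/3) ^ (\<Sum>y\<in>B. card (nb y \<inter> A)))"
        by (simp only: mult.assoc mult_1_left)
    qed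
    also have "\<dots> = exp (- (ln 2 * (?N / (10 * real d)))) * (\<Sum>B\<in>?Y. 2 ^ card (B \<inter> nbs A) * (1/3::real) ^ (\<Sum>y\<in>B. card (nb y \<inter> A)))"
      by (rule sum_distrib_left[symmetric])
    also have "\<dots> \<le> exp (- (ln 2 * (?N / (10 * real d)))) * (\<Sum>B\<in>Pow R. 2 ^ card (B \<inter> nbs A) * (1/3::real) ^ (\<Sum>y\<in>B. card (nb y \<inter> A)))"
      using finR by (intro mult_left_mono sum_mono2) auto
    also have "(\<Sum>B\<in>Pow R. 2 ^ card (B \<inter> nbs A) * (1/3::real) ^ (\<Sum>y\<in>B. card (nb y \<inter> A)))
        = (\<Sum>B\<in>Pow R. (\<Prod>y\<in>B. (if y \<in> nbs A then 2 else 1) * (1/3) ^ card (nb y \<inter> A)) * (\<Prod>y\<in>R - B. 1))"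
    proof (rule sum.cong[OF refl])
      fix B assume "B \<in> Pow R"
      then have fB: "finite B" using fin_sub by auto
      have "(\<Prod>y\<in>B. if y \<in> nbs A then 2 else (1::real)) = (\<Prod>y\<in>B \<inter> nbs A. 2)"
        by (subst prod.inter_restrict[OF fB]) (rule refl)
      then show "2 ^ card (B \<inter> nbs A) * (1/3::real) ^ (\<Sum>y\<in>B. card (nb y \<inter> A))
        = (\<Prod>y\<in>B. (if y \<in> nbs A then 2 else 1) * (1/3) ^ card (nb y \<inter> A)) * (\<Prod>y\<in>R - B. 1)"
        by (simp add: prod.distrib power_sum)
    qed
    also have "\<dots> = (\<Prod>y\<in>R. (if y \<in> nbs A then 2 else 1) * (1/3) ^ card (nb y \<inter> A) + 1)"
      by (rule prod_add[OF finR, symmetric])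
    also have "\<dots> = (\<Prod>y\<in>R - nbs A. (if y \<in> nbs A then 2 else 1) * (1/3) ^ card (nb y \<inter> A) + 1) *
        (\<Prod>y\<in>nbs A. (if y \<in> nbs A then 2 else 1) * (1/3) ^ card (nb y \<inter> A) + 1)"
      by (rule prod.subset_diff[OF sR finR])
    also have "(\<Prod>y\<in>R - nbs A. (if y \<in> nbs A then 2 else 1) * (1/3) ^ card (nb y \<inter> A) + 1) = (\<Prod>y\<in>R - nbs A. 2::real)"
      using nbs_iff[OF AL] by (intro prod.cong) auto
    also have "(\<Prod>y\<in>nbs A. (if y \<in> nbs A then 2 else 1) * (1/3::real) ^ card (nb y \<inter> A) + 1) = (\<Prod>y\<in>nbs A. f (A \<inter> nb y))"
      using nbs_iff[OF AL] sR by (intro prod.cong) (auto simp: f_def Int_commute)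
    finally have 1: "(\<Sum>B\<in>?Y. (1/3) ^ (\<Sum>y\<in>B. card (nb y \<inter> A))) \<le>
      exp (- (ln 2 * (?N / (10 * real d)))) * (2 ^ card (R - nbs A) * (\<Prod>y\<in>nbs A. f (A \<inter> nb y)))" by simp
    have "(\<Prod>y\<in>R. f (A \<inter> nb y)) = (\<Prod>y\<in>R - nbs A. f (A \<inter> nb y)) * (\<Prod>y\<in>nbs A. f (A \<inter> nb y))"
      by (rule prod.subset_diff[OF sR finR])
    also have "(\<Prod>y\<in>R - nbs A. f (A \<inter> nb y)) = (\<Prod>y\<in>R - nbs A. 2 * s)"
      using nbs_iff[OF AL] by (intro prod.cong) (auto simp: f_def)
    finally have eq: "(\<Prod>y\<in>R. f (A \<inter> nb y)) = s ^ card (R - nbs A) * (2 ^ card (R - nbs A) * (\<Prod>y\<in>nbs A. f (A \<inter> nb y)))"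
      by (simp add: power_mult_distrib)
    have 2: "s ^ card (R - nbs A) \<ge> exp (- (?N / real d * (eps * ln 100)))"
    proof -
      have "real (card (R - nbs A)) \<le> eps * ?N" using A by (intro card_outside) auto
      then have "real (card (R - nbs A)) * (ln 100 / real d) \<le> eps * ?N * (ln 100 / real d)" using D0 by (intro mult_right_mono) auto
      then have "exp (- (?N / real d * (eps * ln 100))) \<le> exp (- (real (card (R - nbs A)) * (ln 100 / real d)))" by (simp add: mult_ac)
      also have "\<dots> = exp (- (ln 100 / real d)) ^ card (R - nbs A)" by (simp add: exp_of_nat_mult[symmetric])
      also have "exp (- (ln 100 / real d)) = s"
        unfolding s_def using d1 by (subst root_powr_inverse) (auto simp: powr_def ln_div)
      finally show ?thesis .
    qed
    let ?Z = "2 ^ card (R - nbs A) * (\<Prod>y\<in>nbs A. f (A \<inter> nb y))"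
    have Z0: "0 \<le> ?Z" using f0 by (simp add: prod_nonneg)
    have "exp (- (?N / real d * (eps * ln 100))) * ?Z \<le> (\<Prod>y\<in>R. f (A \<inter> nb y))"
      unfolding eq using 2 Z0 by (rule mult_right_mono)
    then have "exp (?N / real d * (- (ln 2 / 10) + eps * ln 100)) * (exp (- (?N / real d * (eps * ln 100))) * ?Z)
      \<le> exp (?N / real d * (- (ln 2 / 10) + eps * ln 100)) * (\<Prod>y\<in>R. f (A \<inter> nb y))" by (intro mult_left_mono) auto
    moreover have "exp (?N / real d * (- (ln 2 / 10) + eps * ln 100)) * (exp (- (?N / real d * (eps * ln 100))) * ?Z)
      = exp (- (ln 2 * (?N / (10 * real d)))) * ?Z"
    proof -
      have "?N / real d * (- (ln 2 / 10) + eps * ln 100) + - (?N / real d * (eps * ln 100)) = - (ln 2 * (?N / (10 * real d)))"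
        using D0 by (simp add: field_simps)
      then show ?thesis unfolding mult.assoc[symmetric] exp_add[symmetric] by (simp only:)
    qed
    ultimately show ?thesis using 1 by (simp only:)
  qed
  have "(\<Sum>A\<in>?X. \<Sum>B\<in>?Y. (1/3) ^ (\<Sum>y\<in>B. card (nb y \<inter> A))) \<le> (\<Sum>A\<in>?X. exp (?N / real d * (- (ln 2 / 10) + eps * ln 100)) * (\<Prod>y\<in>R. f (A \<inter> nb y)))"
    by (rule sum_mono) (rule pt)
  also have "\<dots> = exp (?N / real d * (- (ln 2 / 10) + eps * ln 100)) * (\<Sum>A\<in>?X. \<Prod>y\<in>R. f (A \<inter> nb y))"
    by (rule sum_distrib_left[symmetric])
  also have "\<dots> \<le> exp (?N / real d * (- (ln 2 / 10) + eps * ln 100)) * (\<Sum>A\<in>Pow L. \<Prod>y\<in>R. f (A \<inter> nb y))"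
    using finL f0 by (intro mult_left_mono sum_mono2 prod_nonneg) auto
  also have "\<dots> \<le> exp (?N / real d * (- (ln 2 / 10) + eps * ln 100)) * (root d (exp (1/40) * 2 ^ d)) ^ card R"
    using holder_all[OF f0 b] by (intro mult_left_mono) auto
  also have "root d (exp (1/40) * 2 ^ d) = exp (1 / (40 * real d)) * 2"
  proof -
    have "root d (exp (1/40) * 2 ^ d) = root d (exp (1/40)) * 2" using d1 by (simp add: real_root_mult real_root_power_cancel)
    also have "root d (exp (1/40)) = exp (1 / (40 * real d))" using d1 by (subst root_powr_inverse) (auto simp: powr_def)
    finally show ?thesis .
  qed
  also have "(exp (1 / (40 * real d)) * 2) ^ card R = exp (?N / real d * (1/40)) * 2 ^ card R"
    by (simp add: power_mult_distrib exp_of_nat_mult[symmetric] cardR)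
  also have "exp (?N / real d * (- (ln 2 / 10) + eps * ln 100)) * (exp (?N / real d * (1/40)) * 2 ^ card R)
     = 2 ^ card R * exp (?N / real d * (- (ln 2 / 10) + eps * ln 100 + 1/40))"
    by (simp add: exp_add distrib_left mult_ac)
  also have "\<dots> \<le> 2 ^ card R * exp (- (3/100) * (?N / real d))"
  proof -
    \<comment> \<open>Balance in units of \<open>N / d\<close>: the gain \<open>ln 2 / 10\<close>
      exceeds 0.066, while \<open>eps * ln 100\<close> is at most 0.005 and the local loss is
      0.025.\<close>
    have "ln (100::real) \<le> 5"
    proof -
      have "ln (100::real) = ln (128 * (100/128))" by simp
      also have "\<dots> = ln (2 ^ 7) + ln (100/128)" by (subst ln_mult) auto
      also have "ln (2 ^ 7 :: real) = 7 * ln 2" by (subst ln_realpow) auto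
      also have "ln (100/128::real) \<le> 0" by (simp add: ln_le_zero_iff)
      finally show ?thesis using ln2_le_25_over_36 by linarith
    qed
    then have "eps * ln 100 \<le> 1/1000 * 5" using eps by (intro mult_mono) auto
    then have "- (ln 2 / 10) + eps * ln 100 + 1/40 \<le> - (3/100::real)" using ln2_ge_two_thirds by linarith
    then have "?N / real d * (- (ln 2 / 10) + eps * ln 100 + 1/40) \<le> ?N / real d * (- (3/100))" by (intro mult_left_mono) auto
    then show ?thesis by (simp add: mult.commute)
  qed
  finally show ?thesis .
qed

end

section \<open>The hypercube\<close>

definition flip :: "nat \<Rightarrow> nat set \<Rightarrow> nat set" where
  "flip i x = (if i \<in> x then x - {i} else insert i x)"
definition cube_nb :: "nat \<Rightarrow> nat set \<Rightarrow> nat set set" where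
  "cube_nb d x = (\<lambda>i. flip i x) ` {..<d}"
definition side :: "nat \<Rightarrow> bool \<Rightarrow> nat set set" where
  "side d b = {x \<in> cube d. even (card x) = b}"

lemma flip_flip [simp]: "flip i (flip i x) = x" unfolding flip_def by auto
lemma mem_flip: "j \<in> flip i x \<longleftrightarrow> (if j = i then j \<notin> x else j \<in> x)" unfolding flip_def by auto
lemma flip_inj: "flip i x = flip j x \<Longrightarrow> i = j" by (metis mem_flip)
lemma flip_sub: "x \<subseteq> {..<d} \<Longrightarrow> i < d \<Longrightarrow> flip i x \<subseteq> {..<d}" unfolding flip_def by auto
lemma even_card_flip: "finite x \<Longrightarrow> even (card (flip i x)) = odd (card x)"
  unfolding flip_def by (auto simp: card_Diff_singleton card_gt_0_iff)
lemma cube_nb_sym: "y \<in> cube_nb d x \<longleftrightarrow> x \<in> cube_nb d y" unfolding cube_nb_def by force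
lemma card_cube_nb: "card (cube_nb d x) = d"
  unfolding cube_nb_def using flip_inj by (subst card_image) (auto intro!: inj_onI)
lemma cube_finite: "x \<in> cube d \<Longrightarrow> finite x" unfolding cube_def using finite_subset by auto
lemma finite_side: "finite (side d b)" unfolding side_def cube_def by auto
lemma cube_nb_side: "x \<in> side d b \<Longrightarrow> cube_nb d x \<subseteq> side d (\<not> b)"
  unfolding side_def cube_nb_def using flip_sub even_card_flip cube_finite by (auto simp: cube_def)

definition proj :: "nat \<Rightarrow> nat set \<Rightarrow> nat set" where "proj m x = x - {m}"

text \<open>On one side of the cube the parity determines the deleted coordinate.\<close>

lemma proj_bij: "bij_betw (proj m) (side (Suc m) b) (Pow {..<m})"
proof (rule bij_betwI')
  fix x y assume xy: "x \<in> side (Suc m) b" "y \<in> side (Suc m) b"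
  show "(proj m x = proj m y) = (x = y)"
  proof
    assume e: "proj m x = proj m y"
    have f: "finite x" "finite y" using xy cube_finite unfolding side_def by auto
    have ev: "even (card x) = even (card y)" using xy unfolding side_def by auto
    have c: "card z = card (z - {m}) + (if m \<in> z then 1 else 0)" if z: "finite z" for z :: "nat set"
    proof (cases "m \<in> z")
      case True
      then have "card z = Suc (card (z - {m}))" using z by (metis card.remove)
      then show ?thesis by (simp only: True if_True Suc_eq_plus1)
    qed simp
    obtain k where k: "card x = k + (if m \<in> x then 1 else 0)" "card y = k + (if m \<in> y then 1 else 0)"
      using c[OF f(1)] c[OF f(2)] e unfolding proj_def by metis
    have "m \<in> x \<longleftrightarrow> m \<in> y" using ev unfolding k by (auto split: if_splits)
    then show "x = y" using e unfolding proj_def by auto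
  qed simp
next
  fix x assume "x \<in> side (Suc m) b"
  then show "proj m x \<in> Pow {..<m}" unfolding side_def cube_def proj_def by (auto simp: less_Suc_eq)
next
  fix y assume y: "y \<in> Pow {..<m}"
  have f: "finite y" "m \<notin> y" using y finite_subset by auto
  have a: "y \<in> cube (Suc m)" "insert m y \<in> cube (Suc m)" using y unfolding cube_def by auto
  show "\<exists>x\<in>side (Suc m) b. y = proj m x"
  proof (cases "even (card y) = b")
    case True
    then show ?thesis using a f unfolding side_def proj_def by (intro bexI[of _ y]) auto
  next
    case False
    then show ?thesis using a f unfolding side_def proj_def by (intro bexI[of _ "insert m y"]) auto
  qed
qed

lemma card_side: "card (side (Suc m) b) = 2 ^ m"
  using bij_betw_same_card[OF proj_bij] by (simp add: card_Pow)

text \<open>Two distinct vertices with a common neighbour differ in exactly two coordinates, and any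
  common neighbour is reached by flipping one of them.\<close>

lemma cube_nb_codeg:
  assumes "x \<noteq> x'"
  shows "card (cube_nb d x \<inter> cube_nb d x') \<le> 2"
proof (cases "cube_nb d x \<inter> cube_nb d x' = {}")
  case False
  have key: "i \<in> (x - x') \<union> (x' - x) \<and> (x - x') \<union> (x' - x) = {i, j}" if "flip i x = flip j x'" for i j
  proof -
    have m: "k \<in> flip i x \<longleftrightarrow> k \<in> flip j x'" for k using that by simp
    have ij: "i \<noteq> j" using that assms by (metis flip_flip)
    have "k \<in> (x - x') \<union> (x' - x) \<longleftrightarrow> k = i \<or> k = j" for k
      using m[of k] ij by (auto simp: mem_flip split: if_splits)
    then show ?thesis by blast
  qed
  obtain i j where ij: "flip i x = flip j x'" using False unfolding cube_nb_def by auto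
  have "cube_nb d x \<inter> cube_nb d x' \<subseteq> (\<lambda>i. flip i x) ` ((x - x') \<union> (x' - x))"
    using key unfolding cube_nb_def by fast
  then have "card (cube_nb d x \<inter> cube_nb d x') \<le> card ((\<lambda>i. flip i x) ` {i, j})" using key[OF ij] by (intro card_mono) auto
  also have "\<dots> \<le> card {i, j}" by (rule card_image_le) simp
  also have "\<dots> \<le> 2" by (simp add: card_insert_le_m1)
  finally show ?thesis .
qed simp

section \<open>Isoperimetry in the cube\<close>

definition out_deg :: "nat \<Rightarrow> nat set set \<Rightarrow> nat set \<Rightarrow> nat" where
  "out_deg m X x = card {i. i < m \<and> flip i x \<notin> X}"

text \<open>Minkowski's inequality in the plane, as the triangle inequality for complex
  numbers.\<close>

lemma sum_sqrt_squares_ge: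
  fixes p q :: "'a \<Rightarrow> real"
  shows "sqrt ((sum p A)\<^sup>2 + (sum q A)\<^sup>2) \<le> (\<Sum>x\<in>A. sqrt ((p x)\<^sup>2 + (q x)\<^sup>2))"
proof -
  have "norm (\<Sum>x\<in>A. Complex (p x) (q x)) \<le> (\<Sum>x\<in>A. norm (Complex (p x) (q x)))" by (rule norm_sum)
  moreover have "(\<Sum>x\<in>A. Complex (p x) (q x)) = Complex (sum p A) (sum q A)"
    by (rule complex_eqI) (auto simp: Re_sum Im_sum)
  ultimately show ?thesis by (simp add: complex_norm)
qed

text \<open>Talagrand's inequality for the mean square root of the boundary degree. Splitting the cube
  along its last coordinate, Minkowski's inequality turns the induction step into a two-point inequality
  for \<open>a (M - a) / M\<close>.\<close>

lemma sqrt_boundary: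
  "X \<subseteq> Pow {..<m} \<Longrightarrow> real (card X) * (2 ^ m - real (card X)) / 2 ^ m \<le> (\<Sum>x\<in>X. sqrt (real (out_deg m X x)))"
proof (induction m arbitrary: X)
  case 0
  then have "X = {} \<or> X = {{}}" by auto
  then show ?case by (auto simp: out_deg_def)
next
  case (Suc m)
  define X0 where "X0 = {x \<in> X. m \<notin> x}"
  define X1 where "X1 = {x. m \<notin> x \<and> insert m x \<in> X}"
  define M :: real where "M = 2 ^ m"
  have M0: "M > 0" unfolding M_def by simp
  have finX: "finite X" using Suc.prems finite_subset by (metis finite_Pow_iff finite_lessThan)
  have s0: "X0 \<subseteq> Pow {..<m}" and s1: "X1 \<subseteq> Pow {..<m}"
  proof -
    have sm: "x \<in> Pow {..<m}" if x: "x \<subseteq> {..<Suc m}" "m \<notin> x" for x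
    proof -
      have "i < m" if "i \<in> x" for i
      proof -
        have "i < Suc m" "i \<noteq> m" using x that by auto
        then show ?thesis by simp
      qed
      then show ?thesis by auto
    qed
    have sub: "x \<subseteq> {..<Suc m}" if "x \<in> X" for x using Suc.prems that by auto
    show "X0 \<subseteq> Pow {..<m}" unfolding X0_def using sm sub by blast
    show "X1 \<subseteq> Pow {..<m}" unfolding X1_def using sm sub by blast
  qed
  have f0: "finite X0" and f1: "finite X1" using s0 s1 finite_subset by (metis finite_Pow_iff finite_lessThan)+
  have X: "X = X0 \<union> insert m ` X1"
  proof -
    have "x \<in> insert m ` X1" if "x \<in> X" "m \<in> x" for x
      using that unfolding X1_def by (intro image_eqI[of _ _ "x - {m}"]) (auto simp: insert_absorb)
    then show ?thesis unfolding X0_def X1_def by auto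
  qed
  have dis: "X0 \<inter> insert m ` X1 = {}" unfolding X0_def by auto
  have inj: "inj_on (insert m) X1" unfolding X1_def by (auto intro!: inj_onI)
  have fl: "flip i (insert m x) = insert m (flip i x)" if "i < m" for i and x :: "nat set"
    using that unfolding flip_def by auto
  have nm: "m \<notin> flip i x" if "i < m" "m \<notin> x" for i and x :: "nat set" using that by (simp add: mem_flip)
  have split: "{i. i < Suc m \<and> P i} = {i. i < m \<and> P i} \<union> (if P m then {m} else {})" for P by (auto simp: less_Suc_eq)
  have h0: "out_deg (Suc m) X x = out_deg m X0 x + (if x \<in> X1 then 0 else 1)" if x: "x \<in> X0" for x
  proof -
    have mx: "m \<notin> x" using x unfolding X0_def by auto
    have "flip m x \<in> X \<longleftrightarrow> x \<in> X1" using mx unfolding flip_def X1_def by auto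
    moreover have "{i. i < m \<and> flip i x \<notin> X} = {i. i < m \<and> flip i x \<notin> X0}" using nm mx unfolding X0_def by auto
    ultimately show ?thesis unfolding out_deg_def split by auto
  qed
  have h1: "out_deg (Suc m) X (insert m x) = out_deg m X1 x + (if x \<in> X0 then 0 else 1)" if x: "x \<in> X1" for x
  proof -
    have mx: "m \<notin> x" using x unfolding X1_def by auto
    have "flip m (insert m x) = x" using mx unfolding flip_def by auto
    then have "flip m (insert m x) \<in> X \<longleftrightarrow> x \<in> X0" using mx unfolding X0_def by auto
    moreover have "{i. i < m \<and> flip i (insert m x) \<notin> X} = {i. i < m \<and> flip i x \<notin> X1}" using nm mx fl unfolding X1_def by auto
    ultimately show ?thesis unfolding out_deg_def split by auto
  qed
  define J where "J a = a * (M - a) / M" for a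
  \<comment> \<open>In the larger cube the out-degree grows by 1 exactly at points whose partner in
    the other half is missing. Minkowski is applied to the square root of the old out-degree and the
    indicator of a missing partner.\<close>
  have half: "sqrt ((J (real (card Y)))\<^sup>2 + (real (card (Y - Z)))\<^sup>2) \<le> (\<Sum>x\<in>Y. sqrt (real (out_deg m Y x) + (if x \<in> Z then 0 else 1)))"
    if Y: "Y \<subseteq> Pow {..<m}" for Y Z
  proof -
    have fY: "finite Y" using Y finite_subset by (metis finite_Pow_iff finite_lessThan)
    have cY: "real (card Y) \<le> M"
    proof -
      have "card Y \<le> card (Pow {..<m})" using Y by (intro card_mono) auto
      then have "real (card Y) \<le> real (2 ^ m)" by (intro of_nat_mono) (simp add: card_Pow)
      then show ?thesis unfolding M_def by simp
    qed
    have "0 \<le> J (real (card Y))" using cY M0 unfolding J_def by simp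
    moreover have "J (real (card Y)) \<le> (\<Sum>x\<in>Y. sqrt (real (out_deg m Y x)))" using Suc.IH[OF Y] unfolding J_def M_def .
    ultimately have "(J (real (card Y)))\<^sup>2 \<le> (\<Sum>x\<in>Y. sqrt (real (out_deg m Y x)))\<^sup>2" by (intro power_mono) auto
    moreover have "(\<Sum>x\<in>Y. if x \<in> Z then 0 else 1) = real (card (Y - Z))"
    proof -
      have "(\<Sum>x\<in>Y. if x \<in> Z then 0 else (1::real)) = (\<Sum>x\<in>Y. if x \<in> - Z then 1 else 0)" by (intro sum.cong) auto
      also have "\<dots> = (\<Sum>x\<in>Y \<inter> - Z. 1)" by (subst sum.inter_restrict[OF fY]) (rule refl)
      finally show ?thesis by (simp add: Diff_eq)
    qed
    ultimately have "sqrt ((J (real (card Y)))\<^sup>2 + (real (card (Y - Z)))\<^sup>2)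
      \<le> sqrt ((\<Sum>x\<in>Y. sqrt (real (out_deg m Y x)))\<^sup>2 + (\<Sum>x\<in>Y. if x \<in> Z then 0 else 1)\<^sup>2)" by simp
    also have "\<dots> \<le> (\<Sum>x\<in>Y. sqrt ((sqrt (real (out_deg m Y x)))\<^sup>2 + (if x \<in> Z then 0 else 1)\<^sup>2))" by (rule sum_sqrt_squares_ge)
    also have "\<dots> = (\<Sum>x\<in>Y. sqrt (real (out_deg m Y x) + (if x \<in> Z then 0 else 1)))" by (intro sum.cong) auto
    finally show ?thesis .
  qed
  have "(\<Sum>x\<in>X. sqrt (real (out_deg (Suc m) X x))) = (\<Sum>x\<in>X0. sqrt (real (out_deg (Suc m) X x))) + (\<Sum>x\<in>insert m ` X1. sqrt (real (out_deg (Suc m) X x)))"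
    by (subst (1) X, rule sum.union_disjoint) (use f0 f1 dis in auto)
  also have "(\<Sum>x\<in>insert m ` X1. sqrt (real (out_deg (Suc m) X x))) = (\<Sum>x\<in>X1. sqrt (real (out_deg (Suc m) X (insert m x))))"
    by (simp add: sum.reindex[OF inj])
  also have "\<dots> = (\<Sum>x\<in>X1. sqrt (real (out_deg m X1 x) + (if x \<in> X0 then 0 else 1)))" using h1 by (intro sum.cong) auto
  also have "(\<Sum>x\<in>X0. sqrt (real (out_deg (Suc m) X x))) = (\<Sum>x\<in>X0. sqrt (real (out_deg m X0 x) + (if x \<in> X1 then 0 else 1)))"
    using h0 by (intro sum.cong) auto
  finally have tot: "sqrt ((J (real (card X0)))\<^sup>2 + (real (card (X0 - X1)))\<^sup>2) + sqrt ((J (real (card X1)))\<^sup>2 + (real (card (X1 - X0)))\<^sup>2)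
     \<le> (\<Sum>x\<in>X. sqrt (real (out_deg (Suc m) X x)))" using half[OF s0, of X1] half[OF s1, of X0] by linarith
  have bound: "card Y \<le> M" if "Y \<subseteq> Pow {..<m}" for Y
  proof -
    have "card Y \<le> card (Pow {..<m})" using that by (intro card_mono) auto
    then have "real (card Y) \<le> real (2 ^ m)" by (intro of_nat_mono) (simp add: card_Pow)
    then show ?thesis unfolding M_def by simp
  qed
  \<comment> \<open>The left side equals \<open>(a + b) * (2 * M - (a + b)) / (2 * M)\<close>, the
    bound for the doubled cube. Only the larger half needs its missing partners: with
    \<open>e = a - b\<close> and \<open>J a \<le> M / 4\<close>, squaring
    \<open>J a + e\<^sup>2 / (2 * M)\<close> adds at most \<open>e\<^sup>2 / 2\<close> to the square
    of \<open>J a\<close>.\<close>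
  have two: "J a + (a - b)\<^sup>2 / (2 * M) + J b \<le> sqrt ((J a)\<^sup>2 + u\<^sup>2) + sqrt ((J b)\<^sup>2 + v\<^sup>2)"
    if ab: "b \<le> a" "0 \<le> b" "a \<le> M" and u: "a - b \<le> u" for a b u v
  proof -
    have J0: "0 \<le> J a" "0 \<le> J b" using ab M0 unfolding J_def by auto
    have J4: "J a \<le> M / 4"
    proof -
      have "0 \<le> (M - 2 * a)\<^sup>2" by simp
      then have "4 * (a * (M - a)) \<le> M * M" by (simp add: power2_eq_square algebra_simps)
      then show ?thesis unfolding J_def using M0 by (simp add: divide_simps mult_ac)
    qed
    define e where "e = a - b"
    have e: "0 \<le> e" "e \<le> M" using ab unfolding e_def by auto
    have e2: "e\<^sup>2 \<le> M * e" using e by (simp add: power2_eq_square mult_right_mono)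
    have "(J a + e\<^sup>2 / (2 * M))\<^sup>2 = (J a)\<^sup>2 + J a * (e\<^sup>2 / M) + (e\<^sup>2 / (2 * M))\<^sup>2" by (simp add: power2_sum)
    also have "J a * (e\<^sup>2 / M) \<le> M / 4 * (e\<^sup>2 / M)" using J4 M0 by (intro mult_right_mono) auto
    also have "M / 4 * (e\<^sup>2 / M) = e\<^sup>2 / 4" using M0 by simp
    also have "(e\<^sup>2 / (2 * M))\<^sup>2 \<le> (e / 2)\<^sup>2"
    proof (rule power_mono)
      show "e\<^sup>2 / (2 * M) \<le> e / 2" using e2 M0 by (simp add: divide_simps mult_ac)
    qed (use M0 in simp)
    also have "(J a)\<^sup>2 + e\<^sup>2 / 4 + (e / 2)\<^sup>2 \<le> (J a)\<^sup>2 + u\<^sup>2"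
    proof -
      have "e\<^sup>2 \<le> u\<^sup>2" using u e unfolding e_def by (intro power_mono) auto
      moreover have "(e / 2)\<^sup>2 = e\<^sup>2 / 4" by (simp add: power_divide)
      moreover have "0 \<le> e\<^sup>2" by simp
      ultimately show ?thesis by linarith
    qed
    finally have "(J a + e\<^sup>2 / (2 * M))\<^sup>2 \<le> (J a)\<^sup>2 + u\<^sup>2" by simp
    then have "J a + e\<^sup>2 / (2 * M) \<le> sqrt ((J a)\<^sup>2 + u\<^sup>2)" by (rule real_le_rsqrt)
    moreover have "J b \<le> sqrt ((J b)\<^sup>2 + v\<^sup>2)" using J0 by (intro real_le_rsqrt) auto
    ultimately show ?thesis unfolding e_def by linarith
  qed
  let ?a = "real (card X0)" and ?b = "real (card X1)"
  have fin: "J ?a + (?a - ?b)\<^sup>2 / (2 * M) + J ?b \<le> (\<Sum>x\<in>X. sqrt (real (out_deg (Suc m) X x)))"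
  proof (cases "?b \<le> ?a")
    case True
    have "?a \<le> real (card (X0 - X1)) + ?b"
      using card_mono[of "(X0 - X1) \<union> X1" X0] card_Un_le[of "X0 - X1" X1] f0 f1 by (auto simp flip: of_nat_add)
    then show ?thesis using two[of ?b ?a "real (card (X0 - X1))" "real (card (X1 - X0))"] True bound[OF s0] tot by auto
  next
    case False
    have "?b \<le> real (card (X1 - X0)) + ?a"
      using card_mono[of "(X1 - X0) \<union> X0" X1] card_Un_le[of "X1 - X0" X0] f0 f1 by (auto simp flip: of_nat_add)
    then show ?thesis using two[of ?a ?b "real (card (X1 - X0))" "real (card (X0 - X1))"] False bound[OF s1] tot
      by (auto simp: power2_commute)
  qed
  have cX: "real (card X) = ?a + ?b"
    using X dis f0 f1 card_image[OF inj] by (metis card_Un_disjoint finite_imageI of_nat_add)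
  have "real (card X) * (2 ^ Suc m - real (card X)) / 2 ^ Suc m = J ?a + (?a - ?b)\<^sup>2 / (2 * M) + J ?b"
    unfolding cX J_def using M0 by (simp add: M_def[symmetric] field_simps power2_eq_square)
  then show ?case using fin by simp
qed

text \<open>
  Deleting the last coordinate identifies both sides of the cube with a cube of one dimension less, and turns
  neighbourhoods into closed neighbourhoods.
\<close>

lemma cube_isoperimetry:
  assumes C: "C \<subseteq> side (Suc m) b"
  shows "real (card C) * (2 ^ m - real (card C)) \<le> sqrt (real m) * 2 ^ m * (real (card (\<Union> (cube_nb (Suc m) ` C))) - real (card C))"
proof -
  let ?p = "proj m"
  define C' where "C' = ?p ` C"
  define K where "K = ?p ` (\<Union> (cube_nb (Suc m) ` C))"
  have inj: "inj_on ?p (side (Suc m) b')" for b' using proj_bij bij_betw_imp_inj_on by blast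
  have cC: "card C' = card C" unfolding C'_def using inj_on_subset[OF inj C] by (rule card_image)
  have nsub: "\<Union> (cube_nb (Suc m) ` C) \<subseteq> side (Suc m) (\<not> b)" using cube_nb_side C by blast
  have cK: "card K = card (\<Union> (cube_nb (Suc m) ` C))" unfolding K_def using inj_on_subset[OF inj nsub] by (rule card_image)
  have C's: "C' \<subseteq> Pow {..<m}" unfolding C'_def using proj_bij[of m b] C unfolding bij_betw_def by blast
  have Ks: "K \<subseteq> Pow {..<m}" unfolding K_def using proj_bij[of m "\<not> b"] nsub unfolding bij_betw_def by blast
  have pm: "?p (flip m x) = ?p x" for x unfolding proj_def flip_def by auto
  have pi: "?p (flip i x) = flip i (?p x)" if "i < m" for i x using that unfolding proj_def flip_def by auto
  \<comment> \<open>Flipping the deleted coordinate becomes the identity, so the projected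
    neighbourhood contains the projected set.\<close>
  have CK: "C' \<subseteq> K"
  proof
    fix z assume "z \<in> C'"
    then obtain x where x: "x \<in> C" "z = ?p x" unfolding C'_def by auto
    have "flip m x \<in> cube_nb (Suc m) x" unfolding cube_nb_def by auto
    then show "z \<in> K" unfolding K_def using x pm[of x] by (metis UN_I image_eqI)
  qed
  have CK2: "flip i z \<in> K" if "z \<in> C'" "i < m" for z i
  proof -
    have "z \<in> ?p ` C" using that(1) unfolding C'_def .
    then obtain x where x: "x \<in> C" "z = ?p x" by auto
    have "flip i x \<in> cube_nb (Suc m) x" unfolding cube_nb_def using that by auto
    then show ?thesis unfolding K_def using x pi[OF that(2), of x] by (metis UN_I image_eqI)
  qed
  \<comment> \<open>\<open>sqrt_boundary\<close> is applied to the complement: its points with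
    positive out-degree lie in \<open>K - C'\<close>, and each contributes at most
    \<open>sqrt m\<close>.\<close>
  define X where "X = Pow {..<m} - C'"
  have fin: "finite C'" "finite K" "finite X" using C's Ks finite_subset unfolding X_def by (metis finite_Diff finite_Pow_iff finite_lessThan)+
  have cX: "real (card X) = 2 ^ m - real (card C)"
  proof -
    have "card X = 2 ^ m - card C'" unfolding X_def using C's fin by (simp add: card_Diff_subset card_Pow)
    moreover have "card C' \<le> 2 ^ m" using card_mono[OF _ C's] by (simp add: card_Pow)
    ultimately show ?thesis using cC by (simp add: of_nat_diff)
  qed
  have "real (card X) * (2 ^ m - real (card X)) / 2 ^ m \<le> (\<Sum>x\<in>X. sqrt (real (out_deg m X x)))"
    by (rule sqrt_boundary) (auto simp: X_def)
  also have "\<dots> \<le> (\<Sum>x\<in>X. if x \<in> K then sqrt (real m) else 0)"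
  proof (rule sum_mono)
    fix x assume x: "x \<in> X"
    show "sqrt (real (out_deg m X x)) \<le> (if x \<in> K then sqrt (real m) else 0)"
    proof (cases "x \<in> K")
      case True
      have "out_deg m X x \<le> card {..<m}" unfolding out_deg_def by (intro card_mono) auto
      then show ?thesis using True by simp
    next
      case False
      have "flip i x \<in> X" if i: "i < m" for i
      proof -
        have "flip i x \<in> Pow {..<m}" using x i flip_sub unfolding X_def by auto
        moreover have "flip i x \<notin> C'" using CK2[of "flip i x" i] False i by auto
        ultimately show ?thesis unfolding X_def by auto
      qed
      then have "out_deg m X x = 0" unfolding out_deg_def by auto
      then show ?thesis using False by simp
    qed
  qed
  also have "\<dots> = (\<Sum>x\<in>X \<inter> K. sqrt (real m))" by (subst sum.inter_restrict[OF fin(3)]) (rule refl)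
  also have "\<dots> = real (card (K - C')) * sqrt (real m)"
  proof -
    have "X \<inter> K = K - C'" using Ks unfolding X_def by auto
    then show ?thesis by simp
  qed
  also have "real (card (K - C')) = real (card (\<Union> (cube_nb (Suc m) ` C))) - real (card C)"
  proof -
    have "card C \<le> card (\<Union> (cube_nb (Suc m) ` C))" using card_mono[OF fin(2) CK] unfolding cC cK .
    moreover have "card (K - C') = card (\<Union> (cube_nb (Suc m) ` C)) - card C"
      using card_Diff_subset[OF fin(1) CK] unfolding cC cK .
    ultimately show ?thesis by (simp add: of_nat_diff)
  qed
  finally show ?thesis unfolding cX by (simp add: divide_simps mult_ac)
qed

lemma cubical_cube: "cubical (side (Suc m) b) (side (Suc m) (\<not> b)) (cube_nb (Suc m)) (Suc m)"
proof -
  interpret B: biregular "side (Suc m) b" "side (Suc m) (\<not> b)" "cube_nb (Suc m)" "Suc m"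
    by unfold_locales (use finite_side cube_nb_side[of _ "Suc m" "\<not> b"] cube_nb_side cube_nb_sym card_cube_nb in auto)
  show ?thesis
  proof unfold_locales
    show "card (side (Suc m) b) = 2 ^ (Suc m - 1)" by (simp add: card_side)
    show "card (cube_nb (Suc m) x \<inter> cube_nb (Suc m) x') \<le> 2" if "x \<noteq> x'" for x x' using that by (rule cube_nb_codeg)
    fix C assume C: "C \<subseteq> side (Suc m) b"
    have "card C \<le> card (B.nbs C)"
    proof -
      have "card (B.cl (B.nbs C)) \<le> card (B.nbs C)" using B.card_cl_le B.nbs_L C by auto
      moreover have "card C \<le> card (B.cl (B.nbs C))" using B.sub_cl_nbs[OF C] finite_subset[OF B.cl_sub finite_side] by (intro card_mono) auto
      ultimately show ?thesis by simp
    qed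
    then have b: "sqrt (real m) * 2 ^ m * (real (card (B.nbs C)) - real (card C)) \<le> sqrt (real (Suc m)) * 2 ^ m * (real (card (B.nbs C)) - real (card C))"
      by (intro mult_right_mono) auto
    have c: "real (card (side (Suc m) b)) = 2 ^ m" by (simp add: card_side)
    show "real (card C) * (real (card (side (Suc m) b)) - real (card C))
       \<le> sqrt (real (Suc m)) * real (card (side (Suc m) b)) * (real (card (B.nbs C)) - real (card C))"
      unfolding c using order_trans[OF cube_isoperimetry[OF C, folded B.nbs_def] b] .
  qed
qed

section \<open>Pairs in which neither side is spread\<close>

locale cubical2 = cubical + rev: cubical R L nb d
begin

lemma edges_sym:
  assumes "A \<subseteq> L" "B \<subseteq> R"
  shows "(\<Sum>y\<in>B. card (nb y \<inter> A)) = (\<Sum>x\<in>A. card (nb x \<inter> B))"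
  using edge_count[OF assms] by simp

text \<open>Split at \<open>card A = N / 8\<close>: a smaller \<open>A\<close> is rare as an almost
  dominating set, a larger one leaves too little room for \<open>B\<close>. Both sums are smaller
  than \<open>2 ^ N\<close> by a factor exponential in \<open>N / d\<close>, far below what is
  asked.\<close>

lemma both_large:
  fixes eps :: real
  assumes eps: "0 \<le> eps" "eps \<le> 1/1000"
    and small1: "(real d + 1) ^ psi * (4/3) ^ d + exp (real d / 3 ^ psi) * (3/2) ^ d \<le> (8/5) ^ d"
    and small2: "(real d + 1) ^ psi * (5/3) ^ d + exp (2 * (real d / 3 ^ psi)) * 2 ^ d \<le> (1 + 3/200) * 2 ^ d"
    and d100: "d \<ge> 100" and d_big: "2 * exp (- (3/100) * (2 ^ (d - 1) / real d)) \<le> exp (- real d)"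
  shows "(\<Sum>A | A \<subseteq> L \<and> (1 - eps) * real (card L) < real (card (nbs A)).
      \<Sum>B | B \<subseteq> R \<and> (1 - eps) * real (card L) < real (card (nbs B)). (1/3) ^ (\<Sum>y\<in>B. card (nb y \<inter> A)))
    \<le> 2 ^ card R * exp (- real d)"
proof -
  let ?N = "real (card L)"
  let ?Y = "{B. B \<subseteq> R \<and> (1 - eps) * ?N < real (card (nbs B))}"
  let ?f = "\<lambda>A. \<Sum>B\<in>?Y. (1/3::real) ^ (\<Sum>y\<in>B. card (nb y \<inter> A))"
  let ?X = "{A. A \<subseteq> L \<and> (1 - eps) * ?N < real (card (nbs A))}"
  let ?X1 = "{A. A \<subseteq> L \<and> 8 * card A < card L \<and> (1 - eps) * ?N < real (card (nbs A))}"
  let ?X2 = "{A. A \<subseteq> L \<and> card L \<le> 8 * card A \<and> (1 - eps) * ?N < real (card (nbs A))}"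
  have D0: "real d \<ge> 100" using d100 by simp
  have finX: "finite {A. A \<subseteq> L \<and> P A}" for P using finL by (auto intro: finite_subset[of _ "Pow L"])
  have "?X = ?X1 \<union> ?X2" by auto
  moreover have "?X1 \<inter> ?X2 = {}" by auto
  ultimately have split: "sum ?f ?X = sum ?f ?X1 + sum ?f ?X2" by (simp only: sum.union_disjoint[OF finX finX])
  have "sum ?f ?X1 \<le> (\<Sum>A\<in>?X1. 2 ^ card R * wt (1/3) A)"
  proof (rule sum_mono)
    fix A assume "A \<in> ?X1"
    then have A: "A \<subseteq> L" by auto
    have "?f A \<le> (\<Sum>B\<in>Pow R. (1/3::real) ^ (\<Sum>y\<in>B. card (nb y \<inter> A)))" using finR by (intro sum_mono2) auto
    then show "?f A \<le> 2 ^ card R * wt (1/3) A" using sum_second_side[OF A, of "1/3"] by simp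
  qed
  then have 1: "sum ?f ?X1 \<le> 2 ^ card R * sum (wt (1/3)) ?X1" by (simp only: sum_distrib_left)
  have 2: "sum (wt (1/3)) ?X1 \<le> exp (?N * (ln 2 / 8 + eps * ln (5/4) + ln (4/5) + ln 2 / real d))"
    by (rule sparse_dominating_sets[OF eps(1) small1])
  have 3: "exp (?N * (ln 2 / 8 + eps * ln (5/4) + ln (4/5) + ln 2 / real d)) \<le> exp (- (3/100) * (?N / real d))"
  proof -
    have a: "ln (5/4::real) \<le> 1/4" using ln_le_minus_one[of "5/4::real"] by simp
    have b: "ln (4/5::real) \<le> -1/5" using ln_le_minus_one[of "4/5::real"] by simp
    have "eps * ln (5/4) \<le> 1/1000 * (1/4)" using a eps by (intro mult_mono) auto
    moreover have "ln 2 / real d \<le> 1 / 100" using D0 ln2_le_25_over_36 by (intro frac_le) auto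
    ultimately have "ln 2 / 8 + eps * ln (5/4) + ln (4/5) + ln 2 / real d \<le> - (3/100)" using b ln2_le_25_over_36 by linarith
    then have "?N * (ln 2 / 8 + eps * ln (5/4) + ln (4/5) + ln 2 / real d) \<le> ?N * (- (3/100))" by (intro mult_left_mono) auto
    moreover have "?N / real d \<le> ?N" using D0 mult_left_mono[of 1 "real d" ?N] by (simp add: divide_simps)
    ultimately have "?N * (ln 2 / 8 + eps * ln (5/4) + ln (4/5) + ln 2 / real d) \<le> - (3/100) * (?N / real d)" by linarith
    then show ?thesis by (simp only: exp_le_cancel_iff)
  qed
  have 4: "sum ?f ?X1 \<le> 2 ^ card R * exp (- (3/100) * (?N / real d))"
    by (rule order_trans[OF 1 mult_left_mono[OF order_trans[OF 2 3]]]) simp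
  have 5: "sum ?f ?X2 \<le> 2 ^ card R * exp (- (3/100) * (?N / real d))" by (rule dense_pairs[OF eps small2])
  have "sum ?f ?X \<le> 2 ^ card R * (2 * exp (- (3/100) * (?N / real d)))" unfolding split using 4 5 by linarith
  moreover have "2 ^ card R * (2 * exp (- (3/100) * (?N / real d))) \<le> 2 ^ card R * exp (- real d)"
  proof (rule mult_left_mono)
    have "?N = 2 ^ (d - 1)" using cardL by simp
    then show "2 * exp (- (3/100) * (?N / real d)) \<le> exp (- real d)" using d_big by (simp only:)
  qed simp
  ultimately show ?thesis by (rule order_trans)
qed

text \<open>Each such pair has a small neighbourhood on one side, where
  \<open>polymer_expansion\<close> applies and the other side is summed freely, or large ones on
  both. The middle term exchanges the roles of the sides.\<close>

lemma defect_sum_both_sides: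
  fixes q eps xi del :: real
  assumes q: "0 \<le> q" "q \<le> 1/3" and eps: "0 \<le> eps"
    and xi1: "(\<Sum>A | A \<subseteq> L \<and> linked n2 A \<and> 2 \<le> card A \<and> real (card (cl (nbs A))) \<le> (1 - eps) * real (card L). wt (1/3) A) \<le> xi"
    and xi2: "(\<Sum>A | A \<subseteq> R \<and> linked n2 A \<and> 2 \<le> card A \<and> real (card (rev.cl (nbs A))) \<le> (1 - eps) * real (card R). wt (1/3) A) \<le> xi"
    and large: "(\<Sum>A | A \<subseteq> L \<and> (1 - eps) * real (card L) < real (card (nbs A)).
      \<Sum>B | B \<subseteq> R \<and> (1 - eps) * real (card L) < real (card (nbs B)). (1/3) ^ (\<Sum>y\<in>B. card (nb y \<inter> A))) \<le> 2 ^ card R * del"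
  shows "(\<Sum>A\<in>Pow L. \<Sum>B\<in>Pow R. if \<not> spread nb A \<and> \<not> spread nb B then q ^ (\<Sum>y\<in>B. card (nb y \<inter> A)) else 0)
     \<le> 2 ^ card R * (2 * (exp (real (card L) * ((1 + q) / 2) ^ d) * (exp xi - 1)) + del)"
proof -
  let ?e = "\<lambda>A B. q ^ (\<Sum>y\<in>B. card (nb y \<inter> A))"
  let ?big = "\<lambda>A. (1 - eps) * real (card L) < real (card (nbs A))"
  let ?X = "{A. A \<subseteq> L \<and> \<not> spread nb A \<and> real (card (nbs A)) \<le> (1 - eps) * real (card L)}"
  let ?Y = "{A. A \<subseteq> R \<and> \<not> spread nb A \<and> real (card (nbs A)) \<le> (1 - eps) * real (card R)}"
  have fL: "finite {A. A \<subseteq> L \<and> P A}" for P using finL by (auto intro: finite_subset[of _ "Pow L"])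
  have fR: "finite {A. A \<subseteq> R \<and> P A}" for P using finR by (auto intro: finite_subset[of _ "Pow R"])
  have e0: "0 \<le> ?e A B" for A B using q by simp
  \<comment> \<open>The larger polymers may be weighed at 1/3, since their total is tiny anyway. The
    singletons keep \<open>q\<close>, because their factor has to match the main term up to a
    negligible ratio.\<close>
  have wmono: "sum (wt q) P \<le> sum (wt (1/3)) P" for P using q by (intro sum_mono wt_mono) auto
  have "(\<Sum>A\<in>Pow L. \<Sum>B\<in>Pow R. if \<not> spread nb A \<and> \<not> spread nb B then ?e A B else 0)
    \<le> (\<Sum>A\<in>Pow L. \<Sum>B\<in>Pow R. (if A \<in> ?X then ?e A B else 0) + (if B \<in> ?Y then ?e A B else 0)
        + (if ?big A then if ?big B then ?e A B else 0 else 0))"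
  proof (intro sum_mono)
    fix A B assume "A \<in> Pow L" "B \<in> Pow R"
    then have "A \<subseteq> L" "B \<subseteq> R" by auto
    then show "(if \<not> spread nb A \<and> \<not> spread nb B then ?e A B else 0)
      \<le> (if A \<in> ?X then ?e A B else 0) + (if B \<in> ?Y then ?e A B else 0) + (if ?big A then if ?big B then ?e A B else 0 else 0)"
      using e0[of A B] cardR by auto
  qed
  also have "\<dots> = (\<Sum>A\<in>Pow L. \<Sum>B\<in>Pow R. if A \<in> ?X then ?e A B else 0) + (\<Sum>A\<in>Pow L. \<Sum>B\<in>Pow R. if B \<in> ?Y then ?e A B else 0)
     + (\<Sum>A\<in>Pow L. \<Sum>B\<in>Pow R. if ?big A then if ?big B then ?e A B else 0 else 0)"
    by (simp only: sum.distrib)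
  also have "(\<Sum>A\<in>Pow L. \<Sum>B\<in>Pow R. if A \<in> ?X then ?e A B else 0) \<le> 2 ^ card R * (exp (real (card L) * ((1 + q) / 2) ^ d) * (exp xi - 1))"
  proof -
    have "(\<Sum>A\<in>Pow L. \<Sum>B\<in>Pow R. if A \<in> ?X then ?e A B else 0) = (\<Sum>A\<in>Pow L. if A \<in> ?X then \<Sum>B\<in>Pow R. ?e A B else 0)"
      by (intro sum.cong refl) simp
    also have "\<dots> = (\<Sum>A\<in>Pow L \<inter> ?X. \<Sum>B\<in>Pow R. ?e A B)" by (subst sum.inter_restrict) (use finL in auto)
    also have "\<dots> = (\<Sum>A\<in>?X. 2 ^ card R * wt q A)" using sum_second_side by (intro sum.cong) auto
    also have "\<dots> = 2 ^ card R * sum (wt q) ?X" by (simp add: sum_distrib_left)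
    also have "sum (wt q) ?X \<le> exp (real (card L) * ((1 + q) / 2) ^ d) * (exp xi - 1)"
      by (rule order_trans[OF polymer_expansion[OF q(1)] mult_left_mono[OF diff_right_mono]])
        (simp_all only: exp_le_cancel_iff order_trans[OF wmono xi1] exp_ge_zero)
    finally show ?thesis by simp
  qed
  also have "(\<Sum>A\<in>Pow L. \<Sum>B\<in>Pow R. if B \<in> ?Y then ?e A B else 0) \<le> 2 ^ card R * (exp (real (card L) * ((1 + q) / 2) ^ d) * (exp xi - 1))"
  proof -
    have "(\<Sum>A\<in>Pow L. \<Sum>B\<in>Pow R. if B \<in> ?Y then ?e A B else 0) = (\<Sum>B\<in>Pow R. \<Sum>A\<in>Pow L. if B \<in> ?Y then ?e A B else 0)"
      by (rule sum.swap)
    also have "\<dots> = (\<Sum>B\<in>Pow R. if B \<in> ?Y then \<Sum>A\<in>Pow L. ?e A B else 0)"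
      by (intro sum.cong refl) simp
    also have "\<dots> = (\<Sum>B\<in>Pow R \<inter> ?Y. \<Sum>A\<in>Pow L. ?e A B)" by (subst sum.inter_restrict) (use finR in auto)
    also have "\<dots> = (\<Sum>B\<in>?Y. 2 ^ card L * wt q B)"
    proof (rule sum.cong)
      fix B assume "B \<in> ?Y"
      then have B: "B \<subseteq> R" by auto
      have "(\<Sum>A\<in>Pow L. ?e A B) = (\<Sum>A\<in>Pow L. q ^ (\<Sum>x\<in>A. card (nb x \<inter> B)))"
        using edges_sym[OF _ B] by (intro sum.cong) auto
      then show "(\<Sum>A\<in>Pow L. ?e A B) = 2 ^ card L * wt q B" using rev.sum_second_side[OF B] by simp
    qed auto
    also have "\<dots> = 2 ^ card L * sum (wt q) ?Y" by (simp add: sum_distrib_left)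
    also have "sum (wt q) ?Y \<le> exp (real (card R) * ((1 + q) / 2) ^ d) * (exp xi - 1)"
      by (rule order_trans[OF rev.polymer_expansion[OF q(1)] mult_left_mono[OF diff_right_mono]])
        (simp_all only: exp_le_cancel_iff order_trans[OF wmono xi2] exp_ge_zero)
    finally show ?thesis by (simp add: cardR)
  qed
  also have "(\<Sum>A\<in>Pow L. \<Sum>B\<in>Pow R. if ?big A then if ?big B then ?e A B else 0 else 0) \<le> 2 ^ card R * del"
  proof -
    have "(\<Sum>A\<in>Pow L. \<Sum>B\<in>Pow R. if ?big A then if ?big B then ?e A B else 0 else 0)
       \<le> (\<Sum>A\<in>Pow L. if A \<in> {A. A \<subseteq> L \<and> ?big A} then (\<Sum>B | B \<subseteq> R \<and> ?big B. (1/3) ^ (\<Sum>y\<in>B. card (nb y \<inter> A))) else 0)"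
    proof (rule sum_mono)
      fix A assume A: "A \<in> Pow L"
      show "(\<Sum>B\<in>Pow R. if ?big A then if ?big B then ?e A B else 0 else 0)
        \<le> (if A \<in> {A. A \<subseteq> L \<and> ?big A} then (\<Sum>B | B \<subseteq> R \<and> ?big B. (1/3) ^ (\<Sum>y\<in>B. card (nb y \<inter> A))) else 0)"
      proof (cases "?big A")
        case True
        have "(\<Sum>B\<in>Pow R. if ?big A then if ?big B then ?e A B else 0 else 0) = (\<Sum>B\<in>Pow R. if B \<in> {B. ?big B} then ?e A B else 0)"
          using True by (intro sum.cong) auto
        also have "\<dots> = (\<Sum>B\<in>Pow R \<inter> {B. ?big B}. ?e A B)" by (subst sum.inter_restrict) (use finR in auto)
        also have "\<dots> \<le> (\<Sum>B\<in>Pow R \<inter> {B. ?big B}. (1/3) ^ (\<Sum>y\<in>B. card (nb y \<inter> A)))" using q by (intro sum_mono power_mono) auto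
        also have "Pow R \<inter> {B. ?big B} = {B. B \<subseteq> R \<and> ?big B}" by auto
        finally show ?thesis using True A by auto
      qed simp
    qed
    also have "\<dots> = (\<Sum>A\<in>Pow L \<inter> {A. A \<subseteq> L \<and> ?big A}. \<Sum>B | B \<subseteq> R \<and> ?big B. (1/3) ^ (\<Sum>y\<in>B. card (nb y \<inter> A)))"
      by (subst sum.inter_restrict) (use finL in auto)
    also have "Pow L \<inter> {A. A \<subseteq> L \<and> ?big A} = {A. A \<subseteq> L \<and> ?big A}" by auto
    also note large
    finally show ?thesis .
  qed
  finally show ?thesis by (simp add: algebra_simps)
qed

end

lemma cubical2_cube: "cubical2 (side (Suc m) b) (side (Suc m) (\<not> b)) (cube_nb (Suc m)) (Suc m)"
  using cubical_cube[of m b] cubical_cube[of m "\<not> b"] by (simp add: cubical2_def)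

definition edge_num :: "nat \<Rightarrow> nat set set \<Rightarrow> nat set set \<Rightarrow> nat" where
  "edge_num d A B = (\<Sum>y\<in>B. card (cube_nb d y \<inter> A))"

text \<open>Fixes \<open>eps = 1/1000\<close> and \<open>psi\<close> about
  \<open>d powr (1/4)\<close>. The singleton factor is \<open>exp mu\<close> for
  \<open>q = 1 - p\<close>, so relative to it the bound is of order
  \<open>exp (- d / 20)\<close>.\<close>

lemma defect_sum_cube:
  "eventually (\<lambda>d. \<forall>q. 0 \<le> q \<longrightarrow> q \<le> 1/3 \<longrightarrow>
    (\<Sum>A\<in>Pow (side d True). \<Sum>B\<in>Pow (side d False). if \<not> spread (cube_nb d) A \<and> \<not> spread (cube_nb d) B then q ^ edge_num d A B else 0)
     \<le> 2 ^ 2 ^ (d - 1) * (2 * (exp (2 ^ (d - 1) * ((1 + q) / 2) ^ d) * (exp (2 * exp (- real d / 20)) - 1)) + exp (- real d))) sequentially"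
proof -
  define psi where "psi d = nat \<lceil>real d powr (1/4)\<rceil>" for d
  have psi1: "real d powr (1/4) \<le> real (psi d)" "real (psi d) \<le> real d powr (1/4) + 1" for d
    unfolding psi_def using powr_ge_zero[of "real d" "1/4"] by linarith+
  have pw: "(real d + 1) ^ psi d \<le> (real d + 1) powr (real d powr (1/4) + 1)" for d
  proof -
    have "(real d + 1) ^ psi d = (real d + 1) powr (real (psi d))" by (simp add: powr_realpow)
    also have "\<dots> \<le> (real d + 1) powr (real d powr (1/4) + 1)" using psi1 by (intro powr_mono) auto
    finally show ?thesis .
  qed
  have p3: "real d / 3 ^ psi d \<le> real d / 3 powr (real d powr (1/4))" for d
  proof -
    have "3 powr (real d powr (1/4)) \<le> 3 powr (real (psi d))" using psi1 by (intro powr_mono) auto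
    also have "\<dots> = 3 ^ psi d" by (simp add: powr_realpow)
    finally show ?thesis by (intro divide_left_mono) auto
  qed
  have a8: "eventually (\<lambda>d::nat. (real d + 1) powr (real d powr (1/4) + 1) * (5/6) ^ d \<le> 1/200) sequentially" by real_asymp
  have s1: "eventually (\<lambda>d. (real d + 1) ^ psi d * (4/3) ^ d + exp (real d / 3 ^ psi d) * (3/2) ^ d \<le> (8/5) ^ d) sequentially"
  proof -
    have "eventually (\<lambda>d::nat. (real d + 1) powr (real d powr (1/4) + 1) * (5/6) ^ d + exp (real d / 3 powr (real d powr (1/4))) * (15/16) ^ d \<le> 1) sequentially"
    proof -
      have "eventually (\<lambda>d::nat. (15/16) ^ d \<le> (1/4::real)) sequentially"
        "eventually (\<lambda>d::nat. exp (real d / 3 powr (real d powr (1/4))) \<le> 1 + 1/200) sequentially" by real_asymp+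
      then show ?thesis using a8
      proof eventually_elim
        case (elim d)
        have "exp (real d / 3 powr (real d powr (1/4))) * (15/16) ^ d \<le> (1 + 1/200) * (1/4)" using elim by (intro mult_mono) auto
        moreover have "x + y \<le> 1" if "x \<le> 1/200" "y \<le> (1 + 1/200) * (1/4)" for x y :: real using that by simp
        ultimately show ?case using elim(3) by blast
      qed
    qed
    then show ?thesis
    proof eventually_elim
      case (elim d)
      have "(4/3::real) ^ d = (5/6) ^ d * (8/5) ^ d" "(3/2::real) ^ d = (15/16) ^ d * (8/5) ^ d"
        by (simp_all add: power_mult_distrib[symmetric])
      then have "(real d + 1) ^ psi d * (4/3) ^ d + exp (real d / 3 ^ psi d) * (3/2) ^ d
        = ((real d + 1) ^ psi d * (5/6) ^ d + exp (real d / 3 ^ psi d) * (15/16) ^ d) * (8/5) ^ d" by (simp add: algebra_simps)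
      also have "\<dots> \<le> ((real d + 1) powr (real d powr (1/4) + 1) * (5/6) ^ d + exp (real d / 3 powr (real d powr (1/4))) * (15/16) ^ d) * (8/5) ^ d"
        using pw[of d] p3[of d] by (intro add_mono mult_right_mono) auto
      also have "\<dots> \<le> 1 * (8/5) ^ d" using elim by (intro mult_right_mono) auto
      finally show ?case by simp
    qed
  qed
  have s2: "eventually (\<lambda>d. (real d + 1) ^ psi d * (5/3) ^ d + exp (2 * (real d / 3 ^ psi d)) * 2 ^ d \<le> (1 + 3/200) * 2 ^ d) sequentially"
  proof -
    have "eventually (\<lambda>d::nat. (real d + 1) powr (real d powr (1/4) + 1) * (5/6) ^ d + exp (2 * (real d / 3 powr (real d powr (1/4)))) \<le> 1 + 3/200) sequentially"
    proof -
      have "eventually (\<lambda>d::nat. exp (2 * (real d / 3 powr (real d powr (1/4)))) \<le> 1 + 1/200) sequentially" by real_asymp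
      then show ?thesis using a8
      proof eventually_elim
        case (elim d)
        have "x + y \<le> 1 + 3/200" if "x \<le> 1/200" "y \<le> 1 + 1/200" for x y :: real using that by simp
        then show ?case using elim by blast
      qed
    qed
    then show ?thesis
    proof eventually_elim
      case (elim d)
      have "(5/3::real) ^ d = (5/6) ^ d * 2 ^ d" by (simp add: power_mult_distrib[symmetric])
      then have "(real d + 1) ^ psi d * (5/3) ^ d + exp (2 * (real d / 3 ^ psi d)) * 2 ^ d
        = ((real d + 1) ^ psi d * (5/6) ^ d + exp (2 * (real d / 3 ^ psi d))) * 2 ^ d" by (simp add: algebra_simps)
      also have "\<dots> \<le> ((real d + 1) powr (real d powr (1/4) + 1) * (5/6) ^ d + exp (2 * (real d / 3 powr (real d powr (1/4))))) * 2 ^ d"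
        using pw[of d] p3[of d] by (intro add_mono mult_right_mono) auto
      also have "\<dots> \<le> (1 + 3/200) * 2 ^ d" using elim by (intro mult_right_mono) auto
      finally show ?case .
    qed
  qed
  have s3: "eventually (\<lambda>d::nat. 2 * exp (- (3/100) * (2 ^ (d - 1) / real d)) \<le> exp (- real d)) sequentially"
  proof -
    have "eventually (\<lambda>d::nat. 2 * exp (- (3/100) * (2 ^ d / 2 / real d)) \<le> exp (- real d)) sequentially" by real_asymp
    then show ?thesis using eventually_ge_at_top[of 1]
    proof eventually_elim
      case (elim d)
      have e: "(2::real) ^ (d - 1) = 2 ^ d / 2" using elim(2) by (cases d) auto
      show ?case unfolding e by (rule elim(1))
    qed
  qed
  have poly: "eventually (\<lambda>d. \<forall>L R (nb :: nat set \<Rightarrow> nat set set). cubical L R nb d \<longrightarrow>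
    (\<Sum>A | A \<subseteq> L \<and> linked (biregular.n2 nb) A \<and> 2 \<le> card A \<and>
        real (card (biregular.cl L nb (biregular.nbs nb A))) \<le> (1 - 1/1000) * real (card L). biregular.wt nb (1/3) A)
     \<le> 2 * exp (- real d / 20)) sequentially" by (rule polymers_total) auto
  show ?thesis
    using s1 s2 s3 poly eventually_ge_at_top[of 100]
  proof eventually_elim
    case (elim d)
    obtain m where d: "d = Suc m" using elim(5) by (cases d) auto
    interpret cubical2 "side d True" "side d False" "cube_nb d" d using cubical2_cube[of m True] d by simp
    have c: "cubical (side d True) (side d False) (cube_nb d) d" "cubical (side d False) (side d True) (cube_nb d) d"
      using cubical_cube[of m True] cubical_cube[of m False] d by auto
    have large: "(\<Sum>A | A \<subseteq> side d True \<and> (1 - 1/1000) * real (card (side d True)) < real (card (nbs A)).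
      \<Sum>B | B \<subseteq> side d False \<and> (1 - 1/1000) * real (card (side d True)) < real (card (nbs B)). (1/3) ^ (\<Sum>y\<in>B. card (cube_nb d y \<inter> A))) \<le> 2 ^ card (side d False) * exp (- real d)"
      by (rule both_large[OF _ _ elim(1,2,5,3)]) auto
    show ?case
    proof (intro allI impI)
      fix q :: real assume q: "0 \<le> q" "q \<le> 1/3"
      have x1: "(\<Sum>A | A \<subseteq> side d True \<and> linked n2 A \<and> 2 \<le> card A \<and> real (card (cl (nbs A))) \<le> (1 - 1/1000) * real (card (side d True)). wt (1/3) A) \<le> 2 * exp (- real d / 20)"
        using elim(4) c(1) by blast
      have x2: "(\<Sum>A | A \<subseteq> side d False \<and> linked n2 A \<and> 2 \<le> card A \<and> real (card (rev.cl (nbs A))) \<le> (1 - 1/1000) * real (card (side d False)). wt (1/3) A) \<le> 2 * exp (- real d / 20)"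
        using elim(4) c(2) by blast
      have "card (side d True) = 2 ^ (d - 1)" "card (side d False) = 2 ^ (d - 1)" using d card_side by auto
      then show "(\<Sum>A\<in>Pow (side d True). \<Sum>B\<in>Pow (side d False). if \<not> spread (cube_nb d) A \<and> \<not> spread (cube_nb d) B then q ^ edge_num d A B else 0)
        \<le> 2 ^ 2 ^ (d - 1) * (2 * (exp (2 ^ (d - 1) * ((1 + q) / 2) ^ d) * (exp (2 * exp (- real d / 20)) - 1)) + exp (- real d))"
        using defect_sum_both_sides[OF q _ x1 x2 large] unfolding edge_num_def by simp
    qed
  qed
qed

section \<open>Percolation\<close>

definition pexp :: "nat \<Rightarrow> real \<Rightarrow> (nat set set set \<Rightarrow> real) \<Rightarrow> real" where
  "pexp d p f = (\<Sum>F\<in>Pow (cube_edges d). p ^ card F * (1 - p) ^ (card (cube_edges d) - card F) * f F)"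

lemma finite_cube: "finite (cube d)" unfolding cube_def by simp

text \<open>Every edge has exactly one odd endpoint. Together with \<open>edge_inj\<close> this
  encodes edges as pairs of an odd vertex and a neighbour, which can be counted vertex by
  vertex.\<close>

lemma cube_edges_eq: "cube_edges d = (\<lambda>(y, x). {x, y}) ` (SIGMA y:side d False. cube_nb d y)"
proof
  show "(\<lambda>(y, x). {x, y}) ` (SIGMA y:side d False. cube_nb d y) \<subseteq> cube_edges d"
  proof
    fix e assume "e \<in> (\<lambda>(y, x). {x, y}) ` (SIGMA y:side d False. cube_nb d y)"
    then obtain y i where y: "y \<in> side d False" "i < d" "e = {flip i y, y}" unfolding cube_nb_def by auto
    have c: "flip i y \<in> cube d" "y \<in> cube d" using y flip_sub unfolding side_def cube_def by auto
    have "flip i y - y \<union> (y - flip i y) = {i}" unfolding flip_def by auto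
    then have "card (flip i y - y \<union> (y - flip i y)) = 1" by simp
    then show "e \<in> cube_edges d" unfolding cube_edges_def mem_Collect_eq using y(3) c by (intro exI[of _ "flip i y"] exI[of _ y] conjI)
  qed
  show "cube_edges d \<subseteq> (\<lambda>(y, x). {x, y}) ` (SIGMA y:side d False. cube_nb d y)"
  proof
    fix e assume "e \<in> cube_edges d"
    then obtain x y where xy: "e = {x, y}" "x \<in> cube d" "y \<in> cube d" "card (x - y \<union> (y - x)) = 1"
      unfolding cube_edges_def by blast
    then obtain i where i: "x - y \<union> (y - x) = {i}" using card_1_singletonE by blast
    have xf: "x = flip i y"
    proof (rule set_eqI)
      fix j
      have "j \<in> x - y \<union> (y - x) \<longleftrightarrow> j = i" using i by simp
      then show "j \<in> x \<longleftrightarrow> j \<in> flip i y" by (auto simp: mem_flip)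
    qed
    have id: "i < d" using i xy unfolding cube_def by blast
    have yf: "y = flip i x" using xf by simp
    have par: "even (card x) = odd (card y)" using even_card_flip[of y i] xf cube_finite xy by simp
    show "e \<in> (\<lambda>(y, x). {x, y}) ` (SIGMA y:side d False. cube_nb d y)"
    proof (cases "even (card y)")
      case False
      then show ?thesis using xy xf id unfolding cube_nb_def side_def by (intro image_eqI[of _ _ "(y, x)"]) auto
    next
      case True
      then show ?thesis using xy yf id par unfolding cube_nb_def side_def by (intro image_eqI[of _ _ "(x, y)"]) auto
    qed
  qed
qed

lemma side_disjoint: "side d True \<inter> side d False = {}" unfolding side_def by auto
lemma side_union: "side d True \<union> side d False = cube d" unfolding side_def by auto

lemma edge_inj: "inj_on (\<lambda>(y, x). {x, y}) (SIGMA y:side d False. cube_nb d y)"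
proof (rule inj_onI, clarify)
  fix y x y' x' assume a: "y \<in> side d False" "x \<in> cube_nb d y" "y' \<in> side d False" "x' \<in> cube_nb d y'" "{x, y} = {x', y'}"
  have "x \<in> side d True" "x' \<in> side d True" using a cube_nb_side[of y d False] cube_nb_side[of y' d False] by auto
  then have "x \<noteq> y'" "x' \<noteq> y" using a(1,3) side_disjoint[of d] by auto
  then show "y = y' \<and> x = x'" using a(5) by (auto simp: doubleton_eq_iff)
qed

lemma finite_cube_edges: "finite (cube_edges d)"
  unfolding cube_edges_eq using finite_side by (auto intro!: finite_imageI finite_SigmaI simp: cube_nb_def)

lemma card_edges_inside:
  assumes A: "A \<subseteq> side d True" and B: "B \<subseteq> side d False"
  shows "card {e \<in> cube_edges d. e \<subseteq> A \<union> B} = edge_num d A B"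
proof -
  have "{e \<in> cube_edges d. e \<subseteq> A \<union> B} = (\<lambda>(y, x). {x, y}) ` (SIGMA y:B. cube_nb d y \<inter> A)"
  proof
    show "{e \<in> cube_edges d. e \<subseteq> A \<union> B} \<subseteq> (\<lambda>(y, x). {x, y}) ` (SIGMA y:B. cube_nb d y \<inter> A)"
    proof
      fix e assume "e \<in> {e \<in> cube_edges d. e \<subseteq> A \<union> B}"
      then obtain y x where e: "e = {x, y}" "y \<in> side d False" "x \<in> cube_nb d y" "{x, y} \<subseteq> A \<union> B"
        unfolding cube_edges_eq by auto
      have "x \<in> side d True" using e cube_nb_side[of y d False] by auto
      then have "x \<in> A" "y \<in> B" using e(2,4) A B side_disjoint[of d] by auto
      then show "e \<in> (\<lambda>(y, x). {x, y}) ` (SIGMA y:B. cube_nb d y \<inter> A)" using e by (intro image_eqI[of _ _ "(y, x)"]) auto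
    qed
    show "(\<lambda>(y, x). {x, y}) ` (SIGMA y:B. cube_nb d y \<inter> A) \<subseteq> {e \<in> cube_edges d. e \<subseteq> A \<union> B}"
      unfolding cube_edges_eq using B by auto
  qed
  moreover have "inj_on (\<lambda>(y, x). {x, y}) (SIGMA y:B. cube_nb d y \<inter> A)"
    by (rule inj_on_subset[OF edge_inj]) (use B in auto)
  ultimately have "card {e \<in> cube_edges d. e \<subseteq> A \<union> B} = card (SIGMA y:B. cube_nb d y \<inter> A)" by (simp add: card_image)
  also have "\<dots> = (\<Sum>y\<in>B. card (cube_nb d y \<inter> A))"
    using finite_subset[OF B finite_side] by (subst card_SigmaI) (auto simp: cube_nb_def)
  finally show ?thesis unfolding edge_num_def .
qed

lemma edges_at:
  assumes v: "v \<in> cube d" shows "{e \<in> cube_edges d. v \<in> e} = (\<lambda>y. {v, y}) ` cube_nb d v"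
proof
  show "{e \<in> cube_edges d. v \<in> e} \<subseteq> (\<lambda>y. {v, y}) ` cube_nb d v"
    unfolding cube_edges_eq using cube_nb_sym by auto
  show "(\<lambda>y. {v, y}) ` cube_nb d v \<subseteq> {e \<in> cube_edges d. v \<in> e}"
  proof
    fix e assume "e \<in> (\<lambda>y. {v, y}) ` cube_nb d v"
    then obtain y where y: "e = {v, y}" "y \<in> cube_nb d v" by auto
    show "e \<in> {e \<in> cube_edges d. v \<in> e}"
    proof (cases "v \<in> side d False")
      case True
      then show ?thesis unfolding cube_edges_eq using y by (auto intro!: image_eqI[of _ _ "(v, y)"])
    next
      case False
      then have "v \<in> side d True" using v side_union by blast
      then have "y \<in> side d False" using y cube_nb_side[of v d True] by auto
      then show ?thesis unfolding cube_edges_eq using y cube_nb_sym by (auto intro!: image_eqI[of _ _ "(y, v)"])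
    qed
  qed
qed

lemma card_edges_at:
  assumes "v \<in> cube d" shows "card {e \<in> cube_edges d. v \<in> e} = d"
proof -
  have "v \<notin> cube_nb d v" unfolding cube_nb_def flip_def by auto
  then have "inj_on (\<lambda>y. {v, y}) (cube_nb d v)" by (auto intro!: inj_onI simp: doubleton_eq_iff)
  then show ?thesis unfolding edges_at[OF assms] by (simp add: card_image card_cube_nb)
qed

text \<open>Independence of the edges: the expectation of a product over the retained edges
  factorises.\<close>

lemma pexp_prod: "pexp d p (\<lambda>F. \<Prod>e\<in>F. a e) = (\<Prod>e\<in>cube_edges d. p * a e + (1 - p))"
proof -
  have "pexp d p (\<lambda>F. \<Prod>e\<in>F. a e) = (\<Sum>F\<in>Pow (cube_edges d). (\<Prod>e\<in>F. p * a e) * (\<Prod>e\<in>cube_edges d - F. 1 - p))"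
    unfolding pexp_def
  proof (rule sum.cong[OF refl])
    fix F assume F: "F \<in> Pow (cube_edges d)"
    then have "card (cube_edges d - F) = card (cube_edges d) - card F" using finite_cube_edges finite_subset by (intro card_Diff_subset) auto
    then show "p ^ card F * (1 - p) ^ (card (cube_edges d) - card F) * (\<Prod>e\<in>F. a e) = (\<Prod>e\<in>F. p * a e) * (\<Prod>e\<in>cube_edges d - F. 1 - p)"
      by (simp add: prod.distrib)
  qed
  also have "\<dots> = (\<Prod>e\<in>cube_edges d. p * a e + (1 - p))" by (rule prod_add[OF finite_cube_edges, symmetric])
  finally show ?thesis .
qed

lemma pexp_add: "pexp d p (\<lambda>F. f F + g F) = pexp d p f + pexp d p g"
  unfolding pexp_def by (simp add: distrib_left sum.distrib)
lemma pexp_cmult: "pexp d p (\<lambda>F. c * f F) = c * pexp d p f"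
  unfolding pexp_def by (simp add: sum_distrib_left mult_ac)
lemma pexp_sum: "pexp d p (\<lambda>F. \<Sum>i\<in>I. f i F) = (\<Sum>i\<in>I. pexp d p (f i))"
  unfolding pexp_def by (simp add: sum_distrib_left sum.swap[of _ _ I])
lemma pexp_const: "pexp d p (\<lambda>F. c) = c"
  using pexp_prod[of d p "\<lambda>_. 1"] pexp_cmult[of d p c "\<lambda>_. 1"] by simp
lemma pexp_mono:
  assumes "0 \<le> p" "p \<le> 1" "\<And>F. F \<subseteq> cube_edges d \<Longrightarrow> f F \<le> g F"
  shows "pexp d p f \<le> pexp d p g"
  unfolding pexp_def using assms by (intro sum_mono mult_left_mono) auto

lemma perc_prob_pexp: "perc_prob d p A = pexp d p (\<lambda>F. if F \<in> A then 1 else 0)"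
proof -
  have "pexp d p (\<lambda>F. if F \<in> A then 1 else 0) = (\<Sum>F\<in>Pow (cube_edges d). if F \<in> A then p ^ card F * (1 - p) ^ (card (cube_edges d) - card F) else 0)"
    unfolding pexp_def by (intro sum.cong) auto
  also have "\<dots> = (\<Sum>F\<in>Pow (cube_edges d) \<inter> A. p ^ card F * (1 - p) ^ (card (cube_edges d) - card F))"
    by (subst sum.inter_restrict) (use finite_cube_edges in auto)
  also have "Pow (cube_edges d) \<inter> A = {F. F \<subseteq> cube_edges d \<and> F \<in> A}" by auto
  finally show ?thesis unfolding perc_prob_def by simp
qed

lemma perc_prob_markov:
  assumes p: "0 \<le> p" "p \<le> 1" and t: "t > 0" and f: "\<And>F. F \<subseteq> cube_edges d \<Longrightarrow> 0 \<le> f F"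
  shows "perc_prob d p {F. t < f F} \<le> pexp d p f / t"
proof -
  have "perc_prob d p {F. t < f F} \<le> pexp d p (\<lambda>F. 1 / t * f F)"
    unfolding perc_prob_pexp using t f by (intro pexp_mono p) (auto simp: field_simps)
  then show ?thesis by (simp only: pexp_cmult) simp
qed

lemma perc_prob_nonneg: "0 \<le> p \<Longrightarrow> p \<le> 1 \<Longrightarrow> 0 \<le> perc_prob d p A"
  unfolding perc_prob_def by (intro sum_nonneg) auto

lemma perc_prob_cover3:
  assumes p: "0 \<le> p" "p \<le> 1" and c: "\<And>F. F \<subseteq> cube_edges d \<Longrightarrow> F \<in> A \<Longrightarrow> F \<in> B \<or> F \<in> C \<or> F \<in> D"
  shows "perc_prob d p A \<le> perc_prob d p B + perc_prob d p C + perc_prob d p D"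
  unfolding perc_prob_pexp pexp_add[symmetric] using c by (intro pexp_mono p) auto

section \<open>The expected number of independent sets with no spread side\<close>

definition badcount :: "nat \<Rightarrow> nat set set set \<Rightarrow> nat" where
  "badcount d F = card {S \<in> indep_sets d F. \<not> spread (cube_nb d) (S \<inter> side d True) \<and> \<not> spread (cube_nb d) (S \<inter> side d False)}"

lemma finite_indep: "finite (indep_sets d F)"
  unfolding indep_sets_def using finite_cube by (auto intro: finite_subset[of _ "Pow (cube d)"])

lemma sum_Pow_cube:
  fixes g :: "nat set set \<Rightarrow> real"
  shows "(\<Sum>S\<in>Pow (cube d). g S) = (\<Sum>A\<in>Pow (side d True). \<Sum>B\<in>Pow (side d False). g (A \<union> B))"
proof -
  have bij: "bij_betw (\<lambda>(A, B). A \<union> B) (Pow (side d True) \<times> Pow (side d False)) (Pow (cube d))"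
  proof (rule bij_betwI[where g = "\<lambda>S. (S \<inter> side d True, S \<inter> side d False)"])
    show "(\<lambda>(A, B). A \<union> B) \<in> Pow (side d True) \<times> Pow (side d False) \<rightarrow> Pow (cube d)"
      using side_union[of d] by auto
    show "(\<lambda>S. (S \<inter> side d True, S \<inter> side d False)) \<in> Pow (cube d) \<rightarrow> Pow (side d True) \<times> Pow (side d False)" by auto
    fix x assume "x \<in> Pow (side d True) \<times> Pow (side d False)"
    then show "((case x of (A, B) \<Rightarrow> A \<union> B) \<inter> side d True, (case x of (A, B) \<Rightarrow> A \<union> B) \<inter> side d False) = x"
      using side_disjoint[of d] by auto
  next
    fix y assume "y \<in> Pow (cube d)"
    then show "(case (y \<inter> side d True, y \<inter> side d False) of (A, B) \<Rightarrow> A \<union> B) = y" using side_union[of d] by auto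
  qed
  have "(\<Sum>S\<in>Pow (cube d). g S) = (\<Sum>x\<in>Pow (side d True) \<times> Pow (side d False). g (case x of (A, B) \<Rightarrow> A \<union> B))"
    by (rule sum.reindex_bij_betw[OF bij, symmetric])
  also have "\<dots> = (\<Sum>A\<in>Pow (side d True). \<Sum>B\<in>Pow (side d False). g (A \<union> B))"
    by (simp add: sum.cartesian_product split_beta)
  finally show ?thesis .
qed

text \<open>A fixed \<open>S\<close> is independent if and only if all cube edges inside
  \<open>S\<close> are deleted, which has probability \<open>1 - p\<close> to their number.\<close>

lemma pexp_badcount:
  "pexp d p (\<lambda>F. real (badcount d F)) =
    (\<Sum>A\<in>Pow (side d True). \<Sum>B\<in>Pow (side d False). if \<not> spread (cube_nb d) A \<and> \<not> spread (cube_nb d) B then (1 - p) ^ edge_num d A B else 0)"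
proof -
  let ?b = "\<lambda>S. \<not> spread (cube_nb d) (S \<inter> side d True) \<and> \<not> spread (cube_nb d) (S \<inter> side d False)"
  have bc: "real (badcount d F) = (\<Sum>S\<in>Pow (cube d). (if ?b S then 1 else 0) * (\<Prod>e\<in>F. if e \<subseteq> S then 0 else 1))" if F: "F \<subseteq> cube_edges d" for F
  proof -
    have fF: "finite F" using F finite_cube_edges finite_subset by auto
    have "{S \<in> indep_sets d F. ?b S} = Pow (cube d) \<inter> {S. ?b S \<and> (\<forall>e\<in>F. \<not> e \<subseteq> S)}" unfolding indep_sets_def by auto
    then have "real (badcount d F) = (\<Sum>S\<in>Pow (cube d) \<inter> {S. ?b S \<and> (\<forall>e\<in>F. \<not> e \<subseteq> S)}. 1)" unfolding badcount_def by simp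
    also have "\<dots> = (\<Sum>S\<in>Pow (cube d). if S \<in> {S. ?b S \<and> (\<forall>e\<in>F. \<not> e \<subseteq> S)} then 1 else 0)"
      by (subst sum.inter_restrict) (use finite_cube in auto)
    also have "\<dots> = (\<Sum>S\<in>Pow (cube d). (if ?b S then 1 else 0) * (\<Prod>e\<in>F. if e \<subseteq> S then 0 else 1))"
    proof (rule sum.cong[OF refl])
      fix S
      show "(if S \<in> {S. ?b S \<and> (\<forall>e\<in>F. \<not> e \<subseteq> S)} then 1 else 0) = (if ?b S then 1 else (0::real)) * (\<Prod>e\<in>F. if e \<subseteq> S then 0 else 1)"
      proof (cases "\<forall>e\<in>F. \<not> e \<subseteq> S")
        case True
        then have "(\<Prod>e\<in>F. if e \<subseteq> S then 0 else (1::real)) = 1" by (intro prod.neutral) auto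
        then show ?thesis using True by auto
      next
        case False
        then have "(\<Prod>e\<in>F. if e \<subseteq> S then 0 else (1::real)) = 0" using fF by (intro prod_zero) auto
        then show ?thesis using False by auto
      qed
    qed
    finally show ?thesis .
  qed
  have "pexp d p (\<lambda>F. real (badcount d F)) = pexp d p (\<lambda>F. \<Sum>S\<in>Pow (cube d). (if ?b S then 1 else 0) * (\<Prod>e\<in>F. if e \<subseteq> S then 0 else 1))"
    unfolding pexp_def using bc by (intro sum.cong) auto
  also have "\<dots> = (\<Sum>S\<in>Pow (cube d). (if ?b S then 1 else 0) * (\<Prod>e\<in>cube_edges d. p * (if e \<subseteq> S then 0 else 1) + (1 - p)))"
    by (simp only: pexp_sum pexp_cmult pexp_prod)
  also have "\<dots> = (\<Sum>S\<in>Pow (cube d). if ?b S then (1 - p) ^ card {e \<in> cube_edges d. e \<subseteq> S} else 0)"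
  proof (rule sum.cong[OF refl])
    fix S
    have "(\<Prod>e\<in>cube_edges d. p * (if e \<subseteq> S then 0 else 1) + (1 - p)) = (\<Prod>e\<in>cube_edges d. if e \<in> {e. e \<subseteq> S} then 1 - p else 1)"
      by (intro prod.cong) auto
    also have "\<dots> = (\<Prod>e\<in>cube_edges d \<inter> {e. e \<subseteq> S}. 1 - p)" by (subst prod.inter_restrict) (use finite_cube_edges in auto)
    also have "cube_edges d \<inter> {e. e \<subseteq> S} = {e \<in> cube_edges d. e \<subseteq> S}" by auto
    finally show "(if ?b S then 1 else 0) * (\<Prod>e\<in>cube_edges d. p * (if e \<subseteq> S then 0 else 1) + (1 - p)) = (if ?b S then (1 - p) ^ card {e \<in> cube_edges d. e \<subseteq> S} else 0)"
      by simp
  qed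
  also have "\<dots> = (\<Sum>A\<in>Pow (side d True). \<Sum>B\<in>Pow (side d False). if ?b (A \<union> B) then (1 - p) ^ card {e \<in> cube_edges d. e \<subseteq> A \<union> B} else 0)"
    by (rule sum_Pow_cube)
  also have "\<dots> = (\<Sum>A\<in>Pow (side d True). \<Sum>B\<in>Pow (side d False). if \<not> spread (cube_nb d) A \<and> \<not> spread (cube_nb d) B then (1 - p) ^ edge_num d A B else 0)"
  proof (intro sum.cong refl)
    fix A B assume AB: "A \<in> Pow (side d True)" "B \<in> Pow (side d False)"
    then have "(A \<union> B) \<inter> side d True = A" "(A \<union> B) \<inter> side d False = B" using side_disjoint[of d] by auto
    then show "(if ?b (A \<union> B) then (1 - p) ^ card {e \<in> cube_edges d. e \<subseteq> A \<union> B} else 0) = (if \<not> spread (cube_nb d) A \<and> \<not> spread (cube_nb d) B then (1 - p) ^ edge_num d A B else 0)"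
      using AB by (simp add: card_edges_inside)
  qed
  finally show ?thesis .
qed

section \<open>Moments of the random vertex weights\<close>

definition vertex_weight :: "nat set set set \<Rightarrow> nat set \<Rightarrow> real" where
  "vertex_weight F v = (1/2) ^ card {e \<in> F. v \<in> e}"
definition total_weight :: "nat \<Rightarrow> bool \<Rightarrow> nat set set set \<Rightarrow> real" where
  "total_weight d b F = (\<Sum>v\<in>side d b. vertex_weight F v)"
text \<open>The diagonal \<open>u = v\<close> is included for positive \<open>d\<close>, since a
  vertex already chosen also blocks itself as an extension.\<close>

definition pair_weight :: "nat \<Rightarrow> bool \<Rightarrow> nat set set set \<Rightarrow> real" where
  "pair_weight d b F = (\<Sum>u\<in>side d b. \<Sum>v | v \<in> side d b \<and> cube_nb d u \<inter> cube_nb d v \<noteq> {}. vertex_weight F u * vertex_weight F v)"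

lemma vertex_weight_nonneg: "0 \<le> vertex_weight F v" unfolding vertex_weight_def by simp

lemma vertex_weight_prod: "finite F \<Longrightarrow> vertex_weight F v = (\<Prod>e\<in>F. if v \<in> e then 1/2 else 1)"
proof -
  assume f: "finite F"
  have "(\<Prod>e\<in>F. if v \<in> e then 1/2 else 1) = (\<Prod>e\<in>F. if e \<in> {e. v \<in> e} then 1/2 else (1::real))" by simp
  also have "\<dots> = (\<Prod>e\<in>F \<inter> {e. v \<in> e}. 1/2)" by (subst prod.inter_restrict[OF f]) simp
  also have "F \<inter> {e. v \<in> e} = {e \<in> F. v \<in> e}" by auto
  finally show ?thesis unfolding vertex_weight_def by simp
qed

lemma prod_edges_at:
  assumes "v \<in> cube d" shows "(\<Prod>e\<in>cube_edges d. if v \<in> e then c else (1::real)) = c ^ d"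
proof -
  have "(\<Prod>e\<in>cube_edges d. if v \<in> e then c else 1) = (\<Prod>e\<in>cube_edges d. if e \<in> {e. v \<in> e} then c else 1)" by simp
  also have "\<dots> = (\<Prod>e\<in>cube_edges d \<inter> {e. v \<in> e}. c)" by (subst prod.inter_restrict[OF finite_cube_edges]) simp
  also have "cube_edges d \<inter> {e. v \<in> e} = {e \<in> cube_edges d. v \<in> e}" by auto
  finally show ?thesis using card_edges_at[OF assms] by simp
qed

lemma pexp_cong: "(\<And>F. F \<subseteq> cube_edges d \<Longrightarrow> f F = g F) \<Longrightarrow> pexp d p f = pexp d p g"
  unfolding pexp_def by (intro sum.cong) auto

lemma fin_F: "F \<subseteq> cube_edges d \<Longrightarrow> finite F" using finite_cube_edges finite_subset by auto

lemma pexp_vertex_weight: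
  assumes "v \<in> cube d" shows "pexp d p (\<lambda>F. vertex_weight F v) = (1 - p / 2) ^ d"
proof -
  have "pexp d p (\<lambda>F. vertex_weight F v) = pexp d p (\<lambda>F. \<Prod>e\<in>F. if v \<in> e then 1/2 else 1)"
    by (rule pexp_cong) (simp add: vertex_weight_prod fin_F)
  also have "\<dots> = (\<Prod>e\<in>cube_edges d. if v \<in> e then 1 - p / 2 else 1)"
    unfolding pexp_prod by (intro prod.cong) auto
  finally show ?thesis using prod_edges_at[OF assms] by simp
qed

lemma pexp_vertex_weight_sq:
  assumes "v \<in> cube d" shows "pexp d p (\<lambda>F. vertex_weight F v * vertex_weight F v) = (1 - 3 * p / 4) ^ d"
proof -
  have "pexp d p (\<lambda>F. vertex_weight F v * vertex_weight F v) = pexp d p (\<lambda>F. \<Prod>e\<in>F. if v \<in> e then 1/4 else 1)"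
  proof (rule pexp_cong)
    fix F assume "F \<subseteq> cube_edges d"
    then have "vertex_weight F v * vertex_weight F v = (\<Prod>e\<in>F. (if v \<in> e then 1/2 else 1) * (if v \<in> e then 1/2 else 1))"
      by (simp only: vertex_weight_prod fin_F prod.distrib)
    also have "\<dots> = (\<Prod>e\<in>F. if v \<in> e then 1/4 else 1)" by (intro prod.cong) auto
    finally show "vertex_weight F v * vertex_weight F v = (\<Prod>e\<in>F. if v \<in> e then 1/4 else 1)" .
  qed
  also have "\<dots> = (\<Prod>e\<in>cube_edges d. if v \<in> e then 1 - 3 * p / 4 else 1)"
    unfolding pexp_prod by (intro prod.cong) auto
  finally show ?thesis using prod_edges_at[OF assms] by simp
qed

text \<open>No edge has both ends on one side, so distinct vertices of a side have independent
  weights.\<close>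

lemma pexp_vertex_weight_pair:
  assumes u: "u \<in> side d b" and v: "v \<in> side d b" and uv: "u \<noteq> v"
  shows "pexp d p (\<lambda>F. vertex_weight F u * vertex_weight F v) = ((1 - p / 2) ^ d)\<^sup>2"
proof -
  have uc: "u \<in> cube d" "v \<in> cube d" using u v unfolding side_def by auto
  have no: "\<not> (u \<in> e \<and> v \<in> e)" if e: "e \<in> cube_edges d" for e
  proof
    assume a: "u \<in> e \<and> v \<in> e"
    then have "e \<in> (\<lambda>y. {u, y}) ` cube_nb d u" using edges_at[OF uc(1)] e by blast
    then have "v \<in> cube_nb d u" using a uv by auto
    then have "v \<in> side d (\<not> b)" using cube_nb_side[OF u] by auto
    then show False using v unfolding side_def by auto
  qed
  have "pexp d p (\<lambda>F. vertex_weight F u * vertex_weight F v) = pexp d p (\<lambda>F. \<Prod>e\<in>F. (if u \<in> e then 1/2 else 1) * (if v \<in> e then 1/2 else 1))"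
    by (rule pexp_cong) (simp only: vertex_weight_prod fin_F prod.distrib)
  also have "\<dots> = (\<Prod>e\<in>cube_edges d. (if u \<in> e then 1 - p / 2 else 1) * (if v \<in> e then 1 - p / 2 else 1))"
    unfolding pexp_prod using no by (intro prod.cong) auto
  also have "\<dots> = (1 - p / 2) ^ d * (1 - p / 2) ^ d" unfolding prod.distrib using prod_edges_at uc by simp
  finally show ?thesis by (simp add: power2_eq_square)
qed

lemma card_side': "d \<ge> 1 \<Longrightarrow> real (card (side d b)) = 2 ^ d / 2"
  using card_side[of "d - 1" b] by (cases d) auto

text \<open>By independence only the diagonal contributes, at most
  \<open>N * (1 - 3 * p / 4) ^ d\<close>. With \<open>p \<ge> 2/3\<close> this is at most
  \<open>N * (1/2) ^ d = 1/2\<close>.\<close>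

lemma pexp_total_weight_var:
  assumes d: "d \<ge> 1" and p: "2/3 \<le> p" "p \<le> 1"
  shows "pexp d p (\<lambda>F. (total_weight d b F - (1/2) * (2 - p) ^ d)\<^sup>2) \<le> 1/2"
proof -
  let ?N = "real (card (side d b))" and ?a = "(1 - p / 2) ^ d" and ?s = "(1 - 3 * p / 4) ^ d"
  have sub: "v \<in> cube d" if "v \<in> side d b" for v using that unfolding side_def by auto
  have mu: "(1/2) * (2 - p) ^ d = ?N * ?a"
  proof -
    have "(2 - p) ^ d = 2 ^ d * (1 - p / 2) ^ d"
      unfolding power_mult_distrib[symmetric] by (simp add: algebra_simps)
    then show ?thesis unfolding card_side'[OF d, of b] by simp
  qed
  have e1: "pexp d p (\<lambda>F. total_weight d b F) = ?N * ?a"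
    unfolding total_weight_def pexp_sum using pexp_vertex_weight sub by simp
  have e2: "pexp d p (\<lambda>F. (total_weight d b F)\<^sup>2) \<le> ?N * ?s + ?N * ?N * ?a\<^sup>2"
  proof -
    have "pexp d p (\<lambda>F. (total_weight d b F)\<^sup>2) = (\<Sum>u\<in>side d b. \<Sum>v\<in>side d b. pexp d p (\<lambda>F. vertex_weight F u * vertex_weight F v))"
      unfolding total_weight_def power2_eq_square sum_product pexp_sum ..
    also have "\<dots> \<le> (\<Sum>u\<in>side d b. \<Sum>v\<in>side d b. (if v = u then ?s else 0) + ?a\<^sup>2)"
    proof (intro sum_mono)
      fix u v assume "u \<in> side d b" "v \<in> side d b"
      then show "pexp d p (\<lambda>F. vertex_weight F u * vertex_weight F v) \<le> (if v = u then ?s else 0) + ?a\<^sup>2"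
        using pexp_vertex_weight_sq[of u d p] pexp_vertex_weight_pair[of u d b v p] sub by auto
    qed
    also have "\<dots> = ?N * ?s + ?N * ?N * ?a\<^sup>2"
      using finite_side by (simp add: sum.distrib sum.delta algebra_simps)
    finally show ?thesis .
  qed
  have "pexp d p (\<lambda>F. (total_weight d b F - ?N * ?a)\<^sup>2) = pexp d p (\<lambda>F. (total_weight d b F)\<^sup>2 + ((- 2 * ?N * ?a) * total_weight d b F + (?N * ?a)\<^sup>2))"
    by (simp add: power2_diff algebra_simps)
  also have "\<dots> = pexp d p (\<lambda>F. (total_weight d b F)\<^sup>2) + ((- 2 * ?N * ?a) * (?N * ?a) + (?N * ?a)\<^sup>2)"
    by (simp only: pexp_add pexp_cmult pexp_const e1)
  also have "\<dots> \<le> ?N * ?s + ?N * ?N * ?a\<^sup>2 + ((- 2 * ?N * ?a) * (?N * ?a) + (?N * ?a)\<^sup>2)" using e2 by simp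
  also have "\<dots> = ?N * ?s" by (simp add: power2_eq_square algebra_simps)
  also have "\<dots> \<le> ?N * (1/2) ^ d" using p by (intro mult_left_mono power_mono) auto
  also have "\<dots> = 1/2" using card_side'[OF d, of b] by (simp add: power_one_over)
  finally show ?thesis unfolding mu .
qed

text \<open>The diagonal gives 1/2 as in the variance. There are at most
  \<open>N * d\<^sup>2\<close> pairs with a common neighbour, and the squared means contribute at
  most \<open>(4/9) ^ d\<close> each, against \<open>N \<le> 2 ^ d\<close>.\<close>

lemma pexp_pair_weight:
  assumes d: "d \<ge> 1" and p: "2/3 \<le> p" "p \<le> 1"
  shows "pexp d p (pair_weight d b) \<le> 1/2 + real d ^ 2 * (8/9) ^ d"
proof -
  obtain m where m: "d = Suc m" using d by (cases d) auto
  interpret cubical2 "side d b" "side d (\<not> b)" "cube_nb d" d using cubical2_cube[of m b] m by simp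
  let ?N = "real (card (side d b))" and ?a = "(1 - p / 2) ^ d" and ?s = "(1 - 3 * p / 4) ^ d"
  have sub: "v \<in> cube d" if "v \<in> side d b" for v using that unfolding side_def by auto
  have "pexp d p (pair_weight d b) = (\<Sum>u\<in>side d b. \<Sum>v | v \<in> side d b \<and> cube_nb d u \<inter> cube_nb d v \<noteq> {}. pexp d p (\<lambda>F. vertex_weight F u * vertex_weight F v))"
    using pexp_sum unfolding pair_weight_def by (simp only: pexp_sum)
  also have "\<dots> \<le> (\<Sum>u\<in>side d b. \<Sum>v | v \<in> side d b \<and> cube_nb d u \<inter> cube_nb d v \<noteq> {}. (if v = u then ?s else 0) + ?a\<^sup>2)"
  proof (intro sum_mono)
    fix u v assume "u \<in> side d b" "v \<in> {v. v \<in> side d b \<and> cube_nb d u \<inter> cube_nb d v \<noteq> {}}"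
    then show "pexp d p (\<lambda>F. vertex_weight F u * vertex_weight F v) \<le> (if v = u then ?s else 0) + ?a\<^sup>2"
      using pexp_vertex_weight_sq[of u d p] pexp_vertex_weight_pair[of u d b v p] sub by auto
  qed
  also have "\<dots> \<le> (\<Sum>u\<in>side d b. ?s + real d ^ 2 * ?a\<^sup>2)"
  proof (rule sum_mono)
    fix u assume u: "u \<in> side d b"
    let ?V = "{v. v \<in> side d b \<and> cube_nb d u \<inter> cube_nb d v \<noteq> {}}"
    have fV: "finite ?V" using finite_side by auto
    have s0: "0 \<le> ?s" using p by simp
    have "?V \<subseteq> n2 u" using n2_iff[OF u] by auto
    then have "card ?V \<le> card (n2 u)" by (rule card_mono[OF finite_subset[OF n2_sub[OF u] finL]])
    then have "card ?V \<le> d ^ 2" using card_n2[OF u] by linarith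
    then have "real (card ?V) \<le> real (d ^ 2)" by (rule of_nat_mono)
    then have c: "real (card ?V) * ?a\<^sup>2 \<le> real d ^ 2 * ?a\<^sup>2" by (intro mult_right_mono) auto
    have "(\<Sum>v\<in>?V. (if v = u then ?s else 0) + ?a\<^sup>2) = (\<Sum>v\<in>?V. if v = u then ?s else 0) + real (card ?V) * ?a\<^sup>2"
      by (simp add: sum.distrib)
    also have "(\<Sum>v\<in>?V. if v = u then ?s else 0) \<le> ?s" using fV s0 by (simp add: sum.delta)
    finally show "(\<Sum>v\<in>?V. (if v = u then ?s else 0) + ?a\<^sup>2) \<le> ?s + real d ^ 2 * ?a\<^sup>2" using c by simp
  qed
  also have "\<dots> = ?N * ?s + real d ^ 2 * (?N * ?a\<^sup>2)" by (simp add: algebra_simps)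
  also have "?N * ?s \<le> 1/2"
  proof -
    have "?N * ?s \<le> ?N * (1/2) ^ d" using p by (intro mult_left_mono power_mono) auto
    also have "\<dots> = 1/2" unfolding card_side'[OF d, of b] by (simp add: power_one_over)
    finally show ?thesis .
  qed
  also have "?N * ?a\<^sup>2 \<le> (8/9) ^ d"
  proof -
    have "?a\<^sup>2 \<le> ((2/3) ^ d)\<^sup>2" using p by (intro power_mono) auto
    then have "?N * ?a\<^sup>2 \<le> 2 ^ d * ((2/3) ^ d)\<^sup>2" unfolding card_side'[OF d, of b] by (intro mult_mono) auto
    also have "\<dots> = (8/9) ^ d" by (simp add: power2_eq_square power_mult_distrib[symmetric])
    finally show ?thesis .
  qed
  finally show ?thesis by (simp add: mult_left_mono)
qed

text \<open>The combination of errors that enters \<open>spread_weight_ratio\<close>, where the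
  factor 4 originates.\<close>

definition dev :: "nat \<Rightarrow> real \<Rightarrow> bool \<Rightarrow> nat set set set \<Rightarrow> real" where
  "dev d p b F = 4 * pair_weight d b F + \<bar>total_weight d b F - (1/2) * (2 - p) ^ d\<bar>"

lemma pair_weight_nonneg: "0 \<le> pair_weight d b F" unfolding pair_weight_def using vertex_weight_nonneg by (intro sum_nonneg mult_nonneg_nonneg)
lemma dev_nonneg: "0 \<le> dev d p b F" unfolding dev_def using pair_weight_nonneg[of d b F] by simp

lemma pexp_dev:
  assumes d: "d \<ge> 1" and p: "2/3 \<le> p" "p \<le> 1"
  shows "pexp d p (dev d p b) \<le> 4 + 4 * real d ^ 2 * (8/9) ^ d"
proof -
  have p0: "0 \<le> p" using p by simp
  have "pexp d p (dev d p b) \<le> pexp d p (\<lambda>F. 4 * pair_weight d b F + (1 + (total_weight d b F - (1/2) * (2 - p) ^ d)\<^sup>2))"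
  proof (rule pexp_mono[OF p0 p(2)])
    fix F
    have "\<bar>x\<bar> \<le> 1 + x\<^sup>2" for x :: real
    proof -
      have "0 \<le> (\<bar>x\<bar> - 1)\<^sup>2" by simp
      then have "2 * \<bar>x\<bar> \<le> 1 + x\<^sup>2" by (simp add: power2_diff)
      then show ?thesis by linarith
    qed
    then show "dev d p b F \<le> 4 * pair_weight d b F + (1 + (total_weight d b F - (1/2) * (2 - p) ^ d)\<^sup>2)" unfolding dev_def by simp
  qed
  also have "\<dots> = 4 * pexp d p (pair_weight d b) + (1 + pexp d p (\<lambda>F. (total_weight d b F - (1/2) * (2 - p) ^ d)\<^sup>2))"
    by (simp only: pexp_add pexp_cmult pexp_const)
  also have "\<dots> \<le> 4 + 4 * real d ^ 2 * (8/9) ^ d" using pexp_pair_weight[OF d p, of b] pexp_total_weight_var[OF d p, of b] by simp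
  finally show ?thesis .
qed

text \<open>The thresholds suit Markov's inequality. \<open>dev\<close> has bounded mean, and
  \<open>sqrt d\<close> grows but is negligible against the standard deviation of the Poisson law.
  The count of bad sets has relative mean of order \<open>exp (- d / 20)\<close>, half of whose rate
  is spent on the threshold.\<close>

definition typical :: "nat \<Rightarrow> real \<Rightarrow> nat set set set \<Rightarrow> bool" where
  "typical d p F \<longleftrightarrow> dev d p True F \<le> sqrt (real d) \<and> dev d p False F \<le> sqrt (real d) \<and>
     real (badcount d F) \<le> 2 ^ 2 ^ (d - 1) * (exp ((1/2) * (2 - p) ^ d) * exp (- real d / 40))"

lemma atypical_null:
  assumes p: "2/3 \<le> p" "p < 1"
  shows "((\<lambda>d. perc_prob d p {F. \<not> typical d p F}) \<longlongrightarrow> 0) sequentially"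
proof -
  define h where "h d = 2 * ((4 + 4 * real d ^ 2 * (8/9) ^ d) / sqrt (real d)) + (2 * (exp (2 * exp (- real d / 20)) - 1) + exp (- real d)) * exp (real d / 40)" for d
  have p': "0 \<le> p" "p \<le> 1" using p by auto
  have h0: "(h \<longlongrightarrow> 0) sequentially"
  proof -
    have "((\<lambda>d::nat. 2 * ((4 + 4 * real d ^ 2 * (8/9) ^ d) / sqrt (real d))) \<longlongrightarrow> 0) sequentially" by real_asymp
    moreover have "((\<lambda>d::nat. (2 * (exp (2 * exp (- real d / 20)) - 1) + exp (- real d)) * exp (real d / 40)) \<longlongrightarrow> 0) sequentially" by real_asymp
    ultimately have "((\<lambda>d. 2 * ((4 + 4 * real d ^ 2 * (8/9) ^ d) / sqrt (real d)) + (2 * (exp (2 * exp (- real d / 20)) - 1) + exp (- real d)) * exp (real d / 40)) \<longlongrightarrow> 0 + 0) sequentially"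
      by (rule tendsto_add)
    then show ?thesis unfolding h_def by simp
  qed
  have bound: "eventually (\<lambda>d. perc_prob d p {F. \<not> typical d p F} \<le> h d) sequentially"
    using defect_sum_cube eventually_ge_at_top[of 1]
  proof eventually_elim
    case (elim d)
    let ?mu = "(1/2) * (2 - p) ^ d"
    let ?M = "2 ^ 2 ^ (d - 1) :: real"
    have D0: "sqrt (real d) > 0" using elim(2) by simp
    have t0: "?M * (exp ?mu * exp (- real d / 40)) > 0" by simp
    have "perc_prob d p {F. \<not> typical d p F} \<le> perc_prob d p {F. sqrt (real d) < dev d p True F}
       + perc_prob d p {F. sqrt (real d) < dev d p False F} + perc_prob d p {F. ?M * (exp ?mu * exp (- real d / 40)) < real (badcount d F)}"
      by (rule perc_prob_cover3[OF p']) (auto simp: typical_def not_le)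
    also have "perc_prob d p {F. sqrt (real d) < dev d p True F} \<le> (4 + 4 * real d ^ 2 * (8/9) ^ d) / sqrt (real d)"
      by (rule order_trans[OF perc_prob_markov[OF p' D0 dev_nonneg] divide_right_mono[OF pexp_dev]]) (use elim(2) p in auto)
    also have "perc_prob d p {F. sqrt (real d) < dev d p False F} \<le> (4 + 4 * real d ^ 2 * (8/9) ^ d) / sqrt (real d)"
      by (rule order_trans[OF perc_prob_markov[OF p' D0 dev_nonneg] divide_right_mono[OF pexp_dev]]) (use elim(2) p in auto)
    also have "perc_prob d p {F. ?M * (exp ?mu * exp (- real d / 40)) < real (badcount d F)}
       \<le> (2 * (exp (2 * exp (- real d / 20)) - 1) + exp (- real d)) * exp (real d / 40)"
    proof -
      let ?x = "exp (2 * exp (- real d / 20)) - 1"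
      have mu: "2 ^ (d - 1) * ((1 + (1 - p)) / 2) ^ d = ?mu"
        using elim(2) by (cases d) (auto simp: power_divide)
      have x0: "0 \<le> ?x" by simp
      have emu: "1 \<le> exp ?mu" using p by simp
      have "pexp d p (\<lambda>F. real (badcount d F)) \<le> ?M * (2 * (exp ?mu * ?x) + exp (- real d))"
        unfolding pexp_badcount using elim(1)[rule_format, of "1 - p"] p unfolding mu by simp
      also have "\<dots> \<le> ?M * (exp ?mu * (2 * ?x + exp (- real d)))"
      proof (rule mult_left_mono)
        have "1 * exp (- real d) \<le> exp ?mu * exp (- real d)" using emu by (intro mult_right_mono) auto
        then show "2 * (exp ?mu * ?x) + exp (- real d) \<le> exp ?mu * (2 * ?x + exp (- real d))" by (simp add: algebra_simps)
      qed simp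
      finally have E: "pexp d p (\<lambda>F. real (badcount d F)) \<le> ?M * (exp ?mu * (2 * ?x + exp (- real d)))" .
      have "perc_prob d p {F. ?M * (exp ?mu * exp (- real d / 40)) < real (badcount d F)}
        \<le> pexp d p (\<lambda>F. real (badcount d F)) / (?M * (exp ?mu * exp (- real d / 40)))"
        by (rule perc_prob_markov[OF p' t0]) simp
      also have "\<dots> \<le> ?M * (exp ?mu * (2 * ?x + exp (- real d))) / (?M * (exp ?mu * exp (- real d / 40)))"
        using E t0 by (intro divide_right_mono) auto
      also have "\<dots> = (2 * ?x + exp (- real d)) * exp (real d / 40)"
        by (simp add: exp_minus divide_simps)
      finally show ?thesis .
    qed
    finally show ?case unfolding h_def by simp
  qed
  show ?thesis
    by (rule tendsto_sandwich[OF _ bound tendsto_const h0]) (simp add: perc_prob_nonneg p')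
qed

section \<open>Spread sets and their weights\<close>

definition spreads :: "nat \<Rightarrow> bool \<Rightarrow> nat \<Rightarrow> nat set set set" where
  "spreads d b k = {A. A \<subseteq> side d b \<and> spread (cube_nb d) A \<and> card A = k}"
definition set_weight :: "nat set set set \<Rightarrow> nat set set \<Rightarrow> real" where
  "set_weight F A = (\<Prod>v\<in>A. vertex_weight F v)"
text \<open>An elementary symmetric sum of the vertex weights, restricted to spread sets. Times
  \<open>2 ^ N\<close> it counts the independent sets whose side \<open>b\<close> is spread with
  \<open>k\<close> vertices, see \<open>card_spread_class\<close>.\<close>

definition spread_weight :: "nat \<Rightarrow> bool \<Rightarrow> nat set set set \<Rightarrow> nat \<Rightarrow> real" where
  "spread_weight d b F k = (\<Sum>A\<in>spreads d b k. set_weight F A)"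

lemma set_weight_nonneg: "0 \<le> set_weight F A" unfolding set_weight_def using vertex_weight_nonneg by (intro prod_nonneg) auto
lemma spread_weight_nonneg: "0 \<le> spread_weight d b F k" unfolding spread_weight_def using set_weight_nonneg by (intro sum_nonneg) auto
lemma finite_spreads: "finite (spreads d b k)"
  unfolding spreads_def using finite_side by (auto intro: finite_subset[of _ "Pow (side d b)"])
lemma spread_subset: "spread nb A \<Longrightarrow> B \<subseteq> A \<Longrightarrow> spread nb B" unfolding spread_def by blast

lemma spread_weight_0: "spread_weight d b F 0 = 1"
proof -
  have "spreads d b 0 = {{}}"
    unfolding spreads_def using finite_subset[OF _ finite_side] by (auto simp: spread_def card_eq_0_iff)
  then show ?thesis unfolding spread_weight_def set_weight_def by simp
qed

lemma spread_weight_large: "card (side d b) < k \<Longrightarrow> spread_weight d b F k = 0"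
proof -
  assume k: "card (side d b) < k"
  have "A \<notin> spreads d b k" for A using card_mono[OF finite_side[of d b], of A] k unfolding spreads_def by auto
  then have "spreads d b k = {}" by blast
  then show ?thesis unfolding spread_weight_def by simp
qed

lemma set_weight_remove:
  assumes "finite A" "u \<in> A" shows "set_weight F A = set_weight F (A - {u}) * vertex_weight F u"
  unfolding set_weight_def using prod.remove[OF assms, of "vertex_weight F"] by (simp only: mult.commute)

section \<open>Recursions for the spread weights\<close>

definition extenders :: "nat \<Rightarrow> bool \<Rightarrow> nat set set \<Rightarrow> nat set set" where
  "extenders d b A = {u \<in> side d b. u \<notin> A \<and> spread (cube_nb d) (insert u A)}"

text \<open>Double counting of pairs of a spread set and one of its elements, by the set that
  remains when the element is removed.\<close>

lemma spreads_remove_one: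
  fixes g :: "nat set set \<Rightarrow> nat set \<Rightarrow> real"
  shows "(\<Sum>A\<in>spreads d b (k + 1). \<Sum>u\<in>A. g (A - {u}) u) = (\<Sum>A\<in>spreads d b k. \<Sum>u\<in>extenders d b A. g A u)"
proof -
  have fA: "finite A" if "A \<in> spreads d b j" for A j using that finite_subset[OF _ finite_side] unfolding spreads_def by auto
  have fe: "finite (extenders d b A)" for A unfolding extenders_def using finite_side by auto
  have "(\<Sum>A\<in>spreads d b (k + 1). \<Sum>u\<in>A. g (A - {u}) u) = (\<Sum>(A, u)\<in>(SIGMA A:spreads d b (k + 1). A). g (A - {u}) u)"
    using finite_spreads fA by (subst sum.Sigma) auto
  also have "\<dots> = (\<Sum>(A, u)\<in>(SIGMA A:spreads d b k. extenders d b A). g A u)"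
  proof (rule sum.reindex_bij_witness[where j = "\<lambda>(A, u). (A - {u}, u)" and i = "\<lambda>(A, u). (insert u A, u)"])
    fix x assume x: "x \<in> (SIGMA A:spreads d b (k + 1). A)"
    then obtain A u where Au: "x = (A, u)" "A \<in> spreads d b (k + 1)" "u \<in> A" by auto
    show "(case (case x of (A, u) \<Rightarrow> (A - {u}, u)) of (A, u) \<Rightarrow> (insert u A, u)) = x" using Au by auto
    have "A - {u} \<in> spreads d b k"
      using Au fA[OF Au(2)] spread_subset[of "cube_nb d" A "A - {u}"] unfolding spreads_def by (auto simp: card_Diff_singleton)
    moreover have "u \<in> extenders d b (A - {u})" using Au unfolding extenders_def spreads_def by (auto simp: insert_absorb)
    ultimately show "(case x of (A, u) \<Rightarrow> (A - {u}, u)) \<in> (SIGMA A:spreads d b k. extenders d b A)" using Au by auto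
    show "(case case x of (A, u) \<Rightarrow> (A - {u}, u) of (A, u) \<Rightarrow> g A u) = (case x of (A, u) \<Rightarrow> g (A - {u}) u)" using Au by simp
  next
    fix y assume y: "y \<in> (SIGMA A:spreads d b k. extenders d b A)"
    then obtain A u where Au: "y = (A, u)" "A \<in> spreads d b k" "u \<in> extenders d b A" by auto
    have un: "u \<notin> A" using Au unfolding extenders_def by auto
    show "(case (case y of (A, u) \<Rightarrow> (insert u A, u)) of (A, u) \<Rightarrow> (A - {u}, u)) = y" using Au un by auto
    have "insert u A \<in> spreads d b (k + 1)" using Au un fA[OF Au(2)] unfolding extenders_def spreads_def by auto
    then show "(case y of (A, u) \<Rightarrow> (insert u A, u)) \<in> (SIGMA A:spreads d b (k + 1). A)" using Au by auto
  qed
  also have "\<dots> = (\<Sum>A\<in>spreads d b k. \<Sum>u\<in>extenders d b A. g A u)" using finite_spreads fe by (subst sum.Sigma) auto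
  finally show ?thesis .
qed

lemma spread_weight_Suc: "real (k + 1) * spread_weight d b F (k + 1) = (\<Sum>A\<in>spreads d b k. set_weight F A * (\<Sum>u\<in>extenders d b A. vertex_weight F u))"
proof -
  have "real (k + 1) * spread_weight d b F (k + 1) = (\<Sum>A\<in>spreads d b (k + 1). \<Sum>u\<in>A. set_weight F (A - {u}) * vertex_weight F u)"
    unfolding spread_weight_def sum_distrib_left
  proof (rule sum.cong[OF refl])
    fix A assume A: "A \<in> spreads d b (k + 1)"
    then have fA: "finite A" "card A = k + 1" using finite_subset[OF _ finite_side] unfolding spreads_def by auto
    have "(\<Sum>u\<in>A. set_weight F (A - {u}) * vertex_weight F u) = (\<Sum>u\<in>A. set_weight F A)"
      by (intro sum.cong refl) (simp only: set_weight_remove[OF fA(1)])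
    then show "real (k + 1) * set_weight F A = (\<Sum>u\<in>A. set_weight F (A - {u}) * vertex_weight F u)" using fA by simp
  qed
  also have "\<dots> = (\<Sum>A\<in>spreads d b k. \<Sum>u\<in>extenders d b A. set_weight F A * vertex_weight F u)" by (rule spreads_remove_one)
  finally show ?thesis by (simp add: sum_distrib_left)
qed

lemma spread_weight_upper: "real (k + 1) * spread_weight d b F (k + 1) \<le> total_weight d b F * spread_weight d b F k"
proof -
  have "real (k + 1) * spread_weight d b F (k + 1) \<le> (\<Sum>A\<in>spreads d b k. set_weight F A * total_weight d b F)"
    unfolding spread_weight_Suc total_weight_def
    by (intro sum_mono mult_left_mono sum_mono2) (auto simp: finite_side extenders_def vertex_weight_nonneg set_weight_nonneg)
  then show ?thesis unfolding spread_weight_def by (simp add: sum_distrib_left mult.commute)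
qed

definition near_weight :: "nat \<Rightarrow> bool \<Rightarrow> nat set set set \<Rightarrow> nat set \<Rightarrow> real" where
  "near_weight d b F u = (\<Sum>v | v \<in> side d b \<and> cube_nb d u \<inter> cube_nb d v \<noteq> {}. vertex_weight F v)"

lemma near_weight_nonneg: "0 \<le> near_weight d b F u" unfolding near_weight_def using vertex_weight_nonneg by (intro sum_nonneg)
lemma pair_weight_near_weight: "pair_weight d b F = (\<Sum>u\<in>side d b. vertex_weight F u * near_weight d b F u)"
  unfolding pair_weight_def near_weight_def by (simp add: sum_distrib_left)

text \<open>A vertex that cannot extend \<open>A\<close> shares a neighbour with some
  \<open>u\<close> in \<open>A\<close>; this covers the vertices of \<open>A\<close> itself, as
  \<open>d \<ge> 1\<close>.\<close>

lemma extenders_weight_lower: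
  assumes d: "d \<ge> 1" and A: "A \<in> spreads d b k"
  shows "total_weight d b F - (\<Sum>u\<in>A. near_weight d b F u) \<le> (\<Sum>u\<in>extenders d b A. vertex_weight F u)"
proof -
  have AL: "A \<subseteq> side d b" "spread (cube_nb d) A" using A unfolding spreads_def by auto
  have fA: "finite A" using AL finite_subset[OF _ finite_side] by auto
  let ?near = "\<lambda>u. {v \<in> side d b. cube_nb d u \<inter> cube_nb d v \<noteq> {}}"
  have fn: "finite (?near u)" for u using finite_side by auto
  have ne: "cube_nb d v \<noteq> {}" for v using card_cube_nb[of d v] d by auto
  have "side d b \<subseteq> extenders d b A \<union> (\<Union>u\<in>A. ?near u)"
  proof
    fix v assume v: "v \<in> side d b"
    show "v \<in> extenders d b A \<union> (\<Union>u\<in>A. ?near u)"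
    proof (cases "\<exists>u\<in>A. cube_nb d u \<inter> cube_nb d v \<noteq> {}")
      case True
      then show ?thesis using v by auto
    next
      case False
      then have "v \<notin> A" using ne[of v] by auto
      moreover have "spread (cube_nb d) (insert v A)" using False AL(2) unfolding spread_def by (auto simp: Int_commute)
      ultimately show ?thesis using v unfolding extenders_def by auto
    qed
  qed
  then have "total_weight d b F \<le> (\<Sum>v\<in>extenders d b A \<union> (\<Union>u\<in>A. ?near u). vertex_weight F v)"
    unfolding total_weight_def using fA fn vertex_weight_nonneg finite_side by (intro sum_mono2) (auto simp: extenders_def)
  also have "\<dots> \<le> (\<Sum>v\<in>extenders d b A. vertex_weight F v) + (\<Sum>v\<in>(\<Union>u\<in>A. ?near u). vertex_weight F v)"
    using fA fn finite_side vertex_weight_nonneg by (simp add: sum_Un extenders_def sum_nonneg)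
  also have "(\<Sum>v\<in>(\<Union>u\<in>A. ?near u). vertex_weight F v) \<le> (\<Sum>u\<in>A. near_weight d b F u)"
    unfolding near_weight_def using fA fn vertex_weight_nonneg by (intro sum_UN_le) auto
  finally show ?thesis by simp
qed

text \<open>The weight blocked by \<open>A\<close> is a sum over \<open>u\<close> in
  \<open>A\<close>. Detaching \<open>u\<close> and letting it range over the whole side turns the
  total loss into \<open>pair_weight\<close> times the spread weight two levels below.\<close>

lemma spread_weight_lower:
  assumes d: "d \<ge> 1"
  shows "total_weight d b F * spread_weight d b F (k + 1) - pair_weight d b F * spread_weight d b F k \<le> real (k + 2) * spread_weight d b F (k + 2)"
proof -
  have "(\<Sum>A\<in>spreads d b (k + 1). set_weight F A * (\<Sum>u\<in>A. near_weight d b F u))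
     = (\<Sum>A\<in>spreads d b (k + 1). \<Sum>u\<in>A. set_weight F (A - {u}) * (vertex_weight F u * near_weight d b F u))"
  proof (rule sum.cong[OF refl])
    fix A assume A: "A \<in> spreads d b (k + 1)"
    then have fA: "finite A" using finite_subset[OF _ finite_side] unfolding spreads_def by auto
    show "set_weight F A * (\<Sum>u\<in>A. near_weight d b F u) = (\<Sum>u\<in>A. set_weight F (A - {u}) * (vertex_weight F u * near_weight d b F u))"
      unfolding sum_distrib_left by (intro sum.cong refl) (simp only: set_weight_remove[OF fA] mult.assoc)
  qed
  also have "\<dots> = (\<Sum>A\<in>spreads d b k. \<Sum>u\<in>extenders d b A. set_weight F A * (vertex_weight F u * near_weight d b F u))" by (rule spreads_remove_one)
  also have "\<dots> \<le> (\<Sum>A\<in>spreads d b k. \<Sum>u\<in>side d b. set_weight F A * (vertex_weight F u * near_weight d b F u))"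
    using finite_side vertex_weight_nonneg set_weight_nonneg near_weight_nonneg by (intro sum_mono sum_mono2) (auto simp: extenders_def)
  also have "\<dots> = pair_weight d b F * spread_weight d b F k"
    unfolding pair_weight_near_weight spread_weight_def sum_product by (subst sum.swap) (intro sum.cong refl, simp add: mult_ac)
  finally have 1: "(\<Sum>A\<in>spreads d b (k + 1). set_weight F A * (\<Sum>u\<in>A. near_weight d b F u)) \<le> pair_weight d b F * spread_weight d b F k" .
  have "total_weight d b F * spread_weight d b F (k + 1) - (\<Sum>A\<in>spreads d b (k + 1). set_weight F A * (\<Sum>u\<in>A. near_weight d b F u))
    = (\<Sum>A\<in>spreads d b (k + 1). set_weight F A * (total_weight d b F - (\<Sum>u\<in>A. near_weight d b F u)))"
    unfolding spread_weight_def by (simp add: sum_distrib_left sum_subtractf right_diff_distrib mult_ac)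
  also have "\<dots> \<le> (\<Sum>A\<in>spreads d b (k + 1). set_weight F A * (\<Sum>u\<in>extenders d b A. vertex_weight F u))"
    using extenders_weight_lower[OF d] set_weight_nonneg by (intro sum_mono mult_left_mono) auto
  also have "\<dots> = real (k + 2) * spread_weight d b F (k + 2)" using spread_weight_Suc[of "k + 1" d b F] by (simp add: add_ac)
  finally show ?thesis using 1 by linarith
qed

text \<open>The lower recursion spans two levels, so its error must be expressed in
  \<open>spread_weight\<close> at \<open>k + 1\<close>. The induction hypothesis does this: for
  \<open>k \<le> 2 * lam\<close> it yields a ratio of at most
  \<open>2 * lam / (lam / 2) = 4\<close>.\<close>

lemma spread_weight_ratio:
  fixes lam kap :: real
  assumes d: "d \<ge> 1" and lam: "lam > 0" and kap: "kap \<le> lam / 2"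
    and dev: "4 * pair_weight d b F + \<bar>total_weight d b F - lam\<bar> \<le> kap"
  shows "real k \<le> 2 * lam \<Longrightarrow> (lam - kap) * spread_weight d b F k \<le> real (k + 1) * spread_weight d b F (k + 1)"
proof (induction k)
  let ?f = "spread_weight d b F"
  have V0: "0 \<le> pair_weight d b F" by (rule pair_weight_nonneg)
  {
    case 0
    have "spreads d b 0 = {{}}"
      unfolding spreads_def using finite_subset[OF _ finite_side] by (auto simp: spread_def card_eq_0_iff)
    moreover have "extenders d b {} = side d b" unfolding extenders_def spread_def by auto
    ultimately have "real (0 + 1) * ?f (0 + 1) = total_weight d b F" unfolding spread_weight_Suc total_weight_def by (simp add: set_weight_def)
    then show ?case using dev V0 by (simp add: spread_weight_0)
  next
    case (Suc k)
    have f0: "0 \<le> ?f k" "0 \<le> ?f (k + 1)" by (rule spread_weight_nonneg)+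
    have "lam / 2 * ?f k \<le> (lam - kap) * ?f k" using kap f0 by (intro mult_right_mono) auto
    also have "\<dots> \<le> real (k + 1) * ?f (k + 1)" using Suc by simp
    also have "\<dots> \<le> 2 * lam * ?f (k + 1)" using Suc.prems f0 by (intro mult_right_mono) auto
    finally have "lam / 2 * ?f k \<le> lam / 2 * (4 * ?f (k + 1))" by simp
    then have "?f k \<le> 4 * ?f (k + 1)" using lam by simp
    then have "pair_weight d b F * ?f k \<le> pair_weight d b F * (4 * ?f (k + 1))" using V0 by (intro mult_left_mono) auto
    moreover have "(lam - kap) * ?f (k + 1) \<le> (total_weight d b F - 4 * pair_weight d b F) * ?f (k + 1)"
      using dev f0 by (intro mult_right_mono) auto
    ultimately have "(lam - kap) * ?f (k + 1) \<le> real (k + 2) * ?f (k + 2)"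
      using spread_weight_lower[OF d, of b F k] by (simp add: algebra_simps)
    then show ?case by simp
  }
qed

section \<open>Counting independent sets by their spread side\<close>

definition Fnbs :: "nat \<Rightarrow> nat set set set \<Rightarrow> nat set set \<Rightarrow> nat set set" where
  "Fnbs d F A = (\<Union>v\<in>A. {y \<in> cube_nb d v. {v, y} \<in> F})"

text \<open>The other side may be any set avoiding the retained neighbourhoods of \<open>A\<close>.
  These are disjoint as \<open>A\<close> is spread, so the number of forbidden vertices is the sum
  of the degrees.\<close>

lemma card_spread_indep:
  assumes F: "F \<subseteq> cube_edges d" and A: "A \<subseteq> side d b" "spread (cube_nb d) A"
  shows "real (card {S \<in> indep_sets d F. S \<inter> side d b = A}) = 2 ^ card (side d (\<not> b)) * set_weight F A"
proof -
  have fA: "finite A" using A finite_subset[OF _ finite_side] by auto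
  have fF: "finite F" using F finite_cube_edges finite_subset by auto
  have un: "side d b \<union> side d (\<not> b) = cube d" "side d b \<inter> side d (\<not> b) = {}" unfolding side_def by auto
  let ?Q = "Fnbs d F A"
  have QR: "?Q \<subseteq> side d (\<not> b)" unfolding Fnbs_def using cube_nb_side A by blast
  have degs: "card {y \<in> cube_nb d v. {v, y} \<in> F} = card {e \<in> F. v \<in> e}" if v: "v \<in> A" for v
  proof -
    have vc: "v \<in> cube d" using v A unfolding side_def by auto
    have "{e \<in> F. v \<in> e} = (\<lambda>y. {v, y}) ` {y \<in> cube_nb d v. {v, y} \<in> F}"
    proof -
      have "{e \<in> F. v \<in> e} = F \<inter> {e \<in> cube_edges d. v \<in> e}" using F by auto
      also have "\<dots> = F \<inter> (\<lambda>y. {v, y}) ` cube_nb d v" by (simp only: edges_at[OF vc])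
      finally show ?thesis by auto
    qed
    moreover have "v \<notin> cube_nb d v" unfolding cube_nb_def flip_def by auto
    then have "inj_on (\<lambda>y. {v, y}) {y \<in> cube_nb d v. {v, y} \<in> F}" by (auto intro!: inj_onI simp: doubleton_eq_iff)
    ultimately show ?thesis by (simp add: card_image)
  qed
  have "card ?Q = (\<Sum>v\<in>A. card {y \<in> cube_nb d v. {v, y} \<in> F})"
    unfolding Fnbs_def
  proof (rule card_UN_disjoint[OF fA])
    show "\<forall>i\<in>A. finite {y \<in> cube_nb d i. {i, y} \<in> F}" unfolding cube_nb_def by auto
    show "\<forall>i\<in>A. \<forall>j\<in>A. i \<noteq> j \<longrightarrow> {y \<in> cube_nb d i. {i, y} \<in> F} \<inter> {y \<in> cube_nb d j. {j, y} \<in> F} = {}"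
      using A(2) unfolding spread_def by blast
  qed
  then have cQ: "card ?Q = (\<Sum>v\<in>A. card {e \<in> F. v \<in> e})" using degs by simp
  have "{S \<in> indep_sets d F. S \<inter> side d b = A} = (\<lambda>B. A \<union> B) ` Pow (side d (\<not> b) - ?Q)"
  proof
    show "{S \<in> indep_sets d F. S \<inter> side d b = A} \<subseteq> (\<lambda>B. A \<union> B) ` Pow (side d (\<not> b) - ?Q)"
    proof
      fix S assume "S \<in> {S \<in> indep_sets d F. S \<inter> side d b = A}"
      then have S: "S \<subseteq> cube d" "\<forall>e\<in>F. \<not> e \<subseteq> S" "S \<inter> side d b = A" unfolding indep_sets_def by auto
      have "S = A \<union> (S \<inter> side d (\<not> b))" using S un by auto
      moreover have "S \<inter> side d (\<not> b) \<inter> ?Q = {}"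
      proof -
        have False if "y \<in> S" "v \<in> A" "{v, y} \<in> F" for y v
        proof -
          have "{v, y} \<subseteq> S" using that S(3) by auto
          then show False using S(2) that by blast
        qed
        then show ?thesis unfolding Fnbs_def by blast
      qed
      ultimately show "S \<in> (\<lambda>B. A \<union> B) ` Pow (side d (\<not> b) - ?Q)"
        by (intro image_eqI[of _ _ "S \<inter> side d (\<not> b)"]) auto
    qed
    show "(\<lambda>B. A \<union> B) ` Pow (side d (\<not> b) - ?Q) \<subseteq> {S \<in> indep_sets d F. S \<inter> side d b = A}"
    proof
      fix S assume "S \<in> (\<lambda>B. A \<union> B) ` Pow (side d (\<not> b) - ?Q)"
      then obtain B where B: "B \<subseteq> side d (\<not> b) - ?Q" "S = A \<union> B" by auto
      have "\<not> e \<subseteq> S" if e: "e \<in> F" for e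
      proof
        assume eS: "e \<subseteq> S"
        obtain y x where yx: "y \<in> side d False" "x \<in> cube_nb d y" "e = {x, y}" using e F unfolding cube_edges_eq by blast
        have xT: "x \<in> side d True" using cube_nb_side[OF yx(1)] yx(2) by auto
        obtain v w where vertex_weight: "v \<in> side d b" "w \<in> side d (\<not> b)" "w \<in> cube_nb d v" "e = {v, w}"
        proof (cases b)
          case True
          then show ?thesis using that[of x y] xT yx cube_nb_sym[of x d y] by auto
        next
          case False
          then show ?thesis using that[of y x] xT yx by auto
        qed
        have "v \<in> A" using vertex_weight eS B un(2) by auto
        moreover have "w \<in> B" using vertex_weight eS B A un(2) by auto
        ultimately show False using B(1) vertex_weight e unfolding Fnbs_def by blast
      qed
      moreover have "S \<subseteq> cube d" using B A un by auto
      moreover have "S \<inter> side d b = A" using B A un by auto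
      ultimately show "S \<in> {S \<in> indep_sets d F. S \<inter> side d b = A}" unfolding indep_sets_def by auto
    qed
  qed
  moreover have "inj_on (\<lambda>B. A \<union> B) (Pow (side d (\<not> b) - ?Q))"
  proof (rule inj_onI)
    fix B C assume "B \<in> Pow (side d (\<not> b) - ?Q)" "C \<in> Pow (side d (\<not> b) - ?Q)" "A \<union> B = A \<union> C"
    then show "B = C" using A(1) un(2) by blast
  qed
  ultimately have ce: "card {S \<in> indep_sets d F. S \<inter> side d b = A} = 2 ^ (card (side d (\<not> b)) - card ?Q)"
    using QR finite_side by (simp add: card_image card_Pow card_Diff_subset finite_subset)
  have le: "card ?Q \<le> card (side d (\<not> b))" using QR finite_side by (intro card_mono)
  have "real (card {S \<in> indep_sets d F. S \<inter> side d b = A}) = 2 ^ (card (side d (\<not> b)) - card ?Q)" unfolding ce by simp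
  also have "(2::real) ^ (card (side d (\<not> b)) - card ?Q) = 2 ^ card (side d (\<not> b)) * (1/2) ^ card ?Q"
    using le by (simp add: power_diff power_one_over)
  also have "(1/2::real) ^ card ?Q = set_weight F A" unfolding cQ set_weight_def vertex_weight_def by (rule power_sum)
  finally show ?thesis .
qed

lemma card_spread_class:
  assumes F: "F \<subseteq> cube_edges d" and n: "card (side d b) \<le> n"
  shows "real (card {S \<in> indep_sets d F. spread (cube_nb d) (S \<inter> side d b) \<and> card (S \<inter> side d b) \<in> K})
     = 2 ^ card (side d (\<not> b)) * (\<Sum>k\<in>K \<inter> {..n}. spread_weight d b F k)"
proof -
  let ?I = "indep_sets d F"
  have un: "{S \<in> ?I. spread (cube_nb d) (S \<inter> side d b) \<and> card (S \<inter> side d b) \<in> K}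
     = (\<Union>A\<in>(\<Union>k\<in>K \<inter> {..n}. spreads d b k). {S \<in> ?I. S \<inter> side d b = A})" (is "?X = ?Y")
  proof -
    have c: "card (S \<inter> side d b) \<le> n" for S using card_mono[OF finite_side, of "S \<inter> side d b" d b] n by auto
    show ?thesis using c unfolding spreads_def by auto
  qed
  have fin: "finite (\<Union>k\<in>K \<inter> {..n}. spreads d b k)" using finite_spreads by auto
  have "real (card ?Y) = (\<Sum>A\<in>(\<Union>k\<in>K \<inter> {..n}. spreads d b k). real (card {S \<in> ?I. S \<inter> side d b = A}))"
    using fin finite_indep by (subst card_UN_disjoint) auto
  also have "\<dots> = (\<Sum>A\<in>(\<Union>k\<in>K \<inter> {..n}. spreads d b k). 2 ^ card (side d (\<not> b)) * set_weight F A)"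
    using card_spread_indep[OF F] by (intro sum.cong) (auto simp: spreads_def)
  also have "\<dots> = (\<Sum>k\<in>K \<inter> {..n}. \<Sum>A\<in>spreads d b k. 2 ^ card (side d (\<not> b)) * set_weight F A)"
    using finite_spreads by (intro sum.UNION_disjoint) (auto simp: spreads_def)
  finally show ?thesis unfolding un spread_weight_def by (simp add: sum_distrib_left)
qed

text \<open>Disjoint neighbourhoods of size \<open>d\<close> must fit into the other side. So a
  spread side is the smaller one unless both sides have at most \<open>N / d\<close>
  vertices.\<close>

lemma card_spread_le:
  assumes d: "d \<ge> 1" and A: "A \<subseteq> side d b" "spread (cube_nb d) A"
  shows "d * card A \<le> 2 ^ (d - 1)"
proof -
  have fA: "finite A" using A finite_subset[OF _ finite_side] by auto
  have "card (\<Union>v\<in>A. cube_nb d v) = (\<Sum>v\<in>A. card (cube_nb d v))"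
    using A(2) fA unfolding spread_def by (intro card_UN_disjoint) (auto simp: cube_nb_def)
  then have "d * card A = card (\<Union>v\<in>A. cube_nb d v)" by (simp add: card_cube_nb)
  also have "\<dots> \<le> card (side d (\<not> b))" using cube_nb_side A finite_side by (intro card_mono) auto
  also have "\<dots> = 2 ^ (d - 1)" using card_side[of "d - 1" "\<not> b"] d by simp
  finally show ?thesis .
qed

definition smalls :: "nat \<Rightarrow> nat set set set" where
  "smalls d = {S. S \<subseteq> cube d \<and> d * card (S \<inter> side d True) \<le> 2 ^ (d - 1) \<and> d * card (S \<inter> side d False) \<le> 2 ^ (d - 1)}"

lemma card_smalls:
  assumes d: "d \<ge> 1"
  shows "real (card (smalls d)) \<le> exp (2 * (2 ^ (d - 1) / real d * (ln (real d) + 1)))"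
proof -
  let ?N = "2 ^ (d - 1) :: real"
  let ?P = "\<lambda>b. {A. A \<subseteq> side d b \<and> real (card A) \<le> ?N / real d}"
  have D0: "real d \<ge> 1" using d by simp
  have cP: "real (card (?P b)) \<le> exp (?N / real d * (ln (real d) + 1))" for b
  proof -
    have "real (card (?P b)) \<le> exp (?N / real d * ln (1 / (1 / real d)) + 1 / real d * card (side d b))"
      using D0 finite_side by (intro card_small_subsets_le) auto
    also have "\<dots> = exp (?N / real d * (ln (real d) + 1))"
    proof -
      have "real (card (side d b)) = ?N" using card_side[of "d - 1" b] d by simp
      then show ?thesis using D0 by (simp add: field_simps)
    qed
    finally show ?thesis .
  qed
  have fP: "finite (?P b)" for b using finite_side by (auto intro: finite_subset[of _ "Pow (side d b)"])
  have "smalls d \<subseteq> (\<lambda>(A, B). A \<union> B) ` (?P True \<times> ?P False)"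
  proof
    fix S assume S: "S \<in> smalls d"
    have conv: "real n \<le> ?N / real d" if "d * n \<le> 2 ^ (d - 1)" for n
    proof -
      have "real (d * n) \<le> real (2 ^ (d - 1))" using that by (rule of_nat_mono)
      then show ?thesis using D0 by (simp add: divide_simps mult_ac)
    qed
    have "S = (S \<inter> side d True) \<union> (S \<inter> side d False)" using S side_union[of d] unfolding smalls_def by auto
    then show "S \<in> (\<lambda>(A, B). A \<union> B) ` (?P True \<times> ?P False)"
      using S conv unfolding smalls_def by (intro image_eqI[of _ _ "(S \<inter> side d True, S \<inter> side d False)"]) auto
  qed
  then have "card (smalls d) \<le> card (?P True \<times> ?P False)"
    using fP by (meson card_image_le card_mono finite_SigmaI finite_imageI le_trans)
  then have "real (card (smalls d)) \<le> real (card (?P True \<times> ?P False))" by (rule of_nat_mono)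
  also have "\<dots> = real (card (?P True)) * real (card (?P False))" by (simp only: card_cartesian_product of_nat_mult)
  also have "\<dots> \<le> exp (?N / real d * (ln (real d) + 1)) * exp (?N / real d * (ln (real d) + 1))"
    using cP by (intro mult_mono) auto
  finally show ?thesis by (simp only: mult_exp_exp mult_2)
qed

section \<open>Comparison with a Poisson distribution\<close>

lemma measure_pmf_sums_nat:
  "(\<lambda>k. if k \<in> A then pmf p k else 0) sums measure_pmf.prob p (A :: nat set)"
  unfolding measure_pmf_conv_infsetsum by (rule sums_infsetsum_nat) (rule pmf_abs_summable)

lemma exp_weight_sums: "(\<lambda>k. lam ^ k / fact k * exp (s * real k)) sums exp (lam * exp (s::real))"
proof -
  have "(\<lambda>k. (lam * exp s) ^ k /\<^sub>R fact k) sums exp (lam * exp s)" by (rule exp_converges)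
  moreover have "(lam * exp s) ^ k /\<^sub>R fact k = lam ^ k / fact k * exp (s * real k)" for k
    by (simp add: power_mult_distrib exp_of_nat2_mult divide_inverse mult_ac)
  ultimately show ?thesis by (simp only:)
qed

text \<open>Convexity of \<open>exp\<close> between 0 and \<open>s * x\<close>. It trades a small
  rate \<open>t\<close> for a linear factor \<open>t / s\<close>.\<close>

lemma exp_scaled_minus_one:
  fixes t s x :: real
  assumes "0 \<le> t" "t \<le> s" "0 < s" "0 \<le> x"
  shows "exp (t * x) - 1 \<le> t / s * (exp (s * x) - 1)"
proof -
  have "exp ((1 - t / s) *\<^sub>R 0 + (t / s) *\<^sub>R (s * x)) \<le> (1 - t / s) * exp 0 + t / s * exp (s * x)"
    by (rule convex_onD[OF exp_convex]) (use assms in auto)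
  then show ?thesis using assms by (simp add: algebra_simps)
qed

text \<open>
  By the recursion the ratio of \<open>f k\<close> to \<open>lam ^ k / fact k\<close> changes by a factor \<open>exp (\<plusminus> 2 kap / lam)\<close> per step, so it is
  almost constant within \<open>O(sqrt lam)\<close> of the mean.
\<close>

lemma poisson_comparison:
  fixes f :: "nat \<Rightarrow> real" and lam kap :: real
  assumes lam: "lam \<ge> 1" and kap: "0 \<le> kap" "2 * kap \<le> sqrt lam"
    and f0: "f 0 = 1" and fnn: "\<And>k. 0 \<le> f k" and fin: "\<And>k. n < k \<Longrightarrow> f k = 0"
    and lo: "\<And>k. real k \<le> 2 * lam \<Longrightarrow> (lam - kap) * f k \<le> real (k + 1) * f (k + 1)"
    and up: "\<And>k. real (k + 1) * f (k + 1) \<le> (lam + kap) * f k"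
    and del: "del = (30 * kap + 3) / sqrt lam" "del \<le> 1/2"
  shows "\<bar>(\<Sum>k\<in>A \<inter> {..n}. f k) - (\<Sum>k\<le>n. f k) * measure_pmf.prob (poisson_pmf lam) A\<bar> \<le> 4 * del * (\<Sum>k\<le>n. f k)"
    and "exp lam * exp (- 2 * kap) / 2 \<le> (\<Sum>k\<le>n. f k)"
proof -
  define s where "s = 1 / sqrt lam"
  define th where "th = 2 * kap / lam"
  define a where "a k = lam ^ k / fact k" for k
  define r where "r k = f k / a k" for k
  \<comment> \<open>The ratios are compared with the one at the mean. From 0 they would drift by a
    factor as large as \<open>exp (2 * kap)\<close>, but over the typical range
    \<open>sqrt lam\<close> around \<open>m\<close> only by
    \<open>1 + O(kap / sqrt lam)\<close>.\<close>
  define m where "m = nat \<lfloor>lam\<rfloor>"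
  have lam0: "lam > 0" "sqrt lam \<ge> 1" using lam by auto
  have sq: "sqrt lam * sqrt lam = lam" using lam0 by simp
  have s: "0 < s" "s \<le> 1" "s * s * lam = 1" using lam0 sq by (auto simp: s_def divide_simps)
  have th0: "0 \<le> th" using kap lam0 by (simp add: th_def)
  have ths: "th \<le> s"
  proof -
    have "2 * kap / lam \<le> sqrt lam / lam" using kap lam0 by (intro divide_right_mono) auto
    also have "\<dots> = s" using sq lam0 by (simp add: s_def divide_simps)
    finally show ?thesis by (simp add: th_def)
  qed
  have "th = 2 * (kap / lam)" by (simp add: th_def)
  then have kl: "0 \<le> kap / lam" "kap / lam \<le> 1/2" using th0 ths s by linarith+
  have canc: "exp u * (exp (- u) * x) = x" for u x :: real by (simp add: exp_minus)
  have e1: "exp (- th) \<le> 1 - kap / lam"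
  proof -
    have "exp (- th) = 1 / exp th" by (simp add: exp_minus inverse_eq_divide)
    also have "\<dots> \<le> 1 / (1 + th)" using th0 exp_ge_add_one_self[of th] by (intro frac_le) auto
    also have "\<dots> \<le> 1 - kap / lam"
    proof -
      define x where "x = kap / lam"
      have x: "0 \<le> x" "x \<le> 1/2" "th = 2 * x" using kl by (auto simp: x_def th_def)
      have "x * x \<le> 1/2 * x" using x by (intro mult_right_mono) auto
      then have "1 \<le> (1 - x) * (1 + 2 * x)" by (simp add: algebra_simps)
      then show ?thesis using x unfolding x_def[symmetric] by (simp add: divide_le_eq)
    qed
    finally show ?thesis .
  qed
  have e2: "1 + kap / lam \<le> exp th"
  proof -
    have "1 + kap / lam \<le> 1 + th" using kl by (simp add: th_def)
    also have "\<dots> \<le> exp th" by (rule exp_ge_add_one_self)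
    finally show ?thesis .
  qed
  have a0: "a k > 0" for k using lam0 by (simp add: a_def)
  have aS: "a (k + 1) = a k * lam / real (k + 1)" for k by (simp add: a_def divide_simps)
  have fr: "f k = r k * a k" for k using a0[of k] by (simp add: r_def)
  have r0: "r 0 = 1" by (simp add: r_def a_def f0)
  have rnn: "0 \<le> r k" for k using fnn a0[of k] by (simp add: r_def)
  have rS: "r (k + 1) * lam = real (k + 1) * f (k + 1) / a k" for k
    using a0[of k] lam0 unfolding r_def aS by (simp add: divide_simps)
  have rlo: "exp (- th) * r k \<le> r (k + 1)" if "real k \<le> 2 * lam" for k
  proof -
    have "(lam - kap) * f k / a k \<le> r (k + 1) * lam" unfolding rS using lo[OF that] a0[of k] by (intro divide_right_mono) auto
    then have "(1 - kap / lam) * r k \<le> r (k + 1)" using lam0 a0[of k] by (simp add: r_def field_simps)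
    moreover have "exp (- th) * r k \<le> (1 - kap / lam) * r k" using e1 rnn by (intro mult_right_mono)
    ultimately show ?thesis by linarith
  qed
  have rup: "r (k + 1) \<le> exp th * r k" for k
  proof -
    have "r (k + 1) * lam \<le> (lam + kap) * f k / a k" unfolding rS using up[of k] a0[of k] by (intro divide_right_mono) auto
    then have "r (k + 1) \<le> (1 + kap / lam) * r k" using lam0 a0[of k] by (simp add: r_def field_simps)
    moreover have "(1 + kap / lam) * r k \<le> exp th * r k" using e2 rnn by (intro mult_right_mono)
    ultimately show ?thesis by linarith
  qed
  have upj: "r (k + j) \<le> exp (th * real j) * r k" for k j
  proof (induction j)
    case (Suc j)
    have "r (k + Suc j) \<le> exp th * r (k + j)" using rup[of "k + j"] by simp
    also have "\<dots> \<le> exp th * (exp (th * real j) * r k)" using Suc.IH by (intro mult_left_mono) auto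
    finally have "r (k + Suc j) \<le> exp th * (exp (th * real j) * r k)" .
    moreover have "exp (th * real (Suc j)) = exp th * exp (th * real j)" unfolding exp_add[symmetric] by (simp add: algebra_simps)
    ultimately show ?case by (simp add: mult.assoc)
  qed simp
  have loj: "exp (- th * real j) * r k \<le> r (k + j)" if "real (k + j) \<le> 2 * lam" for k j
    using that
  proof (induction j)
    case (Suc j)
    have "exp (- th * real (Suc j)) * r k = exp (- th) * (exp (- th * real j) * r k)"
      unfolding mult.assoc[symmetric] exp_add[symmetric] by (simp add: algebra_simps)
    also have "\<dots> \<le> exp (- th) * r (k + j)" using Suc by (intro mult_left_mono) auto
    also have "\<dots> \<le> r (k + j + 1)" using Suc.prems by (intro rlo) auto
    finally show ?case by simp
  qed simp
  have ml: "real m \<le> lam" "lam < real m + 1" using lam0 unfolding m_def by linarith+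
  \<comment> \<open>The drift accumulated from \<open>r 0 = 1\<close> over at most
    \<open>lam\<close> steps. It is harmless as a constant factor, but it enters the lower bound for
    the total.\<close>
  have rm: "exp (- 2 * kap) \<le> r m"
  proof -
    have "th * real m \<le> th * lam" using ml th0 by (intro mult_left_mono) auto
    also have "\<dots> = 2 * kap" using lam0 by (simp add: th_def)
    finally have "exp (- 2 * kap) \<le> exp (- th * real m)" by simp
    also have "\<dots> \<le> r m" using loj[of 0 m] r0 ml lam0 by simp
    finally show ?thesis .
  qed
  have rm0: "r m > 0" using rm by (smt (verit) exp_gt_zero)
  define ab where "ab k = \<bar>real k - real m\<bar>" for k
  have R1: "r k \<le> r m * exp (th * ab k)" for k
  proof (cases "m \<le> k")
    case True
    then obtain j where j: "k = m + j" using le_Suc_ex by blast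
    then show ?thesis using upj[of m j] by (simp add: ab_def mult.commute)
  next
    case False
    then obtain j where j: "m = k + j" using le_Suc_ex by (metis nat_le_linear)
    have "exp (- (th * real j)) * r k \<le> r m" using loj[of k j] j ml lam0 by auto
    then have "exp (th * real j) * (exp (- (th * real j)) * r k) \<le> exp (th * real j) * r m" by (intro mult_left_mono) auto
    moreover have "ab k = real j" using j by (simp add: ab_def)
    ultimately show ?thesis unfolding canc by (simp only: mult.commute)
  qed
  have R2: "r m \<le> r k * exp (th * ab k)" if "real k \<le> 2 * lam" for k
  proof (cases "m \<le> k")
    case True
    then obtain j where j: "k = m + j" using le_Suc_ex by blast
    have "exp (- (th * real j)) * r m \<le> r k" using loj[of m j] j that by auto
    then have "exp (th * real j) * (exp (- (th * real j)) * r m) \<le> exp (th * real j) * r k" by (intro mult_left_mono) auto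
    moreover have "ab k = real j" using j by (simp add: ab_def)
    ultimately show ?thesis unfolding canc by (simp only: mult.commute)
  next
    case False
    then obtain j where j: "m = k + j" using le_Suc_ex by (metis nat_le_linear)
    then show ?thesis using upj[of k j] by (simp add: ab_def mult.commute)
  qed
  define B where "B k = th / s * (exp s * (exp (s * (real k - lam)) + exp (- s * (real k - lam)))) + exp (s * (real k - 2 * lam))" for k
  have dev: "\<bar>r k - r m\<bar> \<le> r m * B k" for k
  proof -
    have ab0: "0 \<le> ab k" by (simp add: ab_def)
    have abl: "ab k \<le> \<bar>real k - lam\<bar> + 1" using ml unfolding ab_def by linarith
    have "exp (th * ab k) - 1 \<le> th / s * (exp (s * ab k) - 1)" by (rule exp_scaled_minus_one[OF th0 ths s(1) ab0])
    also have "\<dots> \<le> th / s * (exp s * (exp (s * (real k - lam)) + exp (- s * (real k - lam))))"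
    proof (rule mult_left_mono)
      have "s * ab k \<le> s * (\<bar>real k - lam\<bar> + 1)" using abl s by (intro mult_left_mono) auto
      then have "exp (s * ab k) \<le> exp s * exp (s * \<bar>real k - lam\<bar>)" by (simp add: mult_exp_exp algebra_simps)
      also have "exp (s * \<bar>real k - lam\<bar>) \<le> exp (s * (real k - lam)) + exp (- s * (real k - lam))"
        by (cases "real k \<le> lam") (auto simp: abs_if algebra_simps add_increasing add_increasing2)
      finally show "exp (s * ab k) - 1 \<le> exp s * (exp (s * (real k - lam)) + exp (- s * (real k - lam)))" by simp
    qed (use th0 s in simp)
    finally have E: "exp (th * ab k) - 1 \<le> th / s * (exp s * (exp (s * (real k - lam)) + exp (- s * (real k - lam))))" .
    have u: "r k - r m \<le> r m * (exp (th * ab k) - 1)" using R1[of k] by (simp add: algebra_simps)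
    have l: "r m - r k \<le> r m * (exp (th * ab k) - 1 + exp (s * (real k - 2 * lam)))"
    proof (cases "real k \<le> 2 * lam")
      case True
      let ?z = "exp (th * ab k)"
      have z1: "?z \<ge> 1" using th0 ab0 by simp
      have "r m / ?z \<le> r k" using R2[OF True] z1 by (simp add: divide_le_eq)
      moreover have "1 - 1 / ?z \<le> ?z - 1"
      proof -
        have "0 \<le> (?z - 1)\<^sup>2 / ?z" using z1 by simp
        also have "(?z - 1)\<^sup>2 / ?z = ?z - 2 + 1 / ?z" using z1 by (simp add: power2_eq_square field_simps)
        finally show ?thesis by simp
      qed
      then have "r m * (1 - 1 / ?z) \<le> r m * (?z - 1)" using rm0 by (intro mult_left_mono) auto
      ultimately have "r m - r k \<le> r m * (?z - 1)" by (simp add: algebra_simps)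
      also have "\<dots> \<le> r m * (?z - 1 + exp (s * (real k - 2 * lam)))" using rm0 by simp
      finally show ?thesis .
    next
      case False
      then have "1 \<le> exp (s * (real k - 2 * lam))" using s by simp
      moreover have "0 \<le> exp (th * ab k) - 1" using th0 ab0 by simp
      ultimately have "1 \<le> exp (th * ab k) - 1 + exp (s * (real k - 2 * lam))" by linarith
      then have "r m * 1 \<le> r m * (exp (th * ab k) - 1 + exp (s * (real k - 2 * lam)))" by (rule mult_left_mono) (use rm0 in simp)
      then show ?thesis using rnn[of k] by linarith
    qed
    have "r m * (exp (th * ab k) - 1) \<le> r m * B k" "r m * (exp (th * ab k) - 1 + exp (s * (real k - 2 * lam))) \<le> r m * B k"
      unfolding B_def using E rm0 by (auto intro!: mult_left_mono add_increasing2)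
    then show ?thesis using u l by linarith
  qed
  have aB: "(\<lambda>k. a k * B k) sums (th / s * (exp s * (exp (- s * lam) * exp (lam * exp s) + exp (s * lam) * exp (lam * exp (- s)))) + exp (- 2 * s * lam) * exp (lam * exp s))"
  proof -
    have h1: "(\<lambda>k. lam ^ k / fact k * exp (s * real k)) sums exp (lam * exp s)" by (rule exp_weight_sums)
    have h2: "(\<lambda>k. lam ^ k / fact k * exp (- s * real k)) sums exp (lam * exp (- s))" by (rule exp_weight_sums)
    have "(\<lambda>k. th / s * (exp s * (exp (- s * lam) * (lam ^ k / fact k * exp (s * real k)) + exp (s * lam) * (lam ^ k / fact k * exp (- s * real k))))
       + exp (- 2 * s * lam) * (lam ^ k / fact k * exp (s * real k)))
       sums (th / s * (exp s * (exp (- s * lam) * exp (lam * exp s) + exp (s * lam) * exp (lam * exp (- s)))) + exp (- 2 * s * lam) * exp (lam * exp s))"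
      by (intro sums_add sums_mult h1 h2)
    moreover have "th / s * (exp s * (exp (- s * lam) * (lam ^ k / fact k * exp (s * real k)) + exp (s * lam) * (lam ^ k / fact k * exp (- s * real k))))
       + exp (- 2 * s * lam) * (lam ^ k / fact k * exp (s * real k)) = a k * B k" for k
    proof -
      have "exp (s * (real k - lam)) = exp (- s * lam) * exp (s * real k)" "exp (- s * (real k - lam)) = exp (s * lam) * exp (- s * real k)"
        "exp (s * (real k - 2 * lam)) = exp (- 2 * s * lam) * exp (s * real k)"
        by (simp_all add: mult_exp_exp algebra_simps)
      then show ?thesis unfolding B_def a_def by (simp only:) (simp add: algebra_simps)
    qed
    ultimately show ?thesis by (simp only:)
  qed
  \<comment> \<open>Since \<open>lam * s\<^sup>2 = 1\<close>, each centred exponential moment is at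
    most \<open>exp 1\<close> times \<open>exp lam\<close>. With \<open>exp s \<le> exp 1\<close>
    the first part costs \<open>2 * exp 1 * exp 1 \<le> 15\<close> times
    \<open>th / s = 2 * kap / sqrt lam\<close>, hence \<open>30 * kap\<close>; the second is at most
    \<open>3 / sqrt lam\<close>.\<close>
  have Ssum: "th / s * (exp s * (exp (- s * lam) * exp (lam * exp s) + exp (s * lam) * exp (lam * exp (- s)))) + exp (- 2 * s * lam) * exp (lam * exp s) \<le> exp lam * del"
  proof -
    have es: "exp s \<le> 1 + s + s\<^sup>2" using exp_bound s by simp
    have ems: "exp (- s) \<le> 1 - s + s\<^sup>2"
    proof -
      have "exp (- s) = 1 / exp s" by (simp add: exp_minus inverse_eq_divide)
      also have "\<dots> \<le> 1 / (1 + s)" using s exp_ge_add_one_self[of s] by (intro frac_le) auto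
      also have "\<dots> \<le> 1 - s + s\<^sup>2"
      proof -
        have "(1 - s + s\<^sup>2) * (1 + s) = 1 + s * s * s" by (simp add: power2_eq_square algebra_simps)
        moreover have "0 \<le> s * s * s" using s by simp
        ultimately show ?thesis using s by (simp add: divide_le_eq)
      qed
      finally show ?thesis .
    qed
    have ss: "lam * s\<^sup>2 = 1" using s(3) by (simp add: power2_eq_square mult_ac)
    have k1: "exp (- s * lam) * exp (lam * exp s) \<le> exp lam * exp 1"
    proof -
      have "lam * exp s \<le> lam * (1 + s + s\<^sup>2)" using es lam0 by (intro mult_left_mono) auto
      also have "\<dots> = lam + lam * s + 1" using ss by (simp add: algebra_simps)
      finally show ?thesis by (simp add: mult_exp_exp algebra_simps)
    qed
    have k2: "exp (s * lam) * exp (lam * exp (- s)) \<le> exp lam * exp 1"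
    proof -
      have "lam * exp (- s) \<le> lam * (1 - s + s\<^sup>2)" using ems lam0 by (intro mult_left_mono) auto
      also have "\<dots> = lam - lam * s + 1" using ss by (simp add: algebra_simps)
      finally show ?thesis by (simp add: mult_exp_exp algebra_simps)
    qed
    have k3: "exp (- 2 * s * lam) * exp (lam * exp s) \<le> exp lam * exp 1 * exp (- sqrt lam)"
    proof -
      have "s * lam = sqrt lam" using sq lam0 by (simp add: s_def divide_simps)
      then have "exp (- 2 * s * lam) * exp (lam * exp s) = exp (- sqrt lam) * (exp (- s * lam) * exp (lam * exp s))"
        by (simp add: mult_exp_exp algebra_simps)
      also have "\<dots> \<le> exp (- sqrt lam) * (exp lam * exp 1)" using k1 by (intro mult_left_mono) auto
      finally show ?thesis by (simp add: mult_ac)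
    qed
    have k4: "exp (- sqrt lam) \<le> 1 / sqrt lam"
    proof -
      have "sqrt lam \<le> exp (sqrt lam)" using exp_ge_add_one_self[of "sqrt lam"] by linarith
      then have "1 / exp (sqrt lam) \<le> 1 / sqrt lam" using lam0 by (intro divide_left_mono) auto
      then show ?thesis by (simp add: exp_minus inverse_eq_divide)
    qed
    have ee: "exp 1 \<le> (272/100::real)" by (rule e_less_272[THEN less_imp_le])
    have "th / s * (exp s * (exp (- s * lam) * exp (lam * exp s) + exp (s * lam) * exp (lam * exp (- s)))) \<le> th / s * (exp 1 * (exp lam * exp 1 + exp lam * exp 1))"
    proof (rule mult_left_mono)
      show "exp s * (exp (- s * lam) * exp (lam * exp s) + exp (s * lam) * exp (lam * exp (- s))) \<le> exp 1 * (exp lam * exp 1 + exp lam * exp 1)"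
        by (rule mult_mono[OF _ add_mono[OF k1 k2]]) (use s in \<open>simp_all add: add_nonneg_nonneg\<close>)
    qed (use th0 s in simp)
    also have "\<dots> = th / s * exp lam * (2 * (exp 1 * exp 1))" by (simp add: algebra_simps)
    also have "\<dots> \<le> th / s * exp lam * 15"
    proof (rule mult_left_mono)
      have "exp 1 * exp 1 \<le> (272/100::real) * (272/100)" using ee by (intro mult_mono) auto
      then show "2 * (exp 1 * exp 1) \<le> (15::real)" by simp
    qed (use th0 s in simp)
    finally have p1: "th / s * (exp s * (exp (- s * lam) * exp (lam * exp s) + exp (s * lam) * exp (lam * exp (- s)))) \<le> th / s * exp lam * 15" .
    have "exp lam * exp 1 * exp (- sqrt lam) \<le> exp lam * 3 * (1 / sqrt lam)" using k4 ee by (intro mult_mono) auto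
    then have p2: "exp (- 2 * s * lam) * exp (lam * exp s) \<le> exp lam * 3 * (1 / sqrt lam)" using k3 by linarith
    have p3: "th / s = 2 * kap / sqrt lam"
    proof -
      have "th / s = 2 * kap * sqrt lam / (sqrt lam * sqrt lam)" unfolding th_def s_def using sq by simp
      also have "\<dots> = 2 * kap / sqrt lam"
      proof -
        have "2 * kap * x / (x * x) = 2 * kap / x" if "x > 0" for x :: real using that by simp
        then show ?thesis using lam0 by (meson less_le_trans zero_less_one)
      qed
      finally show ?thesis .
    qed
    have "th / s * exp lam * 15 + exp lam * 3 * (1 / sqrt lam) = exp lam * del" unfolding p3 del(1) by (simp add: add_divide_distrib algebra_simps)
    then show ?thesis using p1 p2 by linarith
  qed
  define D where "D k = (r k - r m) * a k" for k
  have Dle: "\<bar>D k\<bar> \<le> r m * (a k * B k)" for k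
    unfolding D_def abs_mult using mult_right_mono[OF dev[of k], of "a k"] a0[of k] by (simp add: mult_ac)
  have sumB: "summable (\<lambda>k. r m * (a k * B k))" using aB by (intro summable_mult) (rule sums_summable)
  have totB: "(\<Sum>k. r m * (a k * B k)) \<le> r m * (exp lam * del)"
    using aB Ssum rm0 by (simp add: suminf_mult[OF sums_summable[OF aB]] sums_iff mult_left_mono)
  have sumD: "summable (\<lambda>k. if k \<in> S then D k else 0)" for S
    by (rule summable_comparison_test'[OF sumB, of 0]) (use Dle order_trans[OF abs_ge_zero Dle] in auto)
  have Dtot: "\<bar>\<Sum>k. if k \<in> S then D k else 0\<bar> \<le> r m * (exp lam * del)" for S
  proof -
    have s1: "summable (\<lambda>k. \<bar>if k \<in> S then D k else 0\<bar>)"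
      by (rule summable_comparison_test'[OF sumB, of 0]) (use Dle order_trans[OF abs_ge_zero Dle] in auto)
    have "\<bar>\<Sum>k. if k \<in> S then D k else 0\<bar> \<le> (\<Sum>k. \<bar>if k \<in> S then D k else 0\<bar>)" by (rule summable_rabs[OF s1])
    also have "\<dots> \<le> (\<Sum>k. r m * (a k * B k))"
      by (rule suminf_le[OF _ s1 sumB]) (use Dle order_trans[OF abs_ge_zero Dle] in auto)
    finally show ?thesis using totB by linarith
  qed
  \<comment> \<open>As \<open>f\<close> vanishes beyond \<open>n\<close>, the finite sum is a full
    series: the Poisson probability with normalisation \<open>r m * exp lam\<close>, plus the
    deviations.\<close>
  have key: "(\<Sum>k\<in>S \<inter> {..n}. f k) = (\<Sum>k. if k \<in> S then D k else 0) + r m * (exp lam * measure_pmf.prob (poisson_pmf lam) S)" for S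
  proof -
    have "(\<lambda>k. if k \<in> S then pmf (poisson_pmf lam) k else 0) sums measure_pmf.prob (poisson_pmf lam) S" by (rule measure_pmf_sums_nat)
    then have "(\<lambda>k. r m * (exp lam * (if k \<in> S then pmf (poisson_pmf lam) k else 0))) sums (r m * (exp lam * measure_pmf.prob (poisson_pmf lam) S))"
      by (intro sums_mult)
    then have "(\<lambda>k. (if k \<in> S then D k else 0) + r m * (exp lam * (if k \<in> S then pmf (poisson_pmf lam) k else 0)))
      sums ((\<Sum>k. if k \<in> S then D k else 0) + r m * (exp lam * measure_pmf.prob (poisson_pmf lam) S))"
      by (intro sums_add summable_sums sumD)
    moreover have "(if k \<in> S then D k else 0) + r m * (exp lam * (if k \<in> S then pmf (poisson_pmf lam) k else 0)) = (if k \<in> S \<inter> {..n} then f k else 0)" for k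
    proof -
      have "exp lam * pmf (poisson_pmf lam) k = a k"
        using lam0 by (simp add: a_def mult_exp_exp exp_minus)
      then show ?thesis using fin[of k] by (auto simp: D_def fr algebra_simps not_le)
    qed
    ultimately have "(\<lambda>k. if k \<in> S \<inter> {..n} then f k else 0) sums ((\<Sum>k. if k \<in> S then D k else 0) + r m * (exp lam * measure_pmf.prob (poisson_pmf lam) S))"
      by (simp only:)
    moreover have "(\<lambda>k. if k \<in> S \<inter> {..n} then f k else 0) sums (\<Sum>k\<in>S \<inter> {..n}. f k)" by (rule sums_If_finite_set) simp
    ultimately show ?thesis using sums_unique2 by blast
  qed
  define E where "E = r m * exp lam"
  have E0: "E > 0" using rm0 by (simp add: E_def)
  have tot: "(\<Sum>k\<le>n. f k) = (\<Sum>k. if k \<in> UNIV then D k else 0) + E" using key[of UNIV] by (simp add: E_def)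
  have DU: "\<bar>\<Sum>k. if k \<in> S then D k else 0\<bar> \<le> E * del" for S using Dtot[of S] by (simp add: E_def mult_ac)
  have "E * del \<le> E * (1/2)" using E0 del(2) by (intro mult_left_mono) auto
  then have F: "E / 2 \<le> (\<Sum>k\<le>n. f k)" using tot DU[of UNIV] by linarith
  show "exp lam * exp (- 2 * kap) / 2 \<le> (\<Sum>k\<le>n. f k)"
  proof -
    have "exp (- 2 * kap) * exp lam \<le> E" unfolding E_def using rm by (intro mult_right_mono) auto
    then show ?thesis using F by (simp add: mult.commute)
  qed
  let ?P = "measure_pmf.prob (poisson_pmf lam) A"
  have P: "0 \<le> ?P" "?P \<le> 1" by auto
  have del0: "0 \<le> del" unfolding del(1) using kap lam0 by simp
  have "(\<Sum>k\<in>A \<inter> {..n}. f k) - (\<Sum>k\<le>n. f k) * ?P = (\<Sum>k. if k \<in> A then D k else 0) - (\<Sum>k. if k \<in> UNIV then D k else 0) * ?P"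
    unfolding tot key[of A] E_def by (simp add: algebra_simps)
  also have "\<bar>\<dots>\<bar> \<le> E * del + E * del"
  proof -
    have "\<bar>(\<Sum>k. if k \<in> UNIV then D k else 0) * ?P\<bar> \<le> E * del * 1" unfolding abs_mult using DU[of UNIV] P by (intro mult_mono) auto
    then show ?thesis using DU[of A] by linarith
  qed
  also have "\<dots> = 4 * del * (E / 2)" by simp
  also have "\<dots> \<le> 4 * del * (\<Sum>k\<le>n. f k)" using F del0 by (intro mult_left_mono) auto
  finally show "\<bar>(\<Sum>k\<in>A \<inter> {..n}. f k) - (\<Sum>k\<le>n. f k) * ?P\<bar> \<le> 4 * del * (\<Sum>k\<le>n. f k)" .
qed

section \<open>The theorem\<close>

definition minside :: "nat \<Rightarrow> nat set set \<Rightarrow> nat" where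
  "minside d S = min (card (S \<inter> side d True)) (card (S \<inter> side d False))"

lemma indep_sets_nonempty:
  assumes "F \<subseteq> cube_edges d" shows "indep_sets d F \<noteq> {}"
proof -
  have "{} \<in> indep_sets d F" using assms unfolding indep_sets_def cube_edges_def by blast
  then show ?thesis by auto
qed

lemma prob_DefectSize:
  assumes F: "F \<subseteq> cube_edges d"
  shows "measure_pmf.prob (DefectSize d F) K = real (card {S \<in> indep_sets d F. minside d S \<in> K}) / real (card (indep_sets d F))"
proof -
  have e: "Even_v d = side d True" "Odd_v d = side d False" unfolding Even_v_def Odd_v_def side_def by auto
  have D: "DefectSize d F = map_pmf (minside d) (pmf_of_set (indep_sets d F))"
    unfolding DefectSize_def UniformSampler_def minside_def e ..
  have "indep_sets d F \<inter> minside d -` K = {S \<in> indep_sets d F. minside d S \<in> K}" by auto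
  then show ?thesis unfolding D
    using measure_pmf_of_set[OF indep_sets_nonempty[OF F] finite_indep] by simp
qed

text \<open>If some side is spread and \<open>S\<close> is not in \<open>smalls\<close>, the other
  side has more than \<open>N / d\<close> vertices. It is therefore not spread, and the spread side
  is the minimum; such \<open>S\<close> is counted exactly once and correctly. Any other
  \<open>S\<close> is miscounted by at most 2.\<close>

lemma class_count_error:
  fixes K :: "nat set"
  assumes d: "d \<ge> 2" and F: "F \<subseteq> cube_edges d"
  shows "\<bar>real (card {S \<in> indep_sets d F. minside d S \<in> K})
      - (real (card {S \<in> indep_sets d F. spread (cube_nb d) (S \<inter> side d True) \<and> card (S \<inter> side d True) \<in> K})
       + real (card {S \<in> indep_sets d F. spread (cube_nb d) (S \<inter> side d False) \<and> card (S \<inter> side d False) \<in> K}))\<bar>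
    \<le> 2 * (real (badcount d F) + real (card (smalls d)))"
proof -
  let ?I = "indep_sets d F"
  let ?sp = "\<lambda>b S. spread (cube_nb d) (S \<inter> side d b) \<and> card (S \<inter> side d b) \<in> K"
  let ?bad = "\<lambda>S. \<not> spread (cube_nb d) (S \<inter> side d True) \<and> \<not> spread (cube_nb d) (S \<inter> side d False)"
  have fI: "finite ?I" by (rule finite_indep)
  have cnt: "real (card {S \<in> ?I. P S}) = (\<Sum>S\<in>?I. if P S then 1 else 0)" for P
  proof -
    have "(\<Sum>S\<in>?I. if P S then 1 else (0::real)) = (\<Sum>S\<in>?I. if S \<in> {S. P S} then 1 else 0)" by simp
    also have "\<dots> = (\<Sum>S\<in>?I \<inter> {S. P S}. 1)" by (subst sum.inter_restrict[OF fI]) simp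
    also have "?I \<inter> {S. P S} = {S \<in> ?I. P S}" by auto
    finally show ?thesis by simp
  qed
  have fs: "finite (smalls d)" unfolding smalls_def using finite_cube by (auto intro: finite_subset[of _ "Pow (cube d)"])
  have pt: "\<bar>(if minside d S \<in> K then 1 else 0) - ((if ?sp True S then 1 else 0) + (if ?sp False S then 1 else 0))\<bar>
     \<le> 2 * (if ?bad S then 1 else 0) + 2 * (if S \<in> smalls d then 1 else (0::real))" if S: "S \<in> ?I" for S
  proof (cases "?bad S \<or> S \<in> smalls d")
    case True
    then show ?thesis by (auto split: if_splits)
  next
    case False
    have d1: "d \<ge> 1" using d by simp
    have Sc: "S \<subseteq> cube d" using S unfolding indep_sets_def by auto
    have sl: "d * card (S \<inter> side d b) \<le> 2 ^ (d - 1)" if "spread (cube_nb d) (S \<inter> side d b)" for b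
      by (rule card_spread_le[OF d1 _ that]) auto
    have lt: "card (S \<inter> side d b) < card (S \<inter> side d c)" if "spread (cube_nb d) (S \<inter> side d b)" "\<not> d * card (S \<inter> side d c) \<le> 2 ^ (d - 1)" for b c
    proof -
      have "d * card (S \<inter> side d b) < d * card (S \<inter> side d c)" using sl[OF that(1)] that(2) by linarith
      then show ?thesis by simp
    qed
    consider (t) "spread (cube_nb d) (S \<inter> side d True)" "\<not> d * card (S \<inter> side d False) \<le> 2 ^ (d - 1)"
      | (f) "spread (cube_nb d) (S \<inter> side d False)" "\<not> d * card (S \<inter> side d True) \<le> 2 ^ (d - 1)"
      using False sl Sc unfolding smalls_def by blast
    then show ?thesis
    proof cases
      case t
      then have "\<not> spread (cube_nb d) (S \<inter> side d False)" using sl by blast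
      moreover have "minside d S = card (S \<inter> side d True)" using lt[OF t] unfolding minside_def by simp
      ultimately show ?thesis using t by simp
    next
      case f
      then have "\<not> spread (cube_nb d) (S \<inter> side d True)" using sl by blast
      moreover have "minside d S = card (S \<inter> side d False)" using lt[OF f] unfolding minside_def by simp
      ultimately show ?thesis using f by simp
    qed
  qed
  have "\<bar>real (card {S \<in> ?I. minside d S \<in> K}) - (real (card {S \<in> ?I. ?sp True S}) + real (card {S \<in> ?I. ?sp False S}))\<bar>
    = \<bar>\<Sum>S\<in>?I. (if minside d S \<in> K then 1 else 0) - ((if ?sp True S then 1 else 0) + (if ?sp False S then 1 else 0))\<bar>"
    unfolding cnt by (simp only: sum_subtractf sum.distrib)
  also have "\<dots> \<le> (\<Sum>S\<in>?I. 2 * (if ?bad S then 1 else 0) + 2 * (if S \<in> smalls d then 1 else (0::real)))"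
    by (rule order_trans[OF sum_abs]) (rule sum_mono[OF pt])
  also have "\<dots> = 2 * real (badcount d F) + 2 * real (card {S \<in> ?I. S \<in> smalls d})"
    unfolding badcount_def cnt by (simp only: sum.distrib sum_distrib_left)
  also have "card {S \<in> ?I. S \<in> smalls d} \<le> card (smalls d)" using fs by (intro card_mono) auto
  finally show ?thesis by simp
qed

text \<open>The count for an event and the total number of independent sets are both compared with
  multiples of \<open>G\<close>. Errors of \<open>4 * eta * G + 4 * del * G\<close> over a total of
  at least \<open>G / 2\<close> give the factor 8.\<close>

lemma tv_dist_typical:
  fixes p :: real
  assumes d: "d \<ge> 2" and p: "2/3 \<le> p" "p < 1" and F: "F \<subseteq> cube_edges d" and ty: "typical d p F"
    and lam: "lam = (1/2) * (2 - p) ^ d" and a1: "1 \<le> lam" and a2: "2 * sqrt (real d) \<le> sqrt lam" and a3: "sqrt (real d) \<le> lam / 2"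
    and del: "del = (30 * sqrt (real d) + 3) / sqrt lam" "del \<le> 1/2"
    and eta: "eta = 2 * exp (2 * sqrt (real d)) * (exp (- real d / 40) + exp (2 * (2 ^ (d - 1) / real d * (ln (real d) + 1)) - 2 ^ (d - 1) * ln 2))"
    and eta4: "eta \<le> 1/4"
  shows "tv_dist (DefectSize d F) (poisson_pmf lam) \<le> 8 * eta + 8 * del"
proof -
  let ?I = "indep_sets d F"
  define N :: nat where "N = 2 ^ (d - 1)"
  define M :: real where "M = 2 ^ N"
  define f where "f b = spread_weight d b F" for b
  define bs where "bs = real (badcount d F) + real (card (smalls d))"
  define Z where "Z = real (card ?I)"
  define G where "G = M * (\<Sum>k\<le>N. f True k) + M * (\<Sum>k\<le>N. f False k)"
  let ?kap = "sqrt (real d)"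
  have d1: "d \<ge> 1" using d by simp
  have cN: "card (side d b) = N" for b using card_side[of "d - 1" b] d by (simp add: N_def)
  have M0: "M > 0" unfolding M_def by simp
  have dv: "4 * pair_weight d b F + \<bar>total_weight d b F - lam\<bar> \<le> ?kap" for b
    using ty unfolding typical_def dev_def lam by (cases b) auto
  have lo: "(lam - ?kap) * f b k \<le> real (k + 1) * f b (k + 1)" if "real k \<le> 2 * lam" for b k
    unfolding f_def using a1 a3 dv[of b] that by (intro spread_weight_ratio[OF d1]) auto
  have up: "real (k + 1) * f b (k + 1) \<le> (lam + ?kap) * f b k" for b k
  proof -
    have "total_weight d b F \<le> lam + ?kap" using dv[of b] pair_weight_nonneg[of d b F] by linarith
    then have "total_weight d b F * f b k \<le> (lam + ?kap) * f b k" unfolding f_def by (intro mult_right_mono spread_weight_nonneg)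
    then show ?thesis using spread_weight_upper[of k d b F] unfolding f_def by linarith
  qed
  have fin: "f b k = 0" if "N < k" for b k unfolding f_def using that cN by (intro spread_weight_large) simp
  have kap0: "0 \<le> ?kap" by simp
  have pc: "\<bar>(\<Sum>k\<in>K \<inter> {..N}. f b k) - (\<Sum>k\<le>N. f b k) * measure_pmf.prob (poisson_pmf lam) K\<bar> \<le> 4 * del * (\<Sum>k\<le>N. f b k)" for K b
    by (rule poisson_comparison(1)[OF a1 kap0 a2 _ _ fin lo up del]) (auto simp: f_def spread_weight_0 spread_weight_nonneg)
  have low: "exp lam * exp (- 2 * ?kap) / 2 \<le> (\<Sum>k\<le>N. f b k)" for b
    by (rule poisson_comparison(2)[OF a1 kap0 a2 _ _ fin lo up del]) (auto simp: f_def spread_weight_0 spread_weight_nonneg)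
  have cls: "real (card {S \<in> ?I. spread (cube_nb d) (S \<inter> side d b) \<and> card (S \<inter> side d b) \<in> K}) = M * (\<Sum>k\<in>K \<inter> {..N}. f b k)" for b K
    using card_spread_class[OF F, of b N K] cN unfolding M_def f_def by simp
  have G1: "M * (exp lam * exp (- 2 * ?kap) / 2) \<le> G"
  proof -
    have "M * (exp lam * exp (- 2 * ?kap) / 2) \<le> M * (\<Sum>k\<le>N. f True k)" using low M0 by (intro mult_left_mono) auto
    moreover have "0 \<le> M * (\<Sum>k\<le>N. f False k)" unfolding f_def using M0 spread_weight_nonneg by (intro mult_nonneg_nonneg sum_nonneg) auto
    ultimately show ?thesis unfolding G_def by linarith
  qed
  have G0: "G > 0" using G1 M0 by (smt (verit) exp_gt_zero half_gt_zero mult_pos_pos)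
  \<comment> \<open>The drift factor in the lower bound \<open>G1\<close> for \<open>G\<close> is
    what puts \<open>2 * exp (2 * sqrt d)\<close> into \<open>eta\<close>.\<close>
  have bsG: "bs \<le> eta * G"
  proof -
    have "real (badcount d F) \<le> M * (exp lam * exp (- real d / 40))"
      using ty unfolding typical_def M_def N_def lam by simp
    moreover have "real (card (smalls d)) \<le> M * (exp lam * exp (2 * (2 ^ (d - 1) / real d * (ln (real d) + 1)) - 2 ^ (d - 1) * ln 2))"
    proof -
      have Me: "M = exp (2 ^ (d - 1) * ln 2)"
      proof -
        have "exp (real N * ln 2) = exp (ln 2) ^ N" by (rule exp_of_nat_mult)
        then show ?thesis unfolding M_def by (simp add: N_def)
      qed
      have "real (card (smalls d)) \<le> exp (2 * (2 ^ (d - 1) / real d * (ln (real d) + 1)))" by (rule card_smalls[OF d1])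
      also have "\<dots> = M * (1 * exp (2 * (2 ^ (d - 1) / real d * (ln (real d) + 1)) - 2 ^ (d - 1) * ln 2))"
        unfolding Me mult_1_left exp_add[symmetric] by simp
      also have "\<dots> \<le> M * (exp lam * exp (2 * (2 ^ (d - 1) / real d * (ln (real d) + 1)) - 2 ^ (d - 1) * ln 2))"
        using M0 a1 by (intro mult_left_mono mult_right_mono) auto
      finally show ?thesis .
    qed
    ultimately have "bs \<le> M * exp lam * (exp (- real d / 40) + exp (2 * (2 ^ (d - 1) / real d * (ln (real d) + 1)) - 2 ^ (d - 1) * ln 2))"
      unfolding bs_def by (simp add: algebra_simps)
    also have "\<dots> = eta * (M * (exp lam * exp (- 2 * ?kap) / 2))"
    proof -
      have r: "2 * x * y * (M * (l * x' / 2)) = M * l * y * (x * x')" for x x' y l :: real by (simp add: mult_ac)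
      have "exp (2 * ?kap) * exp (- 2 * ?kap) = 1" by (simp add: mult_exp_exp)
      then show ?thesis unfolding eta r by simp
    qed
    also have "\<dots> \<le> eta * G" using G1 by (intro mult_left_mono) (auto simp: eta)
    finally show ?thesis .
  qed
  have bs4: "4 * bs \<le> G"
  proof -
    have "eta * G \<le> 1/4 * G" using eta4 G0 by (intro mult_right_mono) auto
    then show ?thesis using bsG by linarith
  qed
  have cc: "\<bar>real (card {S \<in> ?I. minside d S \<in> K}) - (M * (\<Sum>k\<in>K \<inter> {..N}. f True k) + M * (\<Sum>k\<in>K \<inter> {..N}. f False k))\<bar> \<le> 2 * bs" for K
    using class_count_error[OF d F, of K] unfolding cls bs_def .
  have ZG: "\<bar>Z - G\<bar> \<le> 2 * bs" using cc[of UNIV] unfolding Z_def G_def by simp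
  then have Zh: "G / 2 \<le> Z" using bs4 by linarith
  have Z0: "Z > 0" using Zh G0 by linarith
  have one: "\<bar>measure_pmf.prob (DefectSize d F) K - measure_pmf.prob (poisson_pmf lam) K\<bar> \<le> 8 * eta + 8 * del" for K
  proof -
    let ?P = "measure_pmf.prob (poisson_pmf lam) K"
    let ?n = "real (card {S \<in> ?I. minside d S \<in> K})"
    let ?g = "M * (\<Sum>k\<in>K \<inter> {..N}. f True k) + M * (\<Sum>k\<in>K \<inter> {..N}. f False k)"
    have P: "0 \<le> ?P" "?P \<le> 1" by auto
    have each: "\<bar>M * (\<Sum>k\<in>K \<inter> {..N}. f b k) - M * (\<Sum>k\<le>N. f b k) * ?P\<bar> \<le> 4 * del * (M * (\<Sum>k\<le>N. f b k))" for b
    proof -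
      have "\<bar>M * ((\<Sum>k\<in>K \<inter> {..N}. f b k) - (\<Sum>k\<le>N. f b k) * ?P)\<bar> \<le> M * (4 * del * (\<Sum>k\<le>N. f b k))"
        unfolding abs_mult using pc[where K = K and b = b] M0 by (simp add: mult_left_mono)
      then show ?thesis by (simp add: algebra_simps)
    qed
    have gP: "\<bar>?g - G * ?P\<bar> \<le> 4 * del * G"
      using each[of True] each[of False] unfolding G_def by (simp add: algebra_simps)
    have ZP: "\<bar>G * ?P - Z * ?P\<bar> \<le> 2 * bs"
    proof -
      have "\<bar>(G - Z) * ?P\<bar> \<le> 2 * bs * 1" unfolding abs_mult using ZG P by (intro mult_mono) auto
      then show ?thesis by (simp add: algebra_simps)
    qed
    have tot: "\<bar>?n - Z * ?P\<bar> \<le> 4 * bs + 4 * del * G" using cc[of K] gP ZP by linarith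
    have "measure_pmf.prob (DefectSize d F) K - ?P = (?n - Z * ?P) / Z"
      unfolding prob_DefectSize[OF F] Z_def[symmetric] using Z0 by (simp add: field_simps)
    then have "\<bar>measure_pmf.prob (DefectSize d F) K - ?P\<bar> = \<bar>?n - Z * ?P\<bar> / Z" using Z0 by simp
    also have "\<dots> \<le> (4 * eta * G + 4 * del * G) / (G / 2)"
    proof (rule frac_le)
      show "\<bar>?n - Z * ?P\<bar> \<le> 4 * eta * G + 4 * del * G" using tot bsG by linarith
      then show "0 \<le> 4 * eta * G + 4 * del * G" by linarith
    qed (use G0 Zh in auto)
    also have "\<dots> = 8 * eta + 8 * del" using G0 by (simp add: field_simps)
    finally show ?thesis .
  qed
  show ?thesis unfolding tv_dist_def by (rule cSUP_least) (auto simp: one)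
qed

theorem theorem1p2:
  fixes p \<epsilon> :: real
  assumes "2/3 \<le> p" and "p < 1" and "\<epsilon> > 0"
  shows "((\<lambda>d. perc_prob d p
            {F. tv_dist (DefectSize d F) (poisson_pmf ((1/2) * (2 - p) ^ d)) > \<epsilon>})
          \<longlongrightarrow> 0) sequentially"
proof -
  define c where "c = 2 - p"
  have c: "c > 1" using assms by (simp add: c_def)
  define del where "del d = (30 * sqrt (real d) + 3) / sqrt ((1/2) * c ^ d)" for d
  define eta where "eta d = 2 * exp (2 * sqrt (real d)) * (exp (- real d / 40) + exp (2 * (2 ^ (d - 1) / real d * (ln (real d) + 1)) - 2 ^ (d - 1) * ln 2))" for d
  have l1: "(del \<longlongrightarrow> 0) sequentially" unfolding del_def using c by real_asymp
  have l2: "(eta \<longlongrightarrow> 0) sequentially"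
  proof -
    have x1: "((\<lambda>d::nat. 2 * exp (2 * sqrt (real d)) * exp (- real d / 40)) \<longlongrightarrow> 0) sequentially" by real_asymp
    have x2: "((\<lambda>d::nat. 2 * exp (2 * sqrt (real d)) * exp (2 * (2 ^ d / 2 / real d * (ln (real d) + 1)) - 2 ^ d / 2 * ln 2)) \<longlongrightarrow> 0) sequentially" by real_asymp
    have "((\<lambda>d::nat. 2 * exp (2 * sqrt (real d)) * exp (- real d / 40) +
      2 * exp (2 * sqrt (real d)) * exp (2 * (2 ^ d / 2 / real d * (ln (real d) + 1)) - 2 ^ d / 2 * ln 2)) \<longlongrightarrow> 0) sequentially"
      using tendsto_add[OF x1 x2] by simp
    moreover have "eventually (\<lambda>d::nat. 2 * exp (2 * sqrt (real d)) * exp (- real d / 40) +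
      2 * exp (2 * sqrt (real d)) * exp (2 * (2 ^ d / 2 / real d * (ln (real d) + 1)) - 2 ^ d / 2 * ln 2) = eta d) sequentially"
      using eventually_ge_at_top[of 1]
    proof eventually_elim
      case (elim d)
      have "(2::real) ^ (d - 1) = 2 ^ d / 2" using elim by (cases d) auto
      then show ?case unfolding eta_def by (simp only: distrib_left)
    qed
    ultimately show ?thesis by (rule Lim_transform_eventually)
  qed
  have l3: "eventually (\<lambda>d::nat. 1 \<le> (1/2) * c ^ d) sequentially" using c by real_asymp
  have l4: "eventually (\<lambda>d::nat. 2 * sqrt (real d) \<le> sqrt ((1/2) * c ^ d)) sequentially" using c by real_asymp
  have l5: "eventually (\<lambda>d::nat. sqrt (real d) \<le> (1/2) * c ^ d / 2) sequentially" using c by real_asymp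
  have e1: "eventually (\<lambda>d. del d < min (1/2) (\<epsilon> / 32)) sequentially" using l1 assms(3) by (intro order_tendstoD(2)[OF l1]) auto
  have e2: "eventually (\<lambda>d. eta d < min (1/4) (\<epsilon> / 32)) sequentially" using l2 assms(3) by (intro order_tendstoD(2)[OF l2]) auto
  have bound: "eventually (\<lambda>d. perc_prob d p {F. tv_dist (DefectSize d F) (poisson_pmf ((1/2) * (2 - p) ^ d)) > \<epsilon>}
     \<le> perc_prob d p {F. \<not> typical d p F}) sequentially"
    using l3 l4 l5 e1 e2 eventually_ge_at_top[of 2]
  proof eventually_elim
    case (elim d)
    have "tv_dist (DefectSize d F) (poisson_pmf ((1/2) * (2 - p) ^ d)) \<le> \<epsilon>" if F: "F \<subseteq> cube_edges d" "typical d p F" for F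
    proof -
      have "tv_dist (DefectSize d F) (poisson_pmf ((1/2) * (2 - p) ^ d)) \<le> 8 * eta d + 8 * del d"
        by (rule tv_dist_typical[OF elim(6) assms(1,2) F refl, of "del d" "eta d"])
          (use elim in \<open>auto simp: del_def eta_def c_def\<close>)
      then show ?thesis using elim(4,5) assms(3) by simp
    qed
    then show ?case unfolding perc_prob_pexp using assms by (intro pexp_mono) (auto simp: not_le[symmetric])
  qed
  show ?thesis
    by (rule tendsto_sandwich[OF _ bound tendsto_const atypical_null[OF assms(1,2)]])
      (use assms in \<open>simp add: perc_prob_nonneg\<close>)
qed

end
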